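(* Let $n\geq 2$, let $\omega_1,\dots,\omega_n\in\mathbb{R}$ and $A=\mathrm{diag}(i\omega_1,\dots,i\omega_n)$. Let $D_1=\{z\in\mathbb{C}^n:|z_j|<1,\ 1\le j\le n\}$ and let $F:D_1\to\mathbb{C}^n$ be analytic with $F(z)=Az+f(z)$, $f(0)=0$, $Df(0)=0$. Assume $A$ is non-resonant and satisfies the Bruno-$s$ condition for some $s>0$ (or, when $n=2$, the one-dimensional Bruno-$s$ condition). Then for every sufficiently small $0<r_{**}<1$ there exist positive constants $A_{**},B_{**},C_{**}$ such that for every $z_0\in\mathbb{C}^n$ with $0<|z_0|<r_{**}/2$ the solution $z(t;z_0)$ of $\dot z=F(z)$, $z(0;z_0)=z_0$, is well defined and satisfies $|z(t;z_0)|\le C_{**}r_{**}$ for all real $t$ with $$|t|\le T_*=A_{**}^{-1}\exp\Big\{B_{**}\big(r_{**}/|z_0|\big)^{1/s}\Big\}.$$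
   Context: $|z|$ denotes the norm $\max_j|z_j|$ on $\mathbb{C}^n$; for $\alpha\in\mathbb{N}^n$, $|\alpha|=\alpha_1+\dots+\alpha_n$. $A=\mathrm{diag}(i\omega)$ is non-resonant if $\alpha\cdot\omega\neq\omega_j$ for all $\alpha\in\mathbb{N}^n$ with $|\alpha|\ge2$ and all $j\in\{1,\dots,n\}$. For an integer $p\geq 3$ let $\Omega(p)=\min\{|\alpha\cdot\omega-\omega_j|: 1\le j\le n,\ \alpha\in\mathbb{N}^n,\ 2\le|\alpha|<p\}$. Bruno-$s$ condition ($s>0$): there is a strictly increasing sequence of positive integers $(p_k)_{k\ge0}$ with $p_1\geq 3$ such that $$\limsup_{|\alpha|\to+\infty}\Big(2\sum_{m=0}^{\kappa(\alpha)}\frac{\log\Omega(p_{m+1})^{-1}}{p_m}-s\log|\alpha|\Big)<+\infty,$$ where $\kappa(\alpha)$ is defined by $p_{\kappa(\alpha)}\le|\alpha|<p_{\kappa(\alpha)+1}$. One-dimensional Bruno-$s$ condition (case $n=2$): $\omega_2\neq0$, $\omega:=-\omega_1/\omega_2$ is a positive irrational number, and $$\limsup_{N\to+\infty}\Big(\sum_{j=0}^{k(N)}\frac{\log q_{j+1}}{q_j}-s\log N\Big)<+\infty,$$ where $(q_j)_{j\ge0}$ are the denominators of the continued fraction convergents of $\omega$ and $k(N)$ is defined by $q_{k(N)}\le N<q_{k(N)+1}$. *)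

theory Defs
  imports "HOL-Analysis.Analysis"
begin

text \<open>Points of C^n are vectors of type complex^'n; the index type 'n is finite
  and linearly ordered (the order gives the labelling 1..n of the coordinates).\<close>

definition supnorm :: "complex^'n::finite \<Rightarrow> real" where
  "supnorm z = Max (range (\<lambda>j. cmod (z $ j)))"

definition unit_polydisc :: "(complex^'n::finite) set" where
  "unit_polydisc = {z. \<forall>j. cmod (z $ j) < 1}"

definition cn_analytic_on :: "(complex^'n::finite \<Rightarrow> complex^'n) \<Rightarrow> (complex^'n) set \<Rightarrow> bool" where
  "cn_analytic_on F U \<longleftrightarrow>
     (\<forall>w\<in>U. \<exists>r>0. \<exists>c :: ('n \<Rightarrow> nat) \<Rightarrow> 'n \<Rightarrow> complex.
        \<forall>z. supnorm (z - w) < r \<longrightarrow>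
          (\<forall>j. ((\<lambda>\<alpha>. c \<alpha> j * (\<Prod>i\<in>UNIV. (z $ i - w $ i) ^ \<alpha> i)) has_sum (F z $ j)) UNIV))"

definition diag_lin :: "('n::finite \<Rightarrow> real) \<Rightarrow> complex^'n \<Rightarrow> complex^'n" where
  "diag_lin \<omega> z = (\<chi> j. \<i> * complex_of_real (\<omega> j) * z $ j)"

definition mi_abs :: "('n::finite \<Rightarrow> nat) \<Rightarrow> nat" where
  "mi_abs \<alpha> = (\<Sum>i\<in>UNIV. \<alpha> i)"

definition mi_dot :: "('n::finite \<Rightarrow> nat) \<Rightarrow> ('n \<Rightarrow> real) \<Rightarrow> real" where
  "mi_dot \<alpha> \<omega> = (\<Sum>i\<in>UNIV. real (\<alpha> i) * \<omega> i)"

definition non_resonant :: "('n::finite \<Rightarrow> real) \<Rightarrow> bool" where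
  "non_resonant \<omega> \<longleftrightarrow> (\<forall>\<alpha> j. 2 \<le> mi_abs \<alpha> \<longrightarrow> mi_dot \<alpha> \<omega> \<noteq> \<omega> j)"

definition small_div :: "('n::finite \<Rightarrow> real) \<Rightarrow> nat \<Rightarrow> real" where
  "small_div \<omega> p = Min {\<bar>mi_dot \<alpha> \<omega> - \<omega> j\<bar> | \<alpha> j. 2 \<le> mi_abs \<alpha> \<and> mi_abs \<alpha> < p}"

definition bruno_kappa :: "(nat \<Rightarrow> nat) \<Rightarrow> nat \<Rightarrow> nat" where
  "bruno_kappa pk N = (GREATEST k. pk k \<le> N)"

definition bruno_cond :: "real \<Rightarrow> ('n::finite \<Rightarrow> real) \<Rightarrow> bool" where
  "bruno_cond s \<omega> \<longleftrightarrow>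
     (\<exists>pk :: nat \<Rightarrow> nat. strict_mono pk \<and> 0 < pk 0 \<and> 3 \<le> pk 1 \<and>
        (\<exists>M. \<exists>N0. \<forall>\<alpha> :: 'n \<Rightarrow> nat. N0 \<le> mi_abs \<alpha> \<longrightarrow>
           2 * (\<Sum>m = 0..bruno_kappa pk (mi_abs \<alpha>).
                  ln (inverse (small_div \<omega> (pk (Suc m)))) / real (pk m))
           - s * ln (real (mi_abs \<alpha>)) \<le> M))"

fun cf_rem :: "real \<Rightarrow> nat \<Rightarrow> real" where
  "cf_rem x 0 = x"
| "cf_rem x (Suc k) = inverse (frac (cf_rem x k))"

definition cf_a :: "real \<Rightarrow> nat \<Rightarrow> int" where
  "cf_a x k = \<lfloor>cf_rem x k\<rfloor>"

fun cf_q :: "real \<Rightarrow> nat \<Rightarrow> int" where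
  "cf_q x 0 = 1"
| "cf_q x (Suc 0) = cf_a x 1"
| "cf_q x (Suc (Suc k)) = cf_a x (Suc (Suc k)) * cf_q x (Suc k) + cf_q x k"

definition cf_k :: "real \<Rightarrow> nat \<Rightarrow> nat" where
  "cf_k x N = (GREATEST k. cf_q x k \<le> int N)"

definition bruno1_cond :: "real \<Rightarrow> real \<Rightarrow> real \<Rightarrow> bool" where
  "bruno1_cond s \<omega>1 \<omega>2 \<longleftrightarrow> \<omega>2 \<noteq> 0 \<and>
     (let w = - \<omega>1 / \<omega>2 in 0 < w \<and> w \<notin> \<rat> \<and>
       (\<exists>M. \<exists>N0. \<forall>N::nat. N0 \<le> N \<longrightarrow>
          (\<Sum>j = 0..cf_k w N. ln (real_of_int (cf_q w (Suc j))) / real_of_int (cf_q w j))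
          - s * ln (real N) \<le> M))"

end

theory Submission
  imports Defs
begin

text \<open>The formal linearization \<open>z = H(w)\<close> is a sum over decorated trees: a vertex contributes a Taylor
  coefficient of \<open>F\<close> divided by \<open>\<i> (\<alpha> \<bullet> \<omega> - \<omega> j)\<close>, where \<open>\<alpha>\<close> counts the leaves above it. Counting the
  vertices with a small divisor (by the arguments of Siegel and Bruno, and of Davie for two frequencies)
  bounds the product of the divisors of a tree with \<open>L\<close> leaves below by \<open>exp (- K L) * L powr (- s L)\<close>.
  Hence the truncation \<open>H\<close> of the linearization to trees with at most \<open>N\<close> leaves is close to the
  identity at radius \<open>\<rho> = \<sigma> N powr (- s)\<close>, and in the coordinate \<open>w\<close> the field is \<open>A w + R(w)\<close> with \<open>R\<close>
  and its Lipschitz constant of order \<open>2 powr (- N)\<close> at radius \<open>\<rho> / 4\<close>. In the frame rotating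
  with \<open>A\<close> the Picard iteration therefore contracts on a time interval of length of order \<open>2 powr N\<close>;
  the result follows by taking \<open>N\<close> of the order of \<open>|z0| powr (- 1 / s)\<close>.\<close>

section \<open>Trees and marked vertices\<close>

text \<open>The bound on the divisors lets the coefficients grow like \<open>L powr (s * L)\<close>,
  which guarantees convergence at no fixed radius; hence a truncation whose order depends on
  \<open>z0\<close>. Bounding every divisor of a tree by the worst one would lose far too much. What
  saves the product is that the difference of two divisors along a branch is again of the form
  \<alpha> \<bullet> \<omega> - \<omega> j, where \<alpha> counts the leaves above one vertex but
  not above the other, plus one: if both divisors are small, many leaves lie in between. Trees,
  unlike a recursion for the coefficients, keep every divisor of a product visible and separate
  arithmetic from analysis: the modulus of a tree coefficient is a divisor-free majorant times
  \<open>exp (log_div \<omega> t)\<close>. Children and Taylor indices are both ordered lists, so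
  that a product of tree sums expands into forests without multinomial factors. The smallness of
  \<open>R\<close> arises because all terms of degree at most \<open>N\<close> cancel and the step
  from \<rho> to \<rho> / 4 gains \<open>4 ^ L\<close> on a term of degree \<open>L\<close>; a
  factor \<open>2 ^ L\<close> of this pays for a derivative.\<close>

datatype 'n ltree = is_Lf: Lf 'n | Nd 'n "'n ltree list"

fun tree_root :: "'n ltree \<Rightarrow> 'n" where
  "tree_root (Lf i) = i"
| "tree_root (Nd j ts) = j"

fun leaves :: "'n ltree \<Rightarrow> 'n list" where
  "leaves (Lf i) = [i]"
| "leaves (Nd j ts) = concat (map leaves ts)"

fun proper :: "'n ltree \<Rightarrow> bool" where
  "proper (Lf i) = True"
| "proper (Nd j ts) = (2 \<le> length ts \<and> (\<forall>t\<in>set ts. proper t))"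

abbreviation nl :: "'n ltree \<Rightarrow> nat" where
  "nl t \<equiv> length (leaves t)"

lemma nl_Nd: "nl (Nd j ts) = (\<Sum>t\<leftarrow>ts. nl t)"
  by (simp add: length_concat comp_def)

lemma nl_pos: "proper t \<Longrightarrow> 0 < nl t"
proof (induction t)
  case (Nd j ts)
  then obtain a ts' where "ts = a # ts'"
    by (cases ts) auto
  with Nd show ?case by auto
qed simp

lemma nl_ge_1: "proper t \<Longrightarrow> 1 \<le> nl t"
  by (metis One_nat_def Suc_leI nl_pos)

lemma length_le_nl: "\<forall>t\<in>set ts. proper t \<Longrightarrow> length ts \<le> (\<Sum>t\<leftarrow>ts. nl t)"
proof (induction ts)
  case (Cons t ts)
  from Cons.prems have "1 \<le> nl t" using nl_pos[of t] by (simp add: Suc_le_eq)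
  with Cons show ?case by simp
qed simp

lemma nl_child:
  assumes "proper (Nd j ts)" "t \<in> set ts"
  shows "nl t < nl (Nd j ts)"
proof -
  obtain xs ys where ts: "ts = xs @ t # ys"
    using assms(2) by (meson split_list)
  have "length (xs @ ys) \<le> (\<Sum>t\<leftarrow>xs @ ys. nl t)"
    using assms ts by (intro length_le_nl) auto
  moreover have "1 \<le> length (xs @ ys)"
    using assms(1) ts by simp
  ultimately have "1 \<le> (\<Sum>t\<leftarrow>xs @ ys. nl t)"
    by linarith
  then have "nl t < (\<Sum>t\<leftarrow>xs @ t # ys. nl t)"
    by (simp only: map_append sum_list_append list.map sum_list.Cons)
  then show ?thesis
    by (simp only: nl_Nd ts)
qed

lemma nl_Nd_ge_2: "proper (Nd j ts) \<Longrightarrow> 2 \<le> nl (Nd j ts)"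
  using length_le_nl[of ts] by (simp add: nl_Nd del: leaves.simps)

fun num_marked :: "('n ltree \<Rightarrow> bool) \<Rightarrow> 'n ltree \<Rightarrow> nat" where
  "num_marked S (Lf i) = 0"
| "num_marked S (Nd j ts) = of_bool (S (Nd j ts)) + (\<Sum>t\<leftarrow>ts. num_marked S t)"

fun topmost :: "('n ltree \<Rightarrow> bool) \<Rightarrow> 'n ltree \<Rightarrow> 'n ltree list" where
  "topmost S (Lf i) = []"
| "topmost S (Nd j ts) = (if S (Nd j ts) then [Nd j ts] else concat (map (topmost S) ts))"

lemma sum_list_concat_map:
  "(\<Sum>v\<leftarrow>concat (map g ts). f v) = (\<Sum>t\<leftarrow>ts. \<Sum>v\<leftarrow>g t. f v)"
  by (induction ts) auto

lemma num_marked_topmost: "num_marked S t = (\<Sum>v\<leftarrow>topmost S t. num_marked S v)"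
proof (induction t)
  case (Nd j ts)
  then have "(\<Sum>t\<leftarrow>ts. num_marked S t) = (\<Sum>t\<leftarrow>ts. \<Sum>v\<leftarrow>topmost S t. num_marked S v)"
    by (intro arg_cong[where f = sum_list] map_cong) auto
  then show ?case
    by (simp add: sum_list_concat_map)
qed simp

lemma mset_leaves_Nd: "mset (leaves (Nd j ts)) = (\<Sum>t\<leftarrow>ts. mset (leaves t))"
  by (induction ts) auto

lemma sum_list_mset_mono:
  assumes "\<And>t. t \<in> set ts \<Longrightarrow> f t \<subseteq># g t"
  shows "(\<Sum>t\<leftarrow>ts. f t) \<subseteq># (\<Sum>t\<leftarrow>ts. g t :: 'a multiset)"
  using assms by (induction ts) (auto intro!: subset_mset.add_mono)

text \<open>No topmost marked vertex lies below another, so their leaves are disjoint parts of the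
  leaves of \<open>t\<close>. Multisets rather than numbers are kept because
  \<open>divisor_diff\<close> needs to know which leaves remain.\<close>

lemma topmost_leaves: "(\<Sum>v\<leftarrow>topmost S t. mset (leaves v)) \<subseteq># mset (leaves t)"
proof (induction t)
  case (Nd j ts)
  then have "(\<Sum>t\<leftarrow>ts. \<Sum>v\<leftarrow>topmost S t. mset (leaves v)) \<subseteq># (\<Sum>t\<leftarrow>ts. mset (leaves t))"
    by (intro sum_list_mset_mono) auto
  then show ?case
    by (simp add: sum_list_concat_map mset_leaves_Nd del: leaves.simps)
qed simp

lemma topmost_D:
  assumes "proper t" "v \<in> set (topmost S t)"
  shows "proper v \<and> S v \<and> \<not> is_Lf v \<and> nl v \<le> nl t"
  using assms
proof (induction t)
  case (Nd j ts)
  show ?case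
  proof (cases "S (Nd j ts)")
    case False
    then obtain t where t: "t \<in> set ts" "v \<in> set (topmost S t)"
      using Nd.prems by auto
    have "nl t < nl (Nd j ts)"
      using nl_child[OF Nd.prems(1) t(1)] .
    moreover have "proper v \<and> S v \<and> \<not> is_Lf v \<and> nl v \<le> nl t"
      using Nd t by auto
    ultimately show ?thesis by (meson le_less_trans less_imp_le)
  qed (use Nd in \<open>auto simp del: leaves.simps\<close>)
qed simp

lemma size_sum_list_mset: "size (\<Sum>v\<leftarrow>vs. f v :: 'a multiset) = (\<Sum>v\<leftarrow>vs. size (f v))"
  by (induction vs) auto

lemma sum_list_nl_le:
  "(\<Sum>v\<leftarrow>vs. mset (leaves v)) \<subseteq># mset (leaves t) \<Longrightarrow> (\<Sum>v\<leftarrow>vs. nl v) \<le> nl t"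
  using size_mset_mono size_sum_list_mset[of "\<lambda>v. mset (leaves v)" vs] by fastforce

text \<open>The marked vertices of \<open>t\<close> are counted by cutting \<open>t\<close> below its topmost marked vertices.\<close>

lemma num_marked_le:
  fixes G :: "nat \<Rightarrow> real"
  assumes super: "\<And>ns m. sum_list ns \<le> m \<Longrightarrow> (\<Sum>n\<leftarrow>ns. G n) \<le> G m"
    and step: "\<And>j ts vs. \<lbrakk>proper (Nd j ts); S (Nd j ts);
        \<forall>v\<in>set vs. proper v \<and> S v \<and> \<not> is_Lf v \<and> nl v < nl (Nd j ts);
        (\<Sum>v\<leftarrow>vs. mset (leaves v)) \<subseteq># mset (leaves (Nd j ts))\<rbrakk>
        \<Longrightarrow> 1 + (\<Sum>v\<leftarrow>vs. G (nl v)) \<le> G (nl (Nd j ts))"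
    and "proper t"
  shows "real (num_marked S t) \<le> G (nl t)"
  using \<open>proper t\<close>
proof (induction t rule: measure_induct_rule[of nl])
  case (less t)
  show ?case
  proof (cases t)
    case (Lf i)
    then show ?thesis using super[of "[]" 1] by simp
  next
    case (Nd j ts)
    \<comment> \<open>Searching in the children, not in \<open>t\<close>, gives the marked vertices
      strictly below the root even when the root is marked; they have fewer leaves, so the induction
      hypothesis applies.\<close>
    define vs where "vs = concat (map (topmost S) ts)"
    have vs: "proper v \<and> S v \<and> \<not> is_Lf v \<and> nl v < nl t" if v: "v \<in> set vs" for v
    proof -
      obtain u where u: "u \<in> set ts" "v \<in> set (topmost S u)"
        using v by (auto simp: vs_def)
      then show ?thesis
        using topmost_D[of u v S] nl_child[of j ts u] less.prems unfolding Nd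
        by (auto simp del: leaves.simps)
    qed
    have sub: "(\<Sum>v\<leftarrow>vs. mset (leaves v)) \<subseteq># mset (leaves t)"
      unfolding vs_def sum_list_concat_map Nd mset_leaves_Nd
      by (intro sum_list_mset_mono topmost_leaves)
    have "(\<Sum>t\<leftarrow>ts. num_marked S t) = (\<Sum>v\<leftarrow>vs. num_marked S v)"
      unfolding vs_def sum_list_concat_map
      by (intro arg_cong[where f = sum_list] map_cong refl num_marked_topmost)
    moreover have "real (\<Sum>v\<leftarrow>vs. num_marked S v) = (\<Sum>v\<leftarrow>vs. real (num_marked S v))"
    by (induction vs) auto
    ultimately have c: "real (num_marked S t) = of_bool (S t) + (\<Sum>v\<leftarrow>vs. real (num_marked S v))"
      by (simp add: Nd)
    have le: "(\<Sum>v\<leftarrow>vs. real (num_marked S v)) \<le> (\<Sum>v\<leftarrow>vs. G (nl v))"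
      using vs less.IH by (intro sum_list_mono) auto
    show ?thesis
    proof (cases "S t")
      case True
      then have "1 + (\<Sum>v\<leftarrow>vs. G (nl v)) \<le> G (nl t)"
        using step[of j ts vs] vs sub less.prems Nd by auto
      then show ?thesis using c le True by simp
    next
      case False
      have "(\<Sum>v\<leftarrow>vs. G (nl v)) \<le> G (nl t)"
        using super[of "map nl vs" "nl t"] sum_list_nl_le[OF sub] by (simp add: comp_def)
      then show ?thesis using c le False by simp
    qed
  qed
qed

definition divisor :: "('n \<Rightarrow> real) \<Rightarrow> 'n ltree \<Rightarrow> real" where
  "divisor \<omega> t = (\<Sum>i\<leftarrow>leaves t. \<omega> i) - \<omega> (tree_root t)"

fun log_div :: "('n \<Rightarrow> real) \<Rightarrow> 'n ltree \<Rightarrow> real" where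
  "log_div \<omega> (Lf i) = 0"
| "log_div \<omega> (Nd j ts) = - ln \<bar>divisor \<omega> (Nd j ts)\<bar> + (\<Sum>t\<leftarrow>ts. log_div \<omega> t)"

section \<open>Counting small divisors\<close>

lemma mi_abs_count: "mi_abs (count M) = size (M :: 'n::finite multiset)"
proof (induction M)
  case (add x M)
  have "(\<Sum>i\<in>UNIV. count (add_mset x M) i) = (\<Sum>i\<in>UNIV. (if i = x then 1 else 0) + count M i)"
    by (intro sum.cong) auto
  with add show ?case
    by (simp add: mi_abs_def sum.distrib)
qed (simp add: mi_abs_def)

lemma mi_dot_count: "mi_dot (count M) \<omega> = (\<Sum>i\<in>#M. \<omega> i)" for M :: "'n::finite multiset"
proof (induction M)
  case (add x M)
  have "(\<Sum>i\<in>UNIV. real (count (add_mset x M) i) * \<omega> i) =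
      (\<Sum>i\<in>UNIV. (if i = x then \<omega> i else 0) + real (count M i) * \<omega> i)"
    by (intro sum.cong) (auto simp: distrib_right)
  with add show ?case
    by (simp add: mi_dot_def sum.distrib)
qed (simp add: mi_dot_def)

lemma finite_mi_abs_less: "finite {\<alpha> :: 'n::finite \<Rightarrow> nat. mi_abs \<alpha> < p}"
proof -
  have "{\<alpha> :: 'n \<Rightarrow> nat. mi_abs \<alpha> < p} \<subseteq> (\<Pi>\<^sub>E i\<in>UNIV. {..<p})"
  proof safe
    fix \<alpha> :: "'n \<Rightarrow> nat" and i assume "mi_abs \<alpha> < p"
    moreover have "\<alpha> i \<le> mi_abs \<alpha>"
      unfolding mi_abs_def by (rule member_le_sum) auto
    ultimately show "\<alpha> i < p" by simp
  qed auto
  then show ?thesis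
    using finite_PiE[of UNIV "\<lambda>_::'n. {..<p}"] finite_subset by auto
qed

definition div_set :: "('n::finite \<Rightarrow> real) \<Rightarrow> nat \<Rightarrow> real set" where
  "div_set \<omega> p = {\<bar>mi_dot \<alpha> \<omega> - \<omega> j\<bar> | \<alpha> j. 2 \<le> mi_abs \<alpha> \<and> mi_abs \<alpha> < p}"

lemma small_div_eq: "small_div \<omega> p = Min (div_set \<omega> p)"
  by (simp add: small_div_def div_set_def)

lemma finite_div_set: "finite (div_set \<omega> p)"
proof -
  have "div_set \<omega> p \<subseteq> (\<lambda>(\<alpha>, j). \<bar>mi_dot \<alpha> \<omega> - \<omega> j\<bar>) ` ({\<alpha>. mi_abs \<alpha> < p} \<times> UNIV)"
    by (auto simp: div_set_def)
  then show ?thesis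
    by (rule finite_subset) (intro finite_imageI finite_SigmaI finite_mi_abs_less finite)
qed

lemma small_div_le:
  assumes "2 \<le> mi_abs \<alpha>" "mi_abs \<alpha> < p"
  shows "small_div \<omega> p \<le> \<bar>mi_dot \<alpha> \<omega> - \<omega> j\<bar>"
  unfolding small_div_eq by (rule Min_le[OF finite_div_set]) (use assms in \<open>auto simp: div_set_def\<close>)

lemma div_set_nonempty: "3 \<le> p \<Longrightarrow> div_set \<omega> p \<noteq> {}"
proof -
  assume "3 \<le> p"
  fix i :: 'a
  have "mi_abs (count {#i, i#}) = 2"
    by (subst mi_abs_count) simp
  with \<open>3 \<le> p\<close> have "\<bar>mi_dot (count {#i, i#}) \<omega> - \<omega> i\<bar> \<in> div_set \<omega> p"
    unfolding div_set_def by force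
  then show ?thesis by auto
qed

lemma small_div_pos:
  assumes "non_resonant \<omega>" "3 \<le> p"
  shows "0 < small_div \<omega> p"
proof -
  have "small_div \<omega> p \<in> div_set \<omega> p"
    unfolding small_div_eq by (rule Min_in[OF finite_div_set div_set_nonempty[OF assms(2)]])
  then show ?thesis
    using assms(1) by (force simp: div_set_def non_resonant_def)
qed

lemma small_div_antimono: "3 \<le> p \<Longrightarrow> p \<le> p' \<Longrightarrow> small_div \<omega> p' \<le> small_div \<omega> p"
  unfolding small_div_eq
  by (rule Min_antimono) (use finite_div_set div_set_nonempty in \<open>auto simp: div_set_def\<close>)

lemma divisor_mi_dot: "divisor \<omega> t = mi_dot (count (mset (leaves t))) \<omega> - \<omega> (tree_root t)"
  unfolding divisor_def mi_dot_count by (metis mset_map sum_mset_sum_list)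

lemma abs_divisor_pos:
  assumes "non_resonant \<omega>" "proper (Nd j ts)"
  shows "0 < \<bar>divisor \<omega> (Nd j ts)\<bar>"
  using assms nl_Nd_ge_2[OF assms(2)] unfolding divisor_mi_dot non_resonant_def
  by (simp add: mi_abs_count del: leaves.simps)

text \<open>Replacing the subtree \<open>v\<close> of \<open>t\<close> by a single leaf with its
  root label gives a tree whose divisor is this difference. Together with
  \<open>small_div_le\<close>, two simultaneously small divisors thus give a lower bound for
  \<open>nl t - nl v\<close>.\<close>

lemma divisor_diff:
  assumes "mset (leaves v) \<subseteq># mset (leaves t)"
  defines "M \<equiv> mset (leaves t) - mset (leaves v) + {#tree_root v#}"
  shows "divisor \<omega> t - divisor \<omega> v = mi_dot (count M) \<omega> - \<omega> (tree_root t)"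
    and "mi_abs (count M) = nl t - nl v + 1"
proof -
  have *: "(\<Sum>i\<leftarrow>leaves u. \<omega> i) = (\<Sum>i\<in>#mset (leaves u). \<omega> i)" for u
    by (metis mset_map sum_mset_sum_list)
  have "(\<Sum>i\<in>#mset (leaves t). \<omega> i) =
      (\<Sum>i\<in>#mset (leaves t) - mset (leaves v). \<omega> i) + (\<Sum>i\<in>#mset (leaves v). \<omega> i)"
    using assms(1) by (metis image_mset_union subset_mset.diff_add sum_mset.union)
  then show "divisor \<omega> t - divisor \<omega> v = mi_dot (count M) \<omega> - \<omega> (tree_root t)"
    unfolding mi_dot_count M_def divisor_def * by simp
  show "mi_abs (count M) = nl t - nl v + 1"
    using assms(1) by (simp add: mi_abs_count M_def size_Diff_submset)
qed

section \<open>Siegel's count of vertices with small divisors\<close>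

lemma sum_max_superadditive:
  fixes c d :: real
  assumes "0 \<le> c" "0 \<le> d"
  shows "(\<Sum>n\<leftarrow>ns. max 0 (c * real (n - e) - d)) \<le> max 0 (c * real (sum_list ns - e) - d)"
proof (induction ns)
  case (Cons n ns)
  \<comment> \<open>Two positive summands pay \<open>d\<close> twice, their sum only once. The shift
    \<open>e\<close> is 0 in Siegel's count and 1 in Davie's.\<close>
  have "max 0 (c * x - d) + max 0 (c * y - d) \<le> max 0 (c * (x + y) - d)"
    if "0 \<le> x" "0 \<le> y" for x y
  proof -
    have "0 \<le> c * x" "0 \<le> c * y" using assms that by auto
    then show ?thesis using assms by (simp add: distrib_left)
  qed
  from this[of "n - e" "sum_list ns - e"]
  have "max 0 (c * real (n - e) - d) + max 0 (c * real (sum_list ns - e) - d) \<le>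
    max 0 (c * (real (n - e) + real (sum_list ns - e)) - d)" by simp
  also have "\<dots> \<le> max 0 (c * real (n + sum_list ns - e) - d)"
  proof -
    have "real (n - e) + real (sum_list ns - e) \<le> real (n + sum_list ns - e)"
      by linarith
    from mult_left_mono[OF this assms(1)] show ?thesis by linarith
  qed
  finally show ?case using Cons by simp
qed simp

lemma max_linear_mono:
  fixes c d :: real
  assumes "0 \<le> c" "m \<le> n"
  shows "max 0 (c * real (m - e) - d) \<le> max 0 (c * real (n - e) - d)"
proof -
  have "real (m - e) \<le> real (n - e)" using assms by simp
  from mult_left_mono[OF this assms(1)] show ?thesis by linarith
qed

text \<open>A marked vertex has at least \<open>p\<close> leaves, since otherwise its divisor is at
  least \<Omega>(p). If exactly one topmost marked vertex lies below a marked one, the two divisors,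
  each below half of \<Omega>(p), differ by less than \<Omega>(p), so their leaf numbers differ by
  at least \<open>p - 1\<close>; this is why the threshold is halved. If there are two or more,
  their terms - 1 leave room for the new vertex. The - 0 only fits the bound to
  \<open>sum_max_superadditive\<close>.\<close>

lemma num_marked_le_siegel:
  fixes \<omega> :: "'n::finite \<Rightarrow> real"
  assumes p: "3 \<le> p" and "proper t"
  shows "real (num_marked (\<lambda>v. \<bar>divisor \<omega> v\<bar> < small_div \<omega> p / 2) t) \<le> max 0 (2 / p * real (nl t - 0) - 1)"
  using \<open>proper t\<close>
proof (rule num_marked_le[rotated 2])
  fix ns :: "nat list" and m assume "sum_list ns \<le> m"
  then show "(\<Sum>n\<leftarrow>ns. max 0 (2 / real p * real (n - 0) - 1)) \<le> max 0 (2 / real p * real (m - 0) - 1)"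
    using sum_max_superadditive[of "2 / p" 1 0 ns] max_linear_mono[of "2 / p" "sum_list ns" m 0 1]
    by (simp del: diff_0_eq_0 diff_zero)
next
  fix j and ts vs :: "'n ltree list"
  let ?S = "\<lambda>v. \<bar>divisor \<omega> v\<bar> < small_div \<omega> p / 2"
  let ?t = "Nd j ts"
  assume t: "proper ?t" "?S ?t"
    and vs: "\<forall>v\<in>set vs. proper v \<and> ?S v \<and> \<not> is_Lf v \<and> nl v < nl ?t"
    and sub: "(\<Sum>v\<leftarrow>vs. mset (leaves v)) \<subseteq># mset (leaves ?t)"
  have large: "p \<le> nl v" if "proper v" "?S v" "\<not> is_Lf v" for v
  proof (rule ccontr)
    assume "\<not> p \<le> nl v"
    moreover have "2 \<le> nl v"
      using that nl_Nd_ge_2 by (metis ltree.exhaust_disc ltree.collapse(2) ltree.disc(1) ltree.exhaust)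
    ultimately have "small_div \<omega> p \<le> \<bar>divisor \<omega> v\<bar>"
      unfolding divisor_mi_dot by (intro small_div_le) (auto simp: mi_abs_count)
    with that show False by linarith
  qed
  have vsl: "p \<le> nl v" if "v \<in> set vs" for v
    using vs that large by blast
  have tl: "p \<le> nl ?t"
    using large[OF t] by (simp del: leaves.simps)
  have p0: "0 < real p" using p by simp
  have le: "(\<Sum>v\<leftarrow>vs. nl v) \<le> nl ?t"
    by (rule sum_list_nl_le[OF sub])
  have eq: "(\<Sum>v\<leftarrow>vs. max 0 (2 / p * real (nl v - 0) - 1)) = 2 / p * real (\<Sum>v\<leftarrow>vs. nl v) - length vs"
    using vsl
  proof (induction vs)
    case (Cons v vs)
    have "1 \<le> real (nl v) / p" using Cons.prems[of v] p0 by simp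
    with Cons show ?case by (simp add: distrib_left)
  qed simp
  consider "vs = []" | v where "vs = [v]" | "2 \<le> length vs"
    by (metis One_nat_def Suc_1 Suc_leI length_0_conv length_Suc_conv less_2_cases_iff not_less)
  then have "1 + (2 / p * real (\<Sum>v\<leftarrow>vs. nl v) - length vs) \<le> 2 / p * real (nl ?t) - 1"
  proof cases
    case 1
    then show ?thesis using tl p0 by (simp add: field_simps del: leaves.simps)
  next
    case (2 v)
    have sv: "mset (leaves v) \<subseteq># mset (leaves ?t)" using sub 2 by simp
    have "nl v < nl ?t" "?S v" using vs 2 by auto
    have "p \<le> nl ?t - nl v + 1"
    proof (rule ccontr)
      assume "\<not> p \<le> nl ?t - nl v + 1"
      then have "small_div \<omega> p \<le> \<bar>divisor \<omega> ?t - divisor \<omega> v\<bar>"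
        unfolding divisor_diff(1)[OF sv] using \<open>nl v < nl ?t\<close>
        by (intro small_div_le; subst divisor_diff(2)[OF sv]; linarith)
      with \<open>?S v\<close> t(2) show False by linarith
    qed
    \<comment> \<open>Here \<open>p - 1 \<ge> p / 2\<close>, and \<open>p / 2\<close> leaves are
      worth exactly one unit of the bound \<open>2 / p * L\<close>.\<close>
    then have "real p / 2 + real (nl v) \<le> real (nl ?t)" using p \<open>nl v < nl ?t\<close> by linarith
    then show ?thesis using p0 2 by (simp add: field_simps del: leaves.simps)
  next
    case 3
    have "2 / p * real (\<Sum>v\<leftarrow>vs. nl v) \<le> 2 / p * real (nl ?t)"
      using le p0 by (intro mult_left_mono) auto
    then show ?thesis using 3 by simp
  qed
  then show "1 + (\<Sum>v\<leftarrow>vs. max 0 (2 / real p * real (nl v - 0) - 1)) \<le> max 0 (2 / real p * real (nl ?t - 0) - 1)"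
    unfolding eq by simp
qed

lemma sum_list_affine:
  "(\<Sum>u\<leftarrow>us. L * (real (f u) - 1) + (\<Sum>m<K. real (c m u) * g m)) =
    L * (real (\<Sum>u\<leftarrow>us. f u) - length us) + (\<Sum>m<K. real (\<Sum>u\<leftarrow>us. c m u) * (g m :: real))"
  by (induction us) (auto simp: algebra_simps sum.distrib)

text \<open>Telescoping over the thresholds \<open>\<theta>\<close>: a divisor \<open>\<delta> \<ge> \<theta> K\<close> contributes
  \<open>ln \<theta> m - ln \<theta> (m+1)\<close> for every \<open>m < K\<close> with \<open>\<delta> < \<theta> m\<close>.\<close>

lemma log_div_le_sum_num_marked:
  fixes \<omega> :: "'n::finite \<Rightarrow> real" and \<theta> :: "nat \<Rightarrow> real"
  assumes nonres: "non_resonant \<omega>" and pos: "\<And>m. 0 < \<theta> m" and dec: "antimono \<theta>"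
    and "proper t"
    and low: "\<And>v. proper v \<Longrightarrow> \<not> is_Lf v \<Longrightarrow> nl v \<le> nl t \<Longrightarrow> \<theta> K \<le> \<bar>divisor \<omega> v\<bar>"
  shows "log_div \<omega> t \<le> \<bar>ln (\<theta> 0)\<bar> * (real (nl t) - 1) +
    (\<Sum>m<K. real (num_marked (\<lambda>v. \<bar>divisor \<omega> v\<bar> < \<theta> m) t) * (ln (\<theta> m) - ln (\<theta> (Suc m))))"
  using \<open>proper t\<close> low
proof (induction t)
  case (Nd j ts)
  let ?d = "\<bar>divisor \<omega> (Nd j ts)\<bar>" and ?L = "\<bar>ln (\<theta> 0)\<bar>" and ?g = "\<lambda>m. ln (\<theta> m) - ln (\<theta> (Suc m))"
  have dpos: "0 < ?d" by (rule abs_divisor_pos[OF nonres Nd.prems(1)])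
  have tele: "- ln d \<le> ?L + (\<Sum>m<K. of_bool (d < \<theta> m) * ?g m)" if "0 < d" "\<theta> K \<le> d" for d K
    using that
  proof (induction K)
    case 0
    then show ?case using pos[of 0] by simp (smt (verit) ln_le_cancel_iff)
  next
    case (Suc K)
    show ?case
    proof (cases "\<theta> K \<le> d")
      case True
      then show ?thesis using Suc by simp
    next
      case False
      have "(\<Sum>m<Suc K. of_bool (d < \<theta> m) * ?g m) = (\<Sum>m<Suc K. ?g m)"
      proof (intro sum.cong refl)
        fix m assume "m \<in> {..<Suc K}"
        then have "\<theta> K \<le> \<theta> m" using dec by (auto simp: antimono_def)
        then show "of_bool (d < \<theta> m) * ?g m = ?g m" using False by simp
      qed
      also have "\<dots> = ln (\<theta> 0) - ln (\<theta> (Suc K))"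
        by (rule sum_lessThan_telescope')
      finally show ?thesis using Suc.prems pos[of "Suc K"]
        by (smt (verit) ln_le_cancel_iff)
    qed
  qed
  have ch: "log_div \<omega> u \<le> ?L * (real (nl u) - 1) +
      (\<Sum>m<K. real (num_marked (\<lambda>v. \<bar>divisor \<omega> v\<bar> < \<theta> m) u) * ?g m)" if u: "u \<in> set ts" for u
  proof (rule Nd.IH[OF u])
    show "proper u" using Nd.prems(1) u by simp
    fix v :: "'n ltree" assume "proper v" "\<not> is_Lf v" "nl v \<le> nl u"
    then show "\<theta> K \<le> \<bar>divisor \<omega> v\<bar>"
      using Nd.prems(2) nl_child[OF Nd.prems(1) u] by (meson le_trans less_imp_le)
  qed
  have "(\<Sum>u\<leftarrow>ts. log_div \<omega> u) \<le> (\<Sum>u\<leftarrow>ts. ?L * (real (nl u) - 1) +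
      (\<Sum>m<K. real (num_marked (\<lambda>v. \<bar>divisor \<omega> v\<bar> < \<theta> m) u) * ?g m))"
    by (rule sum_list_mono[OF ch])
  also have "\<dots> = ?L * (real (\<Sum>u\<leftarrow>ts. nl u) - length ts) +
      (\<Sum>m<K. real (\<Sum>u\<leftarrow>ts. num_marked (\<lambda>v. \<bar>divisor \<omega> v\<bar> < \<theta> m) u) * ?g m)"
    by (rule sum_list_affine)
  \<comment> \<open>Each of the at least two children saves one \<open>?L\<close>; one saving goes
    to the root vertex, another is the - 1 of the claim.\<close>
  also have "?L * (real (\<Sum>u\<leftarrow>ts. nl u) - length ts) \<le> ?L * (real (nl (Nd j ts)) - 2)"
    using Nd.prems(1) by (intro mult_left_mono) (auto simp: nl_Nd simp del: leaves.simps)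
  finally have "log_div \<omega> (Nd j ts) \<le> - ln ?d + (?L * (real (nl (Nd j ts)) - 2) +
      (\<Sum>m<K. real (\<Sum>u\<leftarrow>ts. num_marked (\<lambda>v. \<bar>divisor \<omega> v\<bar> < \<theta> m) u) * ?g m))"
    by simp
  also have "- ln ?d \<le> ?L + (\<Sum>m<K. of_bool (?d < \<theta> m) * ?g m)"
    using tele[OF dpos] Nd.prems(2)[OF Nd.prems(1)] by (simp del: leaves.simps)
  finally have "log_div \<omega> (Nd j ts) \<le> ?L + (\<Sum>m<K. of_bool (?d < \<theta> m) * ?g m) +
      (?L * (real (nl (Nd j ts)) - 2) +
      (\<Sum>m<K. real (\<Sum>u\<leftarrow>ts. num_marked (\<lambda>v. \<bar>divisor \<omega> v\<bar> < \<theta> m) u) * ?g m))"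
    by linarith
  moreover have "(\<Sum>m<K. real (num_marked (\<lambda>v. \<bar>divisor \<omega> v\<bar> < \<theta> m) (Nd j ts)) * ?g m) =
      (\<Sum>m<K. of_bool (?d < \<theta> m) * ?g m) +
      (\<Sum>m<K. real (\<Sum>u\<leftarrow>ts. num_marked (\<lambda>v. \<bar>divisor \<omega> v\<bar> < \<theta> m) u) * ?g m)"
    unfolding sum.distrib[symmetric] by (intro sum.cong refl) (simp add: distrib_right del: leaves.simps)
  moreover have "?L * (real (nl (Nd j ts)) - 1) = ?L * (real (nl (Nd j ts)) - 2) + ?L"
    by (simp add: algebra_simps del: leaves.simps)
  ultimately show ?case by linarith
qed simp

text \<open>Besides non-resonance this is the only arithmetic fact on \<omega> that the analytic
  part uses; both Bruno conditions are converted into it. The growth \<open>L powr (s * L)\<close>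
  is that of a Gevrey series of order \<open>s\<close>.\<close>

definition log_div_bound :: "real \<Rightarrow> ('n \<Rightarrow> real) \<Rightarrow> bool" where
  "log_div_bound s \<omega> \<longleftrightarrow>
     (\<exists>K. \<forall>t. proper t \<longrightarrow> log_div \<omega> t \<le> real (nl t) * (K + s * ln (real (nl t))))"

lemma bruno_kappa_bounds:
  assumes "strict_mono pk" "pk 0 \<le> N"
  shows "pk (bruno_kappa pk N) \<le> N" "N < pk (Suc (bruno_kappa pk N))"
proof -
  have b: "\<forall>k. pk k \<le> N \<longrightarrow> k \<le> N"
    using strict_mono_imp_increasing[OF assms(1)] le_trans by blast
  show "pk (bruno_kappa pk N) \<le> N"
    unfolding bruno_kappa_def
    by (rule GreatestI_nat[where P = "\<lambda>k. pk k \<le> N" and b = N]) (use b assms in auto)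
  show "N < pk (Suc (bruno_kappa pk N))"
  proof (rule ccontr)
    assume "\<not> N < pk (Suc (bruno_kappa pk N))"
    then have "Suc (bruno_kappa pk N) \<le> bruno_kappa pk N"
      unfolding bruno_kappa_def
      by (intro Greatest_le_nat[where P = "\<lambda>k. pk k \<le> N" and b = N]) (use b in auto)
    then show False by simp
  qed
qed

lemma bruno_kappa_mono:
  assumes "strict_mono pk" "pk 0 \<le> M" "M \<le> N"
  shows "bruno_kappa pk M \<le> bruno_kappa pk N"
proof -
  have "pk (bruno_kappa pk M) < pk (Suc (bruno_kappa pk N))"
    using bruno_kappa_bounds[OF assms(1)] assms by (meson le_less_trans le_trans)
  then show ?thesis using assms(1) by (simp add: strict_mono_less)
qed

text \<open>With thresholds \<Omega>(p_m) / 2 the count is at most \<open>2 * L / p_m\<close>, and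
  telescoping weights it with at most the logarithm of 1 / \<Omega>(p_(m+1)). The result is
  \<open>L\<close> times the sum in the condition, its factor 2 being the 2 of Siegel's
  count.\<close>

lemma log_div_bound_bruno:
  fixes \<omega> :: "'n::finite \<Rightarrow> real"
  assumes nonres: "non_resonant \<omega>" and "bruno_cond s \<omega>" and s: "0 < s"
  shows "log_div_bound s \<omega>"
proof -
  obtain pk M N0 where pk: "strict_mono pk" "0 < pk 0" "3 \<le> pk 1"
    and bru0: "\<And>\<alpha> :: 'n \<Rightarrow> nat. N0 \<le> mi_abs \<alpha> \<Longrightarrow>
       2 * (\<Sum>m = 0..bruno_kappa pk (mi_abs \<alpha>). ln (inverse (small_div \<omega> (pk (Suc m)))) / real (pk m))
        - s * ln (real (mi_abs \<alpha>)) \<le> M"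
    using assms(2) unfolding bruno_cond_def by blast
  define a where "a m = 2 * (- ln (small_div \<omega> (pk (Suc m))) / real (pk m))" for m
  have pk3: "3 \<le> pk (Suc m)" for m
    using pk strict_mono_less_eq[OF pk(1), of 1 "Suc m"] by simp
  have pk_pos: "0 < pk m" for m
    using pk strict_mono_less_eq[OF pk(1), of 0 m] by simp
  have om_pos: "0 < small_div \<omega> (pk (Suc m))" for m
    by (rule small_div_pos[OF nonres pk3])
  have om_dec: "small_div \<omega> (pk (Suc n)) \<le> small_div \<omega> (pk (Suc m))" if "m \<le> n" for m n
    using pk3 pk(1) that by (intro small_div_antimono) (auto simp: strict_mono_less_eq)
  have bru: "(\<Sum>m = 0..bruno_kappa pk N. a m) \<le> M + s * ln (real N)" if "N0 \<le> N" for N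
  proof -
    \<comment> \<open>The condition depends on the multi-index only through its size, so
      \<open>N\<close> copies of an arbitrary index suffice.\<close>
    obtain i :: 'n where True by simp
    have "mi_abs (count (replicate_mset N i)) = N"
      by (simp add: mi_abs_count)
    with bru0[of "count (replicate_mset N i)"] that show ?thesis
      using om_pos unfolding a_def by (simp add: ln_inverse sum_distrib_left)
  qed
  show ?thesis
  proof (cases "\<exists>m. small_div \<omega> (pk (Suc m)) \<le> 1")
    case False
    \<comment> \<open>No divisor is below 1 in this case, so already \<open>log_div\<close> is at
      most 0.\<close>
    have ge1: "1 \<le> \<bar>divisor \<omega> v\<bar>" if "proper v" "\<not> is_Lf v" for v
    proof -
      have "2 \<le> nl v" using that nl_Nd_ge_2 by (cases v) auto
      moreover have "nl v < pk (Suc (nl v))"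
        using strict_mono_imp_increasing[OF pk(1), of "Suc (nl v)"] by simp
      ultimately have "small_div \<omega> (pk (Suc (nl v))) \<le> \<bar>divisor \<omega> v\<bar>"
        unfolding divisor_mi_dot by (intro small_div_le) (auto simp: mi_abs_count)
      moreover have "1 < small_div \<omega> (pk (Suc (nl v)))" using False by (meson not_le)
      ultimately show ?thesis by linarith
    qed
    have "log_div \<omega> t \<le> real (nl t) * (0 + s * ln (real (nl t)))" if "proper t" for t
    proof -
      have "log_div \<omega> t \<le> 0"
        using log_div_le_sum_num_marked[where \<theta> = "\<lambda>_. 1" and K = 0, OF nonres _ _ that] ge1
        by (simp add: antimono_def)
      moreover have "0 \<le> real (nl t) * (s * ln (real (nl t)))"
        using s nl_ge_1[OF that] by (intro mult_nonneg_nonneg ln_ge_zero) auto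
      ultimately show ?thesis by simp
    qed
    then show ?thesis unfolding log_div_bound_def by blast
  next
    case True
    then obtain m0 where m0: "small_div \<omega> (pk (Suc m0)) \<le> 1" by blast
    \<comment> \<open>Starting at \<open>m0\<close>, where \<Omega> has dropped to at most 1, makes
      the terms of the sum nonnegative, so that partial sums may be enlarged. Divisors above
      \<theta> 0 are covered by \<open>\<bar>ln (\<theta> 0)\<bar>\<close> per vertex.\<close>
    define \<theta> where "\<theta> m = small_div \<omega> (pk (Suc (m0 + m))) / 2" for m
    have \<theta>_pos: "0 < \<theta> m" for m using om_pos by (simp add: \<theta>_def)
    have \<theta>_dec: "antimono \<theta>" using om_dec by (simp add: antimono_def \<theta>_def)
    have a_nonneg: "0 \<le> a m" if "m0 \<le> m" for m
      using om_dec[OF that] m0 om_pos[of m] pk_pos[of m] ln_le_zero_iff[of "small_div \<omega> (pk (Suc m))"]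
      unfolding a_def by (simp add: divide_nonpos_pos)
    define C where "C = (\<Sum>m\<in>{0..m0}. \<bar>a m\<bar>)"
    \<comment> \<open>\<open>C\<close> compensates the discarded terms up to \<open>m0\<close>,
      whose signs are unknown; \<open>\<bar>M\<bar>\<close> and \<open>N0\<close> carry the
      condition, given only for large \<open>N\<close>, over to every number of leaves.\<close>
    define K where "K = \<bar>ln (\<theta> 0)\<bar> + C + \<bar>M\<bar> + s * ln (real (max N0 1))"
    have asum: "(\<Sum>m\<in>{Suc m0..bruno_kappa pk L}. a m) \<le> C + \<bar>M\<bar> + s * ln (real (max N0 1)) + s * ln (real L)"
      if L: "pk (Suc m0) \<le> L" for L
    proof -
      define N where "N = max N0 L"
      have L0: "pk 0 \<le> L" "1 \<le> L"
        using L pk(1) strict_mono_less_eq[OF pk(1), of 0 "Suc m0"] pk3[of m0] by auto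
      have le: "Suc m0 \<le> bruno_kappa pk L" "bruno_kappa pk L \<le> bruno_kappa pk N"
      proof -
        have "pk (Suc m0) < pk (Suc (bruno_kappa pk L))"
          using bruno_kappa_bounds(2)[OF pk(1) L0(1)] L by linarith
        then show "Suc m0 \<le> bruno_kappa pk L" using pk(1) by (simp add: strict_mono_less)
        show "bruno_kappa pk L \<le> bruno_kappa pk N"
          by (rule bruno_kappa_mono[OF pk(1) L0(1)]) (simp add: N_def)
      qed
      have "(\<Sum>m\<in>{Suc m0..bruno_kappa pk L}. a m) \<le> (\<Sum>m\<in>{Suc m0..bruno_kappa pk N}. a m)"
        using le a_nonneg by (intro sum_mono2) auto
      also have "\<dots> = (\<Sum>m\<in>{0..bruno_kappa pk N}. a m) - (\<Sum>m\<in>{0..m0}. a m)"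
      proof -
        have "{0..bruno_kappa pk N} = {0..m0} \<union> {Suc m0..bruno_kappa pk N}"
          using le by auto
        then show ?thesis by (simp add: sum.union_disjoint)
      qed
      finally have "(\<Sum>m\<in>{Suc m0..bruno_kappa pk L}. a m) \<le>
          (\<Sum>m\<in>{0..bruno_kappa pk N}. a m) - (\<Sum>m\<in>{0..m0}. a m)" .
      moreover have "- (\<Sum>m\<in>{0..m0}. a m) \<le> C"
        unfolding C_def sum_negf[symmetric] by (intro sum_mono) auto
      moreover have "(\<Sum>m\<in>{0..bruno_kappa pk N}. a m) \<le> M + s * ln (real N)"
        by (rule bru) (simp add: N_def)
      ultimately have 1: "(\<Sum>m\<in>{Suc m0..bruno_kappa pk L}. a m) \<le> M + s * ln (real N) + C"
        by linarith
      have "real N \<le> real (max N0 1) * real L"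
      proof -
        have "N \<le> max N0 1 * L"
          unfolding N_def using L0 by (cases "N0 \<le> L") (auto simp: max_def)
        then show ?thesis by (metis of_nat_le_iff of_nat_mult)
      qed
      then have "ln (real N) \<le> ln (real (max N0 1) * real L)"
        using L0 by (intro ln_mono) (auto simp: N_def)
      also have "\<dots> = ln (real (max N0 1)) + ln (real L)"
        using L0 by (intro ln_mult_pos) auto
      finally have "s * ln (real N) \<le> s * ln (real (max N0 1)) + s * ln (real L)"
        using s by (metis distrib_left mult_left_mono less_imp_le)
      with 1 show ?thesis by linarith
    qed
    have dv_ge: "small_div \<omega> (pk (Suc k)) \<le> \<bar>divisor \<omega> v\<bar>"
      if "proper v" "\<not> is_Lf v" "nl v < pk (Suc k)" for v k
    proof -
      have "2 \<le> nl v" using that nl_Nd_ge_2 by (cases v) auto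
      then show ?thesis
        unfolding divisor_mi_dot using that by (intro small_div_le) (auto simp: mi_abs_count)
    qed
    have "log_div \<omega> t \<le> real (nl t) * (K + s * ln (real (nl t)))" if t: "proper t" for t
    proof -
      let ?L = "nl t"
      have L1: "1 \<le> real ?L" using nl_ge_1[OF t] by linarith
      have lnL: "0 \<le> s * ln (real ?L)" using s L1 by simp
      have lnN: "0 \<le> s * ln (real (max N0 1))" using s by simp
      have C0: "0 \<le> C" unfolding C_def by (intro sum_nonneg) auto
      define \<kappa> where "\<kappa> = (if pk (Suc m0) \<le> ?L then bruno_kappa pk ?L - m0 else 0)"
      have \<kappa>: "\<theta> \<kappa> \<le> \<bar>divisor \<omega> v\<bar>" if v: "proper v" "\<not> is_Lf v" "nl v \<le> ?L" for v
      proof -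
        have "nl v < pk (Suc (m0 + \<kappa>))"
        proof (cases "pk (Suc m0) \<le> ?L")
          case True
          then have L0: "pk 0 \<le> ?L" using strict_mono_less_eq[OF pk(1), of 0 "Suc m0"] by simp
          have "?L < pk (Suc (bruno_kappa pk ?L))" by (rule bruno_kappa_bounds(2)[OF pk(1) L0])
          moreover have "bruno_kappa pk ?L \<le> m0 + \<kappa>" using True by (simp add: \<kappa>_def)
          ultimately show ?thesis
            using v(3) strict_mono_less_eq[OF pk(1), of "Suc (bruno_kappa pk ?L)" "Suc (m0 + \<kappa>)"] by simp
        qed (use v(3) in \<open>simp add: \<kappa>_def\<close>)
        from dv_ge[OF v(1,2) this] om_pos[of "m0 + \<kappa>"] show ?thesis by (simp add: \<theta>_def)
      qed
      have "real (num_marked (\<lambda>v. \<bar>divisor \<omega> v\<bar> < \<theta> m) t) * (ln (\<theta> m) - ln (\<theta> (Suc m))) \<le> real ?L * a (Suc m0 + m)" for m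
      proof -
        let ?p = "pk (Suc (m0 + m))"
        have p0: "0 < real ?p" using pk_pos by simp
        have "real (num_marked (\<lambda>v. \<bar>divisor \<omega> v\<bar> < \<theta> m) t) \<le> max 0 (2 / ?p * real (nl t - 0) - 1)"
          unfolding \<theta>_def by (rule num_marked_le_siegel[OF pk3 t])
        also have "\<dots> \<le> 2 / ?p * real ?L" using p0 by simp
        finally have c: "real (num_marked (\<lambda>v. \<bar>divisor \<omega> v\<bar> < \<theta> m) t) \<le> 2 / ?p * real ?L" .
        have "0 \<le> ln (\<theta> m) - ln (\<theta> (Suc m))"
          using \<theta>_pos \<theta>_dec by (simp add: antimono_def ln_mono)
        then have "real (num_marked (\<lambda>v. \<bar>divisor \<omega> v\<bar> < \<theta> m) t) * (ln (\<theta> m) - ln (\<theta> (Suc m)))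
            \<le> 2 / ?p * real ?L * (ln (\<theta> m) - ln (\<theta> (Suc m)))"
          by (rule mult_right_mono[OF c])
        \<comment> \<open>The halves in \<theta> cancel in the difference, and the dropped logarithm
          of \<Omega> is at most 0.\<close>
        also have "\<dots> \<le> 2 / ?p * real ?L * (- ln (small_div \<omega> (pk (Suc (Suc m0 + m)))))"
        proof (rule mult_left_mono)
          have "small_div \<omega> (pk (Suc (m0 + m))) \<le> 1" using om_dec[of m0 "m0 + m"] m0 by simp
          then have "ln (small_div \<omega> (pk (Suc (m0 + m)))) \<le> 0" using om_pos by simp
          then show "ln (\<theta> m) - ln (\<theta> (Suc m)) \<le> - ln (small_div \<omega> (pk (Suc (Suc m0 + m))))"
            using om_pos[of "m0 + m"] om_pos[of "Suc (m0 + m)"] by (simp add: \<theta>_def ln_div)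
        qed (use p0 in auto)
        also have "\<dots> = real ?L * a (Suc m0 + m)" by (simp add: a_def)
        finally show ?thesis .
      qed
      then have "(\<Sum>m<\<kappa>. real (num_marked (\<lambda>v. \<bar>divisor \<omega> v\<bar> < \<theta> m) t) * (ln (\<theta> m) - ln (\<theta> (Suc m)))) \<le>
          (\<Sum>m<\<kappa>. real ?L * a (Suc m0 + m))"
        by (intro sum_mono) auto
      also have "\<dots> = real ?L * (\<Sum>m<\<kappa>. a (Suc m0 + m))" by (simp add: sum_distrib_left)
      also have "\<dots> \<le> real ?L * (C + \<bar>M\<bar> + s * ln (real (max N0 1)) + s * ln (real ?L))"
      proof (rule mult_left_mono)
        show "(\<Sum>m<\<kappa>. a (Suc m0 + m)) \<le> C + \<bar>M\<bar> + s * ln (real (max N0 1)) + s * ln (real ?L)"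
        proof (cases "pk (Suc m0) \<le> ?L")
          case True
          have "(\<Sum>m<\<kappa>. a (Suc m0 + m)) = (\<Sum>m\<in>{Suc m0..bruno_kappa pk ?L}. a m)"
            by (rule sum.reindex_bij_witness[of _ "\<lambda>m. m - Suc m0" "\<lambda>m. Suc m0 + m"])
              (use True in \<open>auto simp: \<kappa>_def\<close>)
          then show ?thesis using asum[OF True] by simp
        next
          case False
          then have "\<kappa> = 0" by (simp add: \<kappa>_def)
          then show ?thesis using lnL lnN C0 by simp
        qed
      qed simp
      finally have "(\<Sum>m<\<kappa>. real (num_marked (\<lambda>v. \<bar>divisor \<omega> v\<bar> < \<theta> m) t) * (ln (\<theta> m) - ln (\<theta> (Suc m)))) \<le>
          real ?L * (C + \<bar>M\<bar> + s * ln (real (max N0 1)) + s * ln (real ?L))" .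
      moreover have "log_div \<omega> t \<le> \<bar>ln (\<theta> 0)\<bar> * (real ?L - 1) +
          (\<Sum>m<\<kappa>. real (num_marked (\<lambda>v. \<bar>divisor \<omega> v\<bar> < \<theta> m) t) * (ln (\<theta> m) - ln (\<theta> (Suc m))))"
        by (rule log_div_le_sum_num_marked[OF nonres \<theta>_pos \<theta>_dec t \<kappa>])
      moreover have "\<bar>ln (\<theta> 0)\<bar> * (real ?L - 1) \<le> \<bar>ln (\<theta> 0)\<bar> * real ?L"
        by (intro mult_left_mono) auto
      moreover have "real ?L * (K + s * ln (real ?L)) = \<bar>ln (\<theta> 0)\<bar> * real ?L +
          real ?L * (C + \<bar>M\<bar> + s * ln (real (max N0 1)) + s * ln (real ?L))"
        unfolding K_def by (simp add: algebra_simps)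
      ultimately show ?thesis by linarith
    qed
    then show ?thesis unfolding log_div_bound_def by blast
  qed
qed

section \<open>Continued fractions and the case of two frequencies\<close>

fun cf_p :: "real \<Rightarrow> nat \<Rightarrow> int" where
  "cf_p x 0 = cf_a x 0"
| "cf_p x (Suc 0) = cf_a x 1 * cf_a x 0 + 1"
| "cf_p x (Suc (Suc k)) = cf_a x (Suc (Suc k)) * cf_p x (Suc k) + cf_p x k"

locale pos_irrational =
  fixes w :: real
  assumes w_pos: "0 < w" and w_irrat: "w \<notin> \<rat>"
begin

abbreviation "q k \<equiv> cf_q w k"
abbreviation "p k \<equiv> cf_p w k"

definition err :: "nat \<Rightarrow> real" where
  "err k = real_of_int (q k) * w - real_of_int (p k)"

lemma frac_pos_of_irrational: "x \<notin> \<rat> \<Longrightarrow> 0 < frac x" for x :: real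
  by (metis Ints_subset_Rats frac_gt_0_iff subsetD)

lemma cf_rem_irrational: "cf_rem w k \<notin> \<rat>"
proof (induction k)
  case (Suc k)
  show ?case
  proof
    assume "cf_rem w (Suc k) \<in> \<rat>"
    then have "frac (cf_rem w k) \<in> \<rat>"
      by (metis Rats_inverse cf_rem.simps(2) inverse_inverse_eq)
    then have "frac (cf_rem w k) + of_int \<lfloor>cf_rem w k\<rfloor> \<in> \<rat>"
      by (intro Rats_add) auto
    then show False using Suc by (simp add: frac_def)
  qed
qed (simp add: w_irrat)

lemma cf_a_Suc_ge_1: "1 \<le> cf_a w (Suc k)"
proof -
  have "0 < frac (cf_rem w k)" "frac (cf_rem w k) < 1"
    using frac_pos_of_irrational[OF cf_rem_irrational] frac_lt_1 by auto
  then have "1 < cf_rem w (Suc k)" by (simp add: one_less_inverse)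
  then show ?thesis unfolding cf_a_def by linarith
qed

lemma cf_a_0_nonneg: "0 \<le> cf_a w 0"
  using w_pos by (simp add: cf_a_def)

lemma q_ge_1: "1 \<le> q k"
proof (induction k rule: induct_nat_012)
  case 1
  then show ?case using cf_a_Suc_ge_1[of 0] by simp
next
  case (ge2 k)
  then have "0 \<le> cf_a w (Suc (Suc k)) * q (Suc k)"
    using cf_a_Suc_ge_1[of "Suc k"] by simp
  then show ?case using ge2 by simp
qed simp

lemma p_nonneg: "0 \<le> p k"
proof (induction k rule: induct_nat_012)
  case 1
  then show ?case using cf_a_Suc_ge_1[of 0] cf_a_0_nonneg by simp
next
  case (ge2 k)
  then show ?case using cf_a_Suc_ge_1[of "Suc k"] by simp
qed (simp add: cf_a_0_nonneg)

lemma q_step: "q (Suc k) + q k \<le> q (Suc (Suc k))"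
proof -
  have "1 * q (Suc k) \<le> cf_a w (Suc (Suc k)) * q (Suc k)"
    using cf_a_Suc_ge_1[of "Suc k"] q_ge_1[of "Suc k"] by (intro mult_right_mono) auto
  then show ?thesis by simp
qed

lemma q_le_Suc: "q k \<le> q (Suc k)"
proof (cases k)
  case 0
  then show ?thesis using q_ge_1[of 1] by simp
next
  case (Suc j)
  then show ?thesis using q_step[of j] q_ge_1[of j] by simp
qed

lemma q_mono: "m \<le> n \<Longrightarrow> q m \<le> q n"
  using lift_Suc_mono_le[of q, OF q_le_Suc] .

text \<open>Denominators at least double every two steps. This makes \<open>cf_k\<close> well
  defined and the series of \<open>ln q / q\<close> convergent.\<close>

lemma power_2_le_q: "2 ^ k \<le> 2 * q k ^ 2"
proof (induction k rule: induct_nat_012)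
  case 1
  then show ?case using q_ge_1[of 1] one_le_power[of "q 1" 2] by simp
next
  case (ge2 k)
  have "2 * q k \<le> q (Suc (Suc k))"
    using q_step[of k] q_le_Suc[of k] by linarith
  then have "(2 * q k) ^ 2 \<le> q (Suc (Suc k)) ^ 2"
    using q_ge_1[of k] by (intro power_mono) auto
  then show ?case using ge2 by (simp add: power_mult_distrib)
qed simp

lemma det: "q (Suc k) * p k - p (Suc k) * q k = (- 1) ^ Suc k"
  by (induction k) (auto simp: algebra_simps)

lemma err_0: "err 0 = frac w"
  by (simp add: err_def frac_def cf_a_def)

text \<open>Inductively \<open>err k = - cf_rem w (k + 2) * err (k + 1)\<close>, and adding
  \<open>cf_a w (k + 2) * err (k + 1)\<close> leaves the fractional part of that complete quotient.
  Alternating signs and decreasing size both follow.\<close>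

lemma err_Suc: "err (Suc k) = - frac (cf_rem w (Suc k)) * err k"
proof (induction k)
  case 0
  have "frac w \<noteq> 0" using frac_pos_of_irrational[OF w_irrat] by simp
  moreover have "err (Suc 0) = real_of_int (cf_a w (Suc 0)) * frac w - 1"
    by (simp add: err_def frac_def cf_a_def algebra_simps)
  ultimately show ?case unfolding err_0 frac_def[of "cf_rem w (Suc 0)"] cf_a_def
    by (simp add: algebra_simps)
next
  case (Suc k)
  let ?x = "cf_rem w (Suc k)" and ?y = "cf_rem w (Suc (Suc k))"
  have "frac ?x \<noteq> 0" using frac_pos_of_irrational[OF cf_rem_irrational, of "Suc k"] by simp
  then have "err k = - ?y * err (Suc k)"
    using Suc by (simp add: field_simps)
  moreover have "err (Suc (Suc k)) = real_of_int (cf_a w (Suc (Suc k))) * err (Suc k) + err k"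
    by (simp add: err_def algebra_simps)
  ultimately show ?case
    unfolding frac_def[of ?y] cf_a_def by (simp add: algebra_simps del: cf_rem.simps)
qed

lemma err_alternates: "err k * err (Suc k) \<le> 0"
proof -
  have "err k * err (Suc k) = - (frac (cf_rem w (Suc k)) * (err k)\<^sup>2)"
    unfolding err_Suc by (simp add: power2_eq_square del: cf_rem.simps)
  then show ?thesis
    using mult_nonneg_nonneg[OF frac_ge_0 zero_le_power2, of "cf_rem w (Suc k)" "err k"] by linarith
qed

lemma abs_err_Suc_le: "\<bar>err (Suc k)\<bar> \<le> \<bar>err k\<bar>"
proof -
  have "\<bar>frac (cf_rem w (Suc k))\<bar> \<le> 1"
    using frac_ge_0[of "cf_rem w (Suc k)"] frac_lt_1[of "cf_rem w (Suc k)"] by linarith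
  then show ?thesis
    unfolding err_Suc abs_mult abs_minus_cancel by (rule mult_left_le_one_le[OF abs_ge_zero abs_ge_zero])
qed

text \<open>The determinant of consecutive convergents is 1 or - 1, and since the errors alternate
  in sign, the two terms add in absolute value. This fixes the size of \<open>err k\<close> up to a
  factor 2.\<close>

lemma err_det: "real_of_int (q (Suc k)) * \<bar>err k\<bar> + real_of_int (q k) * \<bar>err (Suc k)\<bar> = 1"
proof -
  have "real_of_int (q (Suc k)) * err k - real_of_int (q k) * err (Suc k) =
      - real_of_int (q (Suc k) * p k - p (Suc k) * q k)"
    by (simp add: err_def algebra_simps)
  then have "\<bar>real_of_int (q (Suc k)) * err k - real_of_int (q k) * err (Suc k)\<bar> = 1"
    unfolding det by (simp add: power_abs)
  moreover have "\<bar>real_of_int (q (Suc k)) * err k - real_of_int (q k) * err (Suc k)\<bar> =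
      \<bar>real_of_int (q (Suc k)) * err k\<bar> + \<bar>real_of_int (q k) * err (Suc k)\<bar>"
  proof -
    have "real_of_int (q (Suc k) * q k) * (err k * err (Suc k)) \<le> 0"
      using q_ge_1[of k] q_ge_1[of "Suc k"] by (intro mult_nonneg_nonpos[OF _ err_alternates]) auto
    then have "(real_of_int (q (Suc k)) * err k) * (real_of_int (q k) * err (Suc k)) \<le> 0"
      by (simp add: algebra_simps)
    moreover have "\<bar>x - y\<bar> = \<bar>x\<bar> + \<bar>y\<bar>" if "x * y \<le> 0" for x y :: real
      using that by (auto simp: mult_le_0_iff)
    ultimately show ?thesis by blast
  qed
  ultimately show ?thesis using q_ge_1[of k] q_ge_1[of "Suc k"] by (simp add: abs_mult)
qed

lemma abs_err_le: "real_of_int (q (Suc k)) * \<bar>err k\<bar> \<le> 1"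
proof -
  have "0 \<le> real_of_int (q k) * \<bar>err (Suc k)\<bar>"
    using q_ge_1[of k] by (intro mult_nonneg_nonneg) auto
  then show ?thesis using err_det[of k] by linarith
qed

lemma abs_err_ge: "1 \<le> 2 * real_of_int (q (Suc k)) * \<bar>err k\<bar>"
proof -
  have "real_of_int (q k) * \<bar>err (Suc k)\<bar> \<le> real_of_int (q (Suc k)) * \<bar>err k\<bar>"
    using q_le_Suc[of k] q_ge_1[of k] abs_err_Suc_le[of k] by (intro mult_mono) auto
  then show ?thesis using err_det[of k] by linarith
qed

text \<open>As the determinant is 1 or - 1, \<open>(m, n)\<close> is an integral combination, with
  coefficients \<open>a\<close> and \<open>b\<close>, of two consecutive convergents. The range of
  \<open>m\<close> forces \<open>a \<noteq> 0\<close> and \<open>a * b \<le> 0\<close>; since the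
  errors alternate too, the two contributions cannot cancel.\<close>

lemma best_approximation:
  assumes m: "1 \<le> m" "m < q (Suc k)"
  shows "\<bar>err k\<bar> \<le> \<bar>real_of_int m * w - real_of_int n\<bar>"
proof -
  define \<sigma> :: int where "\<sigma> = (- 1) ^ Suc k"
  have \<sigma>: "\<sigma> * \<sigma> = 1" unfolding \<sigma>_def by (metis left_minus_one_mult_self mult.right_neutral)
  define a where "a = \<sigma> * (n * q (Suc k) - m * p (Suc k))"
  define b where "b = \<sigma> * (m * p k - n * q k)"
  have "a * q k + b * q (Suc k) = \<sigma> * m * (q (Suc k) * p k - p (Suc k) * q k)"
    "a * p k + b * p (Suc k) = \<sigma> * n * (q (Suc k) * p k - p (Suc k) * q k)"
    by (simp_all add: a_def b_def algebra_simps)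
  then have mn: "m = a * q k + b * q (Suc k)" "n = a * p k + b * p (Suc k)"
    unfolding det \<sigma>_def[symmetric] using \<sigma> by (simp_all add: algebra_simps)
  have e: "real_of_int m * w - real_of_int n = real_of_int a * err k + real_of_int b * err (Suc k)"
    unfolding mn err_def by (simp add: algebra_simps)
  have qpos: "0 < q k" "0 < q (Suc k)" using q_ge_1[of k] q_ge_1[of "Suc k"] by linarith+
  have a0: "a \<noteq> 0"
  proof
    assume "a = 0"
    then have mb: "m = b * q (Suc k)" using mn by simp
    then have "0 < b" using m qpos zero_less_mult_pos2[of b "q (Suc k)"] by linarith
    then have "1 * q (Suc k) \<le> b * q (Suc k)" using qpos by (intro mult_right_mono) auto
    then show False using m mb by linarith
  qed
  have sgn: "a * b \<le> 0"
  proof (rule ccontr)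
    assume "\<not> a * b \<le> 0"
    then consider "1 \<le> a" "1 \<le> b" | "a \<le> - 1" "b \<le> - 1"
      by (auto simp: not_le zero_less_mult_iff)
    then show False
    proof cases
      case 1
      then have "0 \<le> a * q k" "1 * q (Suc k) \<le> b * q (Suc k)"
        using qpos by (auto intro: mult_right_mono)
      then show False using m mn by linarith
    next
      case 2
      then have "a * q k \<le> 0" "b * q (Suc k) \<le> 0"
        using qpos by (auto simp: mult_le_0_iff)
      then show False using m mn by linarith
    qed
  qed
  have "0 \<le> real_of_int (a * b) * (err k * err (Suc k))"
    by (rule mult_nonpos_nonpos[OF _ err_alternates]) (use sgn in \<open>simp only: of_int_le_0_iff\<close>)
  then have "0 \<le> (real_of_int a * err k) * (real_of_int b * err (Suc k))"
    by (simp add: algebra_simps)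
  then have "\<bar>real_of_int a * err k\<bar> \<le> \<bar>real_of_int a * err k + real_of_int b * err (Suc k)\<bar>"
    by (auto simp: zero_le_mult_iff)
  moreover have "1 * \<bar>err k\<bar> \<le> \<bar>real_of_int a\<bar> * \<bar>err k\<bar>"
    using a0 by (intro mult_right_mono) auto
  ultimately show ?thesis unfolding e by (simp add: abs_mult)
qed

text \<open>A smaller denominator does no better than \<open>err (k - 1)\<close>, which is at least
  \<open>1 / (2 * q k)\<close> in modulus.\<close>

lemma q_le_of_close:
  assumes "1 \<le> m" "\<bar>real_of_int m * w - real_of_int n\<bar> < 1 / (2 * real_of_int (q k))"
  shows "q k \<le> m"
proof (cases k)
  case (Suc j)
  show ?thesis
  proof (rule ccontr)
    assume "\<not> q k \<le> m"
    then have "\<bar>err j\<bar> \<le> \<bar>real_of_int m * w - real_of_int n\<bar>"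
      using assms Suc by (intro best_approximation) auto
    then have "\<bar>err j\<bar> < 1 / (2 * real_of_int (q k))" using assms by linarith
    moreover have "0 < real_of_int (q k)" using q_ge_1[of k] by simp
    ultimately show False using abs_err_ge[of j] Suc by (simp add: field_simps)
  qed
qed (use assms in simp)

text \<open>Closeness makes the integer \<open>m * p k - n * q k\<close> less than 1 in modulus,
  hence 0, and \<open>q k\<close> and \<open>p k\<close> are coprime. This rigidity is behind
  Davie's count: below \<open>q (Suc k) / 2\<close> all close approximations come from one
  convergent.\<close>

lemma multiple_of_close:
  assumes m: "1 \<le> m" "2 * m < q (Suc k)"
    and c: "\<bar>real_of_int m * w - real_of_int n\<bar> < 1 / (2 * real_of_int (q k))"
  shows "\<exists>l. m = l * q k \<and> n = l * p k"
proof -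
  have qpos: "0 < real_of_int (q k)" "0 < real_of_int (q (Suc k))"
    using q_ge_1[of k] q_ge_1[of "Suc k"] by simp_all
  have "real_of_int (m * p k - n * q k) =
      real_of_int (q k) * (real_of_int m * w - real_of_int n) - real_of_int m * err k"
    by (simp add: err_def algebra_simps)
  then have "\<bar>real_of_int (m * p k - n * q k)\<bar> \<le>
      real_of_int (q k) * \<bar>real_of_int m * w - real_of_int n\<bar> + real_of_int m * \<bar>err k\<bar>"
    using qpos m by (metis abs_mult abs_of_nonneg abs_triangle_ineq4 less_imp_le of_int_0_le_iff order_trans zero_le_one)
  moreover have "real_of_int (q k) * \<bar>real_of_int m * w - real_of_int n\<bar> < 1 / 2"
    using c qpos by (simp add: field_simps)
  moreover have "2 * (real_of_int m * \<bar>err k\<bar>) \<le> 1"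
  proof -
    have "2 * real_of_int m * \<bar>err k\<bar> \<le> real_of_int (q (Suc k)) * \<bar>err k\<bar>"
      using m(2) by (intro mult_right_mono) linarith+
    then show ?thesis using abs_err_le[of k] by linarith
  qed
  ultimately have "\<bar>real_of_int (m * p k - n * q k)\<bar> < 1" by linarith
  then have "\<bar>m * p k - n * q k\<bar> < 1" by linarith
  then have eq: "m * p k = n * q k" by linarith
  have "coprime (q k) (p k)"
  proof (rule coprimeI)
    fix d assume "d dvd q k" "d dvd p k"
    then have "d dvd q (Suc k) * p k - p (Suc k) * q k" by simp
    then have "d dvd (- 1) ^ Suc k" unfolding det .
    then show "is_unit d" by (metis dvd_trans is_unit_power_iff dvd_minus_iff one_dvd minus_one_mult_self dvd_triv_left)
  qed
  moreover have "q k dvd m * p k" using eq by simp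
  ultimately have "q k dvd m" by (simp add: coprime_dvd_mult_left_iff)
  then obtain l where l: "m = l * q k" by (metis dvd_div_mult_self)
  then have "n * q k = l * p k * q k" using eq by (metis mult.assoc mult.commute)
  then have "n = l * p k" using q_ge_1[of k] by (metis mult_right_cancel not_one_le_zero)
  with l show ?thesis by blast
qed

lemma sum_ln_q_over_q_bounded: "\<exists>C. \<forall>n. (\<Sum>k<n. ln (real_of_int (q k)) / real_of_int (q k)) \<le> C"
proof -
  \<comment> \<open>The fourth root of 2 fits: \<open>2 ^ k \<le> 2 * q k ^ 2\<close> gives
    \<open>b ^ k \<le> 2 * sqrt (q k)\<close>, while \<open>ln x \<le> 2 * sqrt x\<close>.\<close>
  define b :: real where "b = 2 powr (1/4)"
  have b4: "b ^ 4 = 2" unfolding b_def by (simp add: powr_power)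
  have b1: "1 < b" unfolding b_def by simp
  have le: "ln (real_of_int (q k)) / real_of_int (q k) \<le> 4 * (1 / b) ^ k" for k
  proof -
    let ?x = "real_of_int (q k)"
    have x1: "1 \<le> ?x" using q_ge_1[of k] by simp
    have "real_of_int (2 ^ k) \<le> real_of_int (2 * q k ^ 2)"
      using power_2_le_q[of k] by (simp only: of_int_le_iff)
    then have "2 ^ k \<le> 2 * ?x ^ 2" by simp
    moreover have "(b ^ k) ^ 4 = 2 ^ k" by (metis b4 power_commutes power_mult mult.commute)
    moreover have "(2 * sqrt ?x) ^ 4 = 16 * ?x ^ 2"
    proof -
      have "(sqrt ?x) ^ 4 = ((sqrt ?x) ^ 2) ^ 2" by (simp flip: power_mult)
      then show ?thesis using x1 by (simp add: power_mult_distrib)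
    qed
    ultimately have "(b ^ k) ^ 4 \<le> (2 * sqrt ?x) ^ 4"
      using zero_le_power2[of ?x] by linarith
    then have bk: "b ^ k \<le> 2 * sqrt ?x" using x1 b1 by (subst (asm) power_mono_iff) auto
    have "ln ?x = 2 * ln (sqrt ?x)" using x1 by (simp add: ln_sqrt)
    also have "\<dots> \<le> 2 * sqrt ?x" using ln_le_minus_one[of "sqrt ?x"] x1 by simp
    finally have "ln ?x * b ^ k \<le> 2 * sqrt ?x * (2 * sqrt ?x)"
      using bk x1 b1 by (intro mult_mono) auto
    also have "\<dots> = 4 * ?x" using x1 by simp
    finally show ?thesis using x1 b1 by (simp add: field_simps power_divide)
  qed
  have sm: "summable (\<lambda>k. 4 * (1 / b) ^ k)"
    using b1 by (intro summable_mult summable_geometric) simp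
  have "(\<Sum>k<n. ln (real_of_int (q k)) / real_of_int (q k)) \<le> (\<Sum>k. 4 * (1 / b) ^ k)" for n
  proof -
    have "(\<Sum>k<n. ln (real_of_int (q k)) / real_of_int (q k)) \<le> (\<Sum>k<n. 4 * (1 / b) ^ k)"
      by (intro sum_mono le)
    also have "\<dots> \<le> (\<Sum>k. 4 * (1 / b) ^ k)"
      using b1 by (intro sum_le_suminf[OF sm]) auto
    finally show ?thesis .
  qed
  then show ?thesis by blast
qed

lemma cf_k_bounds:
  assumes "1 \<le> N"
  shows "q (cf_k w N) \<le> int N" "int N < q (Suc (cf_k w N))"
proof -
  have b: "\<forall>k. q k \<le> int N \<longrightarrow> k \<le> 2 * N ^ 2"
  proof (intro allI impI)
    fix k assume k: "q k \<le> int N"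
    have "int k < 2 ^ k" by (metis of_nat_less_two_power)
    also have "\<dots> \<le> 2 * q k ^ 2" by (rule power_2_le_q)
    also have "\<dots> \<le> 2 * int N ^ 2"
      using k q_ge_1[of k] by (intro mult_left_mono power_mono) auto
    finally have "int k < int (2 * N ^ 2)" by simp
    then show "k \<le> 2 * N ^ 2" by linarith
  qed
  show "q (cf_k w N) \<le> int N"
    unfolding cf_k_def
    by (rule GreatestI_nat[where P = "\<lambda>k. q k \<le> int N" and b = "2 * N ^ 2" and k = 0]) (use b assms in auto)
  show "int N < q (Suc (cf_k w N))"
  proof (rule ccontr)
    assume "\<not> int N < q (Suc (cf_k w N))"
    then have "Suc (cf_k w N) \<le> cf_k w N"
      unfolding cf_k_def
      by (intro Greatest_le_nat[where P = "\<lambda>k. q k \<le> int N" and b = "2 * N ^ 2"]) (use b in auto)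
    then show False by simp
  qed
qed

lemma cf_k_mono:
  assumes "1 \<le> M" "M \<le> N"
  shows "cf_k w M \<le> cf_k w N"
proof (rule ccontr)
  assume "\<not> cf_k w M \<le> cf_k w N"
  then have "q (Suc (cf_k w N)) \<le> q (cf_k w M)" by (intro q_mono) simp
  then show False using cf_k_bounds(1)[OF assms(1)] cf_k_bounds(2)[of N] assms by linarith
qed

end

section \<open>Davie's count for two frequencies\<close>

lemma excess_step:
  fixes B x y :: real
  assumes B: "0 < B" and "0 \<le> x" and gap: "B \<le> y - x" and sum: "(\<Sum>n\<leftarrow>ns. real n) \<le> y - x"
    and le: "\<forall>n\<in>set ns. real n \<le> x"
  shows "1 + max 0 (2 / B * x - 1) + (\<Sum>n\<leftarrow>ns. max 0 (2 / B * real n - 1)) \<le> max 0 (2 / B * y - 1)"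
\<comment> \<open>\<open>x\<close> is the largest branch, \<open>ns\<close> are the others. If
  \<open>x < B / 2\<close>, no branch has any excess, and \<open>y \<ge> B\<close> pays for the
  vertex. Otherwise both \<open>x\<close> and the bound for the rest carry an effective deduction of
  1, and one of these two pays for the vertex.\<close>
proof (cases "x < B / 2")
  case True
  have "(\<Sum>n\<leftarrow>ns. max 0 (2 / B * real n - 1)) = (\<Sum>n\<leftarrow>ns. 0)"
    using True le B by (intro arg_cong[where f = sum_list] map_cong) (auto simp: field_simps max_def)
  moreover have "max 0 (2 / B * x - 1) = 0" using True B by (simp add: field_simps)
  moreover have "B \<le> y" using gap \<open>0 \<le> x\<close> by linarith
  ultimately show ?thesis using B by (simp add: field_simps)
next
  case False
  have "(\<Sum>n\<leftarrow>ns. max 0 (2 / B * real (n - 0) - 1)) \<le> max 0 (2 / B * real (sum_list ns - 0) - 1)"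
    using B by (intro sum_max_superadditive) auto
  then have 1: "(\<Sum>n\<leftarrow>ns. max 0 (2 / B * real n - 1)) \<le> max 0 (2 / B * real (sum_list ns) - 1)"
    by simp
  have "real (sum_list ns) \<le> y - x" using sum by (simp add: sum_list_of_nat)
  then have "2 / B * real (sum_list ns) \<le> 2 / B * (y - x)" using B by (intro mult_left_mono) auto
  moreover have "2 \<le> 2 / B * (y - x)" using gap B by (simp add: field_simps)
  moreover have "1 \<le> 2 / B * x" using False B by (simp add: field_simps)
  moreover have "2 / B * (y - x) = 2 / B * y - 2 / B * x" by (rule right_diff_distrib)
  ultimately show ?thesis using 1 by linarith
qed

locale two_frequencies =
  fixes \<omega> :: "'n::finite \<Rightarrow> real" and i1 i2 :: 'n
  assumes univ: "UNIV = {i1, i2}" and distinct: "i1 \<noteq> i2"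
    and \<omega>2: "\<omega> i2 \<noteq> 0" and ratio_pos: "0 < - \<omega> i1 / \<omega> i2" and ratio_irrat: "- \<omega> i1 / \<omega> i2 \<notin> \<rat>"
begin

definition w where "w = - \<omega> i1 / \<omega> i2"

sublocale pos_irrational w
  by unfold_locales (use ratio_pos ratio_irrat in \<open>auto simp: w_def\<close>)

text \<open>Up to the factor \<open>- \<omega> i2\<close> the divisor is \<open>a * w - b\<close>,
  where \<open>a\<close> and \<open>b\<close> are the entries of the multi-index after one is taken
  off at \<open>j\<close>, so that \<open>a + b = size M - 1\<close>. A small divisor is thus a good
  rational approximation of \<open>w\<close>, and for a multiple of a convergent
  \<open>a + b\<close> is divisible by \<open>q k + p k\<close>.\<close>

lemma close_to_resonance:
  assumes size: "2 \<le> size M"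
    and c: "\<bar>mi_dot (count M) \<omega> - \<omega> j\<bar> < \<bar>\<omega> i2\<bar> / (2 * real_of_int (q k))"
  shows "q k \<le> int (size M) - 1"
    and "2 * (int (size M) - 1) < q (Suc k) \<Longrightarrow> (q k + p k) dvd (int (size M) - 1)"
proof -
  define a where "a = int (count M i1) - of_bool (j = i1)"
  define b where "b = int (count M i2) - of_bool (j = i2)"
  have j: "j = i1 \<or> j = i2" using univ by auto
  have "mi_abs (count M) = count M i1 + count M i2"
    unfolding mi_abs_def univ using distinct by simp
  then have ab: "a + b = int (size M) - 1"
    using j distinct by (auto simp: a_def b_def mi_abs_count)
  have "mi_dot (count M) \<omega> - \<omega> j = real_of_int a * \<omega> i1 + real_of_int b * \<omega> i2"
    unfolding mi_dot_def univ using j distinct by (auto simp: a_def b_def algebra_simps)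
  also have "\<dots> = - \<omega> i2 * (real_of_int a * w - real_of_int b)"
    using \<omega>2 by (simp add: w_def field_simps)
  finally have "\<bar>\<omega> i2\<bar> * \<bar>real_of_int a * w - real_of_int b\<bar> < \<bar>\<omega> i2\<bar> * (1 / (2 * real_of_int (q k)))"
    using c by (simp add: abs_mult)
  then have close: "\<bar>real_of_int a * w - real_of_int b\<bar> < 1 / (2 * real_of_int (q k))"
    using \<omega>2 by (metis mult_less_cancel_left_pos zero_less_abs_iff)
  have half: "1 / (2 * real_of_int (q k)) \<le> 1 / 2" using q_ge_1[of k] by simp
  have ge: "- 1 \<le> a" by (simp add: a_def)
  \<comment> \<open>For \<open>a \<le> 0\<close> the size of \<open>M\<close> forces
    \<open>b \<ge> 1\<close>, and positivity of \<open>w\<close> keeps \<open>a * w - b\<close> at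
    distance at least 1 from 0.\<close>
  have a1: "1 \<le> a"
  proof (rule ccontr)
    assume "\<not> 1 \<le> a"
    then have "a \<le> 0" "1 \<le> b" using ab size by linarith+
    then have "real_of_int a * w \<le> 0" using w_pos by (simp add: mult_le_0_iff)
    then show False using close half \<open>1 \<le> b\<close> by linarith
  qed
  then have "0 < real_of_int a * w" using w_pos by simp
  then have "- 1 < real_of_int b" using close half by linarith
  then have b0: "0 \<le> b" by linarith
  show "q k \<le> int (size M) - 1"
    using q_le_of_close[OF a1 close] ab b0 by linarith
  assume "2 * (int (size M) - 1) < q (Suc k)"
  moreover have "a \<le> int (size M) - 1" using ab b0 by linarith
  then have "2 * a \<le> 2 * (int (size M) - 1)" by (intro mult_left_mono) auto
  ultimately have "2 * a < q (Suc k)" by (rule le_less_trans[rotated])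
  from multiple_of_close[OF a1 this close] obtain l where "a = l * q k" "b = l * p k" by blast
  then have "int (size M) - 1 = l * (q k + p k)" using ab by (simp add: algebra_simps)
  then show "(q k + p k) dvd (int (size M) - 1)" by simp
qed

text \<open>The natural weight is \<open>nl - 1\<close>, the number that \<open>q k + p k\<close>
  divides at a marked vertex. If the increment of this weight over the largest marked branch is
  below \<open>q (Suc k) / 2\<close>, the new vertex takes up a full multiple of
  \<open>q k + p k\<close>, paid by the linear term; otherwise the increment is paid by the excess
  term. The threshold is half of that in \<open>close_to_resonance\<close>, so that differences of
  marked divisors qualify too.\<close>

lemma num_marked_le_davie:
  assumes "proper t"
  shows "real (num_marked (\<lambda>v. \<bar>divisor \<omega> v\<bar> < \<bar>\<omega> i2\<bar> / (4 * real_of_int (q k))) t) \<le>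
    real (nl t - 1) / real_of_int (q k + p k) + max 0 (2 / (real_of_int (q (Suc k)) / 2) * real (nl t - 1) - 1)"
    (is "_ \<le> real (nl t - 1) / ?Q + max 0 (2 / ?B * _ - 1)")
proof -
  let ?S = "\<lambda>v. \<bar>divisor \<omega> v\<bar> < \<bar>\<omega> i2\<bar> / (4 * real_of_int (q k))"
  define \<phi> where "\<phi> n = max 0 (2 / ?B * real n - 1)" for n :: nat
  have qpos: "0 < real_of_int (q k)" using q_ge_1[of k] by simp
  have Q: "0 < ?Q" using q_ge_1[of k] p_nonneg[of k] by simp
  have B: "0 < ?B" using q_ge_1[of "Suc k"] by simp
  have quarter: "\<bar>\<omega> i2\<bar> / (4 * real_of_int (q k)) \<le> \<bar>\<omega> i2\<bar> / (2 * real_of_int (q k))"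
    "\<bar>\<omega> i2\<bar> / (4 * real_of_int (q k)) + \<bar>\<omega> i2\<bar> / (4 * real_of_int (q k)) = \<bar>\<omega> i2\<bar> / (2 * real_of_int (q k))"
    using qpos \<omega>2 by (simp_all add: field_simps)
  have small: "(q k + p k) dvd int (nl v - 1)"
    if "proper v" "?S v" "\<not> is_Lf v" "2 * int (nl v - 1) < q (Suc k)" for v
  proof -
    have "2 \<le> nl v" using that nl_Nd_ge_2 by (cases v) auto
    then show ?thesis
      using close_to_resonance(2)[of "mset (leaves v)" "tree_root v" k] that quarter
      unfolding divisor_mi_dot by (simp add: of_nat_diff)
  qed
  have "real (num_marked ?S t) \<le> real (nl t - 1) / ?Q + \<phi> (nl t - 1)"
    using assms
  proof (rule num_marked_le[where G = "\<lambda>n. real (n - 1) / ?Q + \<phi> (n - 1)", rotated 2])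
    fix ns :: "nat list" and m assume m: "sum_list ns \<le> m"
    have "(\<Sum>n\<leftarrow>ns. real (n - 1)) \<le> real (m - 1)"
    proof -
      have "(\<Sum>n\<leftarrow>ns. n - 1) \<le> sum_list ns - 1" by (induction ns) auto
      then have "real (\<Sum>n\<leftarrow>ns. n - 1) \<le> real (m - 1)" using m by simp
      moreover have "real (\<Sum>n\<leftarrow>ns. n - 1) = (\<Sum>n\<leftarrow>ns. real (n - 1))" by (induction ns) auto
      ultimately show ?thesis by linarith
    qed
    then have "(\<Sum>n\<leftarrow>ns. real (n - 1)) / ?Q \<le> real (m - 1) / ?Q"
      using Q by (intro divide_right_mono) auto
    moreover have "(\<Sum>n\<leftarrow>ns. real (n - 1)) / ?Q = (\<Sum>n\<leftarrow>ns. real (n - 1) / ?Q)"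
      by (induction ns) (auto simp: add_divide_distrib)
    moreover have "(\<Sum>n\<leftarrow>ns. \<phi> (n - 1)) \<le> \<phi> (m - 1)"
      unfolding \<phi>_def using B m
      by (intro order_trans[OF sum_max_superadditive max_linear_mono]) auto
    ultimately show "(\<Sum>n\<leftarrow>ns. real (n - 1) / ?Q + \<phi> (n - 1)) \<le> real (m - 1) / ?Q + \<phi> (m - 1)"
      by (simp add: sum_list_addf)
  next
    fix j and ts vs :: "'n ltree list"
    let ?t = "Nd j ts"
    assume t: "proper ?t" "?S ?t"
      and vs: "\<forall>v\<in>set vs. proper v \<and> ?S v \<and> \<not> is_Lf v \<and> nl v < nl ?t"
      and sub: "(\<Sum>v\<leftarrow>vs. mset (leaves v)) \<subseteq># mset (leaves ?t)"
    define u where "u = nl ?t - 1"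
    have u1: "1 \<le> u" using nl_Nd_ge_2[OF t(1)] by (simp add: u_def del: leaves.simps)
    have split: "(\<Sum>v\<leftarrow>xs. real (nl v - 1) / ?Q + \<phi> (nl v - 1)) =
        real (\<Sum>v\<leftarrow>xs. nl v - 1) / ?Q + (\<Sum>v\<leftarrow>xs. \<phi> (nl v - 1))" for xs :: "'n ltree list"
      by (induction xs) (auto simp: add_divide_distrib)
    show "1 + (\<Sum>v\<leftarrow>vs. real (nl v - 1) / ?Q + \<phi> (nl v - 1)) \<le>
        real (nl ?t - 1) / ?Q + \<phi> (nl ?t - 1)"
    proof (cases "vs = []")
      case True
      have "1 \<le> real u / ?Q + \<phi> u"
      proof (cases "2 * int u < q (Suc k)")
        case True
        then have "(q k + p k) dvd int u" unfolding u_def using t by (intro small) auto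
        then have "q k + p k \<le> int u" using u1 by (intro zdvd_imp_le) auto
        then have "1 \<le> real u / ?Q" using Q by simp
        then show ?thesis by (simp add: \<phi>_def)
      next
        case False
        then have "2 \<le> 2 / ?B * real u" using B by (simp add: field_simps)
        moreover have "0 \<le> real u / ?Q" using Q by (intro divide_nonneg_nonneg) auto
        ultimately show ?thesis unfolding \<phi>_def by linarith
      qed
      then show ?thesis using True by (simp add: u_def del: leaves.simps)
    next
      case False
      \<comment> \<open>The largest branch is singled out because \<open>excess_step\<close> needs
        the others to be no larger.\<close>
      define x where "x = Max (set (map nl vs))"
      have "x \<in> set (map nl vs)" unfolding x_def using False by (intro Max_in) auto
      then obtain v where v: "v \<in> set vs" "nl v = x" by auto
      have vmax: "nl v' \<le> nl v" if "v' \<in> set vs" for v'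
        unfolding v(2) x_def using that by (intro Max_ge) auto
      obtain xs ys where xys: "vs = xs @ v # ys" using v by (meson split_list)
      define rest where "rest = map (\<lambda>v. nl v - 1) (xs @ ys)"
      define d where "d = u - (nl v - 1)"
      have vt: "proper v" "?S v" "\<not> is_Lf v" "nl v < nl ?t" using vs v by auto
      have nlv: "1 \<le> nl v" by (rule nl_ge_1[OF vt(1)])
      have sum_rest: "(\<Sum>v\<leftarrow>vs. real (nl v - 1) / ?Q + \<phi> (nl v - 1)) =
          real (nl v - 1) / ?Q + \<phi> (nl v - 1) + real (sum_list rest) / ?Q + (\<Sum>n\<leftarrow>rest. \<phi> n)"
        unfolding split xys rest_def by (simp add: add_divide_distrib comp_def)
      have ud: "u = nl v - 1 + d" unfolding d_def u_def using vt(4) by linarith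
      have d1: "sum_list rest + 1 \<le> d"
      proof (cases "xs @ ys = []")
        case True
        then show ?thesis using vt(4) nlv by (simp add: rest_def d_def u_def del: leaves.simps)
      next
        case False
        then have "1 \<le> length (xs @ ys)" by (cases "xs @ ys") auto
        moreover have "(\<Sum>v\<leftarrow>xs @ ys. nl v - 1) + length (xs @ ys) = (\<Sum>v\<leftarrow>xs @ ys. nl v)"
        proof -
          have "\<forall>v\<in>set (xs @ ys). 1 \<le> nl v" using vs xys nl_pos by (force simp: Suc_le_eq)
          then show ?thesis by (induction "xs @ ys" arbitrary: xs ys) (auto simp: Cons_eq_append_conv, fastforce+)
        qed
        moreover have "(\<Sum>v\<leftarrow>xs @ ys. nl v) + nl v \<le> nl ?t"
          using sum_list_nl_le[OF sub] unfolding xys by simp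
        ultimately show ?thesis unfolding rest_def d_def u_def using nlv by linarith
      qed
      have rest_le: "n \<le> sum_list rest" if "n \<in> set rest" for n
        using that by (auto intro: member_le_sum_list)
      have sv: "mset (leaves v) \<subseteq># mset (leaves ?t)"
        using sub unfolding xys by (metis (no_types, lifting) mset_subset_eq_add_right subset_mset.order_trans
          map_append list.map(2) sum_list.append sum_list.Cons mset_subset_eq_add_left)
      show ?thesis
      \<comment> \<open>In the first case \<open>d\<close> and the weights of the other branches,
        whose sum is at most \<open>d - 1\<close>, are all divisible by \<open>q k + p k\<close>; so
        the positive difference of \<open>d\<close> and that sum is at least
        \<open>q k + p k\<close>.\<close>
      proof (cases "2 * int d < q (Suc k)")
        case True
        let ?M = "mset (leaves ?t) - mset (leaves v) + {#tree_root v#}"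
        have sM: "size ?M = d + 1"
          using divisor_diff(2)[OF sv] nlv vt(4) unfolding mi_abs_count d_def u_def by linarith
        have "(q k + p k) dvd int (size ?M) - 1"
        proof (rule close_to_resonance(2))
          show "\<bar>mi_dot (count ?M) \<omega> - \<omega> (tree_root ?t)\<bar> < \<bar>\<omega> i2\<bar> / (2 * real_of_int (q k))"
            unfolding divisor_diff(1)[OF sv, symmetric] using t(2) vt(2) quarter(2) by linarith
          show "2 \<le> size ?M" "2 * (int (size ?M) - 1) < q (Suc k)" unfolding sM using d1 True by simp_all
        qed
        then have dvd_d: "(q k + p k) dvd int d" unfolding sM by simp
        have "(q k + p k) dvd int n" if n: "n \<in> set rest" for n
        proof -
          obtain v' where v': "v' \<in> set vs" "n = nl v' - 1"
            using n unfolding rest_def xys by auto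
          have "2 * int n < q (Suc k)" using rest_le[OF n] d1 True by linarith
          then show ?thesis unfolding v'(2) using vs v'(1) by (intro small) auto
        qed
        then have "(q k + p k) dvd int (sum_list rest)"
          by (induction rest) auto
        with dvd_d have "(q k + p k) dvd int d - int (sum_list rest)" by (rule dvd_diff)
        then have "q k + p k \<le> int d - int (sum_list rest)" using d1 by (intro zdvd_imp_le) auto
        then have "?Q + real (sum_list rest) + real (nl v - 1) \<le> real u"
          unfolding ud by linarith
        then have "(?Q + real (sum_list rest) + real (nl v - 1)) / ?Q \<le> real u / ?Q"
          using Q by (intro divide_right_mono) auto
        then have 1: "1 + real (sum_list rest) / ?Q + real (nl v - 1) / ?Q \<le> real u / ?Q"
          using Q by (simp add: add_divide_distrib)
        have "(\<Sum>n\<leftarrow>(nl v - 1) # rest. max 0 (2 / ?B * real (n - 0) - 1)) \<le>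
            max 0 (2 / ?B * real (u - 0) - 1)"
          using B d1 ud by (intro order_trans[OF sum_max_superadditive max_linear_mono]) auto
        then have "\<phi> (nl v - 1) + (\<Sum>n\<leftarrow>rest. \<phi> n) \<le> \<phi> u"
          by (simp add: \<phi>_def)
        with 1 show ?thesis unfolding sum_rest u_def by linarith
      next
        case False
        have "1 + \<phi> (nl v - 1) + (\<Sum>n\<leftarrow>rest. \<phi> n) \<le> \<phi> u"
          unfolding \<phi>_def
        proof (rule excess_step[OF B])
          show "?B \<le> real u - real (nl v - 1)" using False unfolding ud by simp
          show "(\<Sum>n\<leftarrow>rest. real n) \<le> real u - real (nl v - 1)"
            using d1 unfolding ud by (simp add: sum_list_of_nat)
          show "\<forall>n\<in>set rest. real n \<le> real (nl v - 1)"
            unfolding rest_def using vmax xys by (force intro: diff_le_mono)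
        qed simp
        moreover have "(real (nl v - 1) + real (sum_list rest)) / ?Q \<le> real u / ?Q"
          using Q d1 ud by (intro divide_right_mono) auto
        ultimately show ?thesis unfolding sum_rest u_def add_divide_distrib by linarith
      qed
    qed
  qed
  then show ?thesis unfolding \<phi>_def .
qed

text \<open>The thresholds are proportional to \<open>1 / q k\<close>. The linear term of the count
  reproduces the sum in the condition with factor 1 instead of Siegel's 2, and the excess term
  contributes only the convergent series of \<open>ln q / q\<close>.\<close>

lemma log_div_bound_bruno1:
  assumes nonres: "non_resonant \<omega>" and bruno1: "bruno1_cond s (\<omega> i1) (\<omega> i2)" and s: "0 < s"
  shows "log_div_bound s \<omega>"
proof -
  obtain M N0 where bru: "\<And>N::nat. N0 \<le> N \<Longrightarrow>
      (\<Sum>j = 0..cf_k w N. ln (real_of_int (q (Suc j))) / real_of_int (q j)) - s * ln (real N) \<le> M"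
    using bruno1 unfolding bruno1_cond_def w_def[symmetric] Let_def by blast
  obtain C where C: "\<And>n. (\<Sum>k<n. ln (real_of_int (q k)) / real_of_int (q k)) \<le> C"
    using sum_ln_q_over_q_bounded by blast
  have C0: "0 \<le> C" using C[of 0] by simp
  define \<theta> where "\<theta> k = \<bar>\<omega> i2\<bar> / (4 * real_of_int (q k))" for k
  define b where "b k = ln (real_of_int (q (Suc k)))" for k
  have qr: "1 \<le> real_of_int (q k)" for k using q_ge_1[of k] by simp
  have b0: "0 \<le> b k" for k using qr[of "Suc k"] by (simp add: b_def)
  have bq0: "0 \<le> b k / real_of_int (q k)" for k using b0[of k] qr[of k] by (intro divide_nonneg_nonneg) auto
  have \<theta>_pos: "0 < \<theta> k" for k using \<omega>2 q_ge_1[of k] by (simp add: \<theta>_def)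
  have \<theta>_dec: "antimono \<theta>"
    using q_mono q_ge_1 by (auto simp: antimono_def \<theta>_def intro!: divide_left_mono mult_pos_pos)
      (metis less_le_trans zero_less_one)+
  define K where "K = \<bar>ln (\<theta> 0)\<bar> + \<bar>M\<bar> + s * ln (real (max N0 1)) + 4 * C"
  have main: "(\<Sum>k<Suc (cf_k w L). b k / real_of_int (q k)) \<le> \<bar>M\<bar> + s * ln (real (max N0 1)) + s * ln (real L)"
    if L: "1 \<le> L" for L
  proof -
    define N where "N = max N0 L"
    have "(\<Sum>k<Suc (cf_k w L). b k / real_of_int (q k)) \<le> (\<Sum>k<Suc (cf_k w N). b k / real_of_int (q k))"
      using cf_k_mono[OF L, of N] bq0 by (intro sum_mono2) (auto simp: N_def)
    also have "\<dots> = (\<Sum>j = 0..cf_k w N. ln (real_of_int (q (Suc j))) / real_of_int (q j))"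
      by (intro sum.cong) (auto simp: b_def)
    also have "\<dots> \<le> M + s * ln (real N)" using bru[of N] by (simp add: N_def)
    finally have 1: "(\<Sum>k<Suc (cf_k w L). b k / real_of_int (q k)) \<le> M + s * ln (real N)" .
    have "real N \<le> real (max N0 1) * real L"
    proof -
      have "N \<le> max N0 1 * L"
        unfolding N_def using L by (cases "N0 \<le> L") (auto simp: max_def)
      then show ?thesis by (metis of_nat_le_iff of_nat_mult)
    qed
    then have "ln (real N) \<le> ln (real (max N0 1) * real L)"
      using L by (intro ln_mono) (auto simp: N_def)
    also have "\<dots> = ln (real (max N0 1)) + ln (real L)"
      using L by (intro ln_mult_pos) auto
    finally have "s * ln (real N) \<le> s * ln (real (max N0 1)) + s * ln (real L)"
      using s by (metis distrib_left mult_left_mono less_imp_le)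
    with 1 show ?thesis by linarith
  qed
  have "log_div \<omega> t \<le> real (nl t) * (K + s * ln (real (nl t)))" if t: "proper t" for t
  proof -
    let ?L = "nl t"
    have L1: "1 \<le> ?L" by (rule nl_ge_1[OF t])
    define \<kappa> where "\<kappa> = Suc (cf_k w ?L)"
    have \<kappa>: "\<theta> \<kappa> \<le> \<bar>divisor \<omega> v\<bar>" if v: "proper v" "\<not> is_Lf v" "nl v \<le> ?L" for v
    proof (rule ccontr)
      assume "\<not> \<theta> \<kappa> \<le> \<bar>divisor \<omega> v\<bar>"
      moreover have "\<theta> \<kappa> \<le> \<bar>\<omega> i2\<bar> / (2 * real_of_int (q \<kappa>))"
        using qr[of \<kappa>] unfolding \<theta>_def by (intro divide_left_mono) auto
      moreover have "2 \<le> nl v" using v nl_Nd_ge_2 by (cases v) auto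
      ultimately have "q \<kappa> \<le> int (nl v) - 1"
        using close_to_resonance(1)[of "mset (leaves v)" "tree_root v" \<kappa>] unfolding divisor_mi_dot by simp
      then show False using cf_k_bounds(2)[OF L1] v(3) unfolding \<kappa>_def by linarith
    qed
    have "real (num_marked (\<lambda>v. \<bar>divisor \<omega> v\<bar> < \<theta> k) t) * (ln (\<theta> k) - ln (\<theta> (Suc k))) \<le>
        real ?L * (b k / real_of_int (q k) + 4 * (b k / real_of_int (q (Suc k))))" for k
    proof -
      have p0: "0 \<le> real_of_int (p k)" using p_nonneg by simp
      have "real (num_marked (\<lambda>v. \<bar>divisor \<omega> v\<bar> < \<theta> k) t) \<le>
          real (?L - 1) / real_of_int (q k + p k) + max 0 (2 / (real_of_int (q (Suc k)) / 2) * real (?L - 1) - 1)"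
        unfolding \<theta>_def by (rule num_marked_le_davie[OF t])
      also have "real (?L - 1) / real_of_int (q k + p k) \<le> real ?L / real_of_int (q k)"
        using qr[of k] p0 by (intro frac_le) auto
      also have "max 0 (2 / (real_of_int (q (Suc k)) / 2) * real (?L - 1) - 1) \<le> 4 * (real ?L / real_of_int (q (Suc k)))"
      proof -
        have "real (?L - 1) / real_of_int (q (Suc k)) \<le> real ?L / real_of_int (q (Suc k))"
          using qr[of "Suc k"] by (intro divide_right_mono) auto
        moreover have "0 \<le> real ?L / real_of_int (q (Suc k))"
          using qr[of "Suc k"] by (intro divide_nonneg_nonneg) auto
        ultimately show ?thesis by simp
      qed
      finally have c: "real (num_marked (\<lambda>v. \<bar>divisor \<omega> v\<bar> < \<theta> k) t) \<le>
          real ?L / real_of_int (q k) + 4 * (real ?L / real_of_int (q (Suc k)))" by simp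
      have "ln (\<theta> k) - ln (\<theta> (Suc k)) = b k - ln (real_of_int (q k))"
        unfolding \<theta>_def b_def using \<omega>2 qr[of k] qr[of "Suc k"]
        by (simp add: ln_div ln_mult)
      moreover have "0 \<le> ln (real_of_int (q k))" using qr[of k] by simp
      moreover have "0 \<le> ln (\<theta> k) - ln (\<theta> (Suc k))"
        using \<theta>_pos \<theta>_dec by (simp add: antimono_def ln_mono)
      ultimately have "real (num_marked (\<lambda>v. \<bar>divisor \<omega> v\<bar> < \<theta> k) t) * (ln (\<theta> k) - ln (\<theta> (Suc k))) \<le>
          (real ?L / real_of_int (q k) + 4 * (real ?L / real_of_int (q (Suc k)))) * b k"
        using qr[of k] qr[of "Suc k"] by (intro mult_mono c) (auto intro!: add_nonneg_nonneg divide_nonneg_nonneg)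
      also have "\<dots> = real ?L * (b k / real_of_int (q k) + 4 * (b k / real_of_int (q (Suc k))))"
        by (simp add: algebra_simps)
      finally show ?thesis .
    qed
    then have "(\<Sum>k<\<kappa>. real (num_marked (\<lambda>v. \<bar>divisor \<omega> v\<bar> < \<theta> k) t) * (ln (\<theta> k) - ln (\<theta> (Suc k)))) \<le>
        (\<Sum>k<\<kappa>. real ?L * (b k / real_of_int (q k) + 4 * (b k / real_of_int (q (Suc k)))))"
      by (intro sum_mono) auto
    also have "\<dots> = real ?L * ((\<Sum>k<\<kappa>. b k / real_of_int (q k)) + 4 * (\<Sum>k<\<kappa>. b k / real_of_int (q (Suc k))))"
      by (simp only: sum_distrib_left sum.distrib distrib_left)
    also have "\<dots> \<le> real ?L * ((\<bar>M\<bar> + s * ln (real (max N0 1)) + s * ln (real ?L)) + 4 * C)"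
    proof (intro mult_left_mono add_mono)
      show "(\<Sum>k<\<kappa>. b k / real_of_int (q k)) \<le> \<bar>M\<bar> + s * ln (real (max N0 1)) + s * ln (real ?L)"
        unfolding \<kappa>_def by (rule main[OF L1])
      have "(\<Sum>k<\<kappa>. b k / real_of_int (q (Suc k))) \<le> (\<Sum>k<Suc \<kappa>. ln (real_of_int (q k)) / real_of_int (q k))"
        unfolding b_def sum.lessThan_Suc_shift by simp
      then show "(\<Sum>k<\<kappa>. b k / real_of_int (q (Suc k))) \<le> C" using C[of "Suc \<kappa>"] by linarith
    qed auto
    finally have "(\<Sum>k<\<kappa>. real (num_marked (\<lambda>v. \<bar>divisor \<omega> v\<bar> < \<theta> k) t) * (ln (\<theta> k) - ln (\<theta> (Suc k)))) \<le>
        real ?L * ((\<bar>M\<bar> + s * ln (real (max N0 1)) + s * ln (real ?L)) + 4 * C)" .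
    moreover have "log_div \<omega> t \<le> \<bar>ln (\<theta> 0)\<bar> * (real ?L - 1) +
        (\<Sum>k<\<kappa>. real (num_marked (\<lambda>v. \<bar>divisor \<omega> v\<bar> < \<theta> k) t) * (ln (\<theta> k) - ln (\<theta> (Suc k))))"
      by (rule log_div_le_sum_num_marked[OF nonres \<theta>_pos \<theta>_dec t \<kappa>])
    moreover have "\<bar>ln (\<theta> 0)\<bar> * (real ?L - 1) \<le> \<bar>ln (\<theta> 0)\<bar> * real ?L"
      by (intro mult_left_mono) auto
    moreover have "real ?L * (K + s * ln (real ?L)) = \<bar>ln (\<theta> 0)\<bar> * real ?L +
        real ?L * ((\<bar>M\<bar> + s * ln (real (max N0 1)) + s * ln (real ?L)) + 4 * C)"
      unfolding K_def by (simp add: algebra_simps)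
    ultimately show ?thesis by linarith
  qed
  then show ?thesis unfolding log_div_bound_def by blast
qed

end

lemma log_div_bound_two:
  fixes \<omega> :: "'n::{finite,linorder} \<Rightarrow> real"
  assumes "non_resonant \<omega>" "CARD('n) = 2" "bruno1_cond s (\<omega> (Min UNIV)) (\<omega> (Max UNIV))" "0 < s"
  shows "log_div_bound s \<omega>"
proof -
  obtain x y :: 'n where xy: "UNIV = {x, y}" "x \<noteq> y"
    using assms(2) by (metis card_2_iff)
  have mM: "Min UNIV \<noteq> (Max UNIV :: 'n)" "Min UNIV \<in> {x, y}" "Max UNIV \<in> {x, y}"
    unfolding xy using xy(2) by (auto simp: min_def max_def)
  then have univ: "UNIV = {Min UNIV, Max UNIV :: 'n}"
    unfolding xy(1)[symmetric] using xy by (metis insert_iff insert_commute singletonD)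
  interpret two_frequencies \<omega> "Min UNIV" "Max UNIV"
    using assms(3) mM(1) univ unfolding bruno1_cond_def Let_def by unfold_locales auto
  show ?thesis by (rule log_div_bound_bruno1[OF assms(1,3,4)])
qed

section \<open>Solutions on an interval\<close>

lemma vector_derivative_norm_bound:
  fixes g :: "real \<Rightarrow> 'a::real_normed_vector"
  assumes "\<And>t. t \<in> {a..b} \<Longrightarrow> (g has_vector_derivative g' t) (at t within {a..b})"
    and "\<And>t. t \<in> {a..b} \<Longrightarrow> norm (g' t) \<le> M" and "s \<in> {a..b}" "t \<in> {a..b}"
  shows "norm (g t - g s) \<le> M * \<bar>t - s\<bar>"
proof -
  have "norm (g t - g s) \<le> M * norm (t - s)"
  proof (rule differentiable_bound[where S = "{a..b}" and f' = "\<lambda>u h. h *\<^sub>R g' u"])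
    show "onorm (\<lambda>h. h *\<^sub>R g' u) \<le> M" if "u \<in> {a..b}" for u
      by (rule onorm_le) (use assms(2)[OF that] in \<open>simp add: mult.commute[of M] mult_left_mono\<close>)
  qed (use assms in \<open>auto simp: has_vector_derivative_def\<close>)
  then show ?thesis by simp
qed

text \<open>Contraction in the plain supremum norm: \<open>M * T \<le> b\<close> keeps the iterates
  in the ball, \<open>L * T < 1\<close> makes them contract. The explicit conditions on
  \<open>T\<close> are the point, since \<open>L\<close> and \<open>M\<close> will be of order 2
  powr (- N).\<close>

lemma picard_lindeloef_interval:
  fixes \<Phi> :: "real \<Rightarrow> 'a::banach \<Rightarrow> 'a"
  assumes T: "0 \<le> T" and b: "0 \<le> b"
    and cont: "continuous_on ({-T..T} \<times> cball v0 b) (\<lambda>(t, x). \<Phi> t x)"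
    and bound: "\<And>t x. t \<in> {-T..T} \<Longrightarrow> x \<in> cball v0 b \<Longrightarrow> norm (\<Phi> t x) \<le> M"
    and lip: "\<And>t x y. t \<in> {-T..T} \<Longrightarrow> x \<in> cball v0 b \<Longrightarrow> y \<in> cball v0 b \<Longrightarrow>
        norm (\<Phi> t x - \<Phi> t y) \<le> L * norm (x - y)"
    and L: "0 \<le> L" and TM: "M * T \<le> b" and TL: "L * T < 1"
  shows "\<exists>v. v 0 = v0 \<and> (\<forall>t\<in>{-T..T}. v t \<in> cball v0 b \<and>
      (v has_vector_derivative \<Phi> t (v t)) (at t within {-T..T}))"
proof -
  \<comment> \<open>Bounded continuous functions live on the whole line; freezing the argument at
    the ends of the interval extends the integral operator to them.\<close>
  define clamp where "clamp t = max (-T) (min T t)" for t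
  have clamp: "clamp t \<in> {-T..T}" "t \<in> {-T..T} \<Longrightarrow> clamp t = t" "\<bar>clamp t\<bar> \<le> T" for t
    using T by (auto simp: clamp_def)
  define S where "S = PiC UNIV (\<lambda>_::real. cball v0 b)"
  \<comment> \<open>The primitive starts at \<open>-T\<close>, so that it is differentiable on the
    whole interval; subtracting \<open>G v 0\<close> moves the initial time to 0.\<close>
  define G where "G v t = integral {-T..t} (\<lambda>s. \<Phi> s (apply_bcontfun v s))" for v t
  define op where "op v = Bcontfun (\<lambda>t. v0 + (G v (clamp t) - G v 0))" for v
  have S: "apply_bcontfun v t \<in> cball v0 b" if "v \<in> S" for v t
    using that by (auto simp: S_def mem_PiC_iff)
  have zero: "0 \<in> {-T..T}" using T by simp
  have G: "(G v has_vector_derivative \<Phi> t (apply_bcontfun v t)) (at t within {-T..T})"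
    if "v \<in> S" "t \<in> {-T..T}" for v t
    unfolding G_def
  proof (rule integral_has_vector_derivative[OF _ that(2)])
    show "continuous_on {-T..T} (\<lambda>s. \<Phi> s (apply_bcontfun v s))"
    proof -
      have "continuous_on {-T..T} (\<lambda>s. (s, apply_bcontfun v s))"
        by (intro continuous_intros) auto
      moreover have "(\<lambda>s. (s, apply_bcontfun v s)) ` {-T..T} \<subseteq> {-T..T} \<times> cball v0 b"
        by (intro image_subsetI SigmaI S that)
      ultimately have "continuous_on {-T..T} (\<lambda>s. case (s, apply_bcontfun v s) of (t, x) \<Rightarrow> \<Phi> t x)"
        by (rule continuous_on_compose2[OF cont])
      then show ?thesis by simp
    qed
  qed
  have Gcont: "continuous_on {-T..T} (G v)" if "v \<in> S" for v
    by (rule continuous_on_vector_derivative) (rule G[OF that])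
  have Gb: "norm (G v t - G v 0) \<le> b" if "v \<in> S" "t \<in> {-T..T}" for v t
  proof -
    have "norm (G v t - G v 0) \<le> M * \<bar>t - 0\<bar>"
      by (rule vector_derivative_norm_bound[OF G[OF that(1)]]) (use bound S that zero in auto)
    also have "\<dots> \<le> M * T"
    proof (rule mult_left_mono)
      have "norm (\<Phi> 0 v0) \<le> M" by (rule bound[OF zero]) (use b in simp)
      then show "0 \<le> M" by (rule order_trans[OF norm_ge_zero])
    qed (use that in auto)
    finally show ?thesis using TM by linarith
  qed
  have clamp_cont: "continuous_on UNIV clamp"
    unfolding clamp_def by (intro continuous_intros)
  have app: "apply_bcontfun (op v) = (\<lambda>t. v0 + (G v (clamp t) - G v 0))" if "v \<in> S" for v
    unfolding op_def
  proof (rule Bcontfun_inverse)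
    have "continuous_on UNIV (\<lambda>t. v0 + (G v (clamp t) - G v 0))"
      by (intro continuous_intros continuous_on_compose2[OF Gcont[OF that] clamp_cont] image_subsetI clamp(1))
    moreover have "norm (v0 + (G v (clamp t) - G v 0)) \<le> norm v0 + b" for t
      using Gb[OF that clamp(1)] norm_triangle_mono by blast
    ultimately show "(\<lambda>t. v0 + (G v (clamp t) - G v 0)) \<in> bcontfun"
      by (rule bcontfun_normI)
  qed
  have ex: "\<exists>!v\<in>S. op v = v"
  proof (rule Banach_fix[where c = "L * T"])
    show "complete S"
      unfolding complete_eq_closed S_def by (intro closed_PiC) auto
    have "const_bcontfun v0 \<in> S" using b by (auto simp: S_def mem_PiC_iff const_bcontfun.rep_eq)
    then show "S \<noteq> {}" by auto
    show "0 \<le> L * T" "L * T < 1" using L T TL by auto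
    show "op ` S \<subseteq> S"
    proof safe
      fix v assume v: "v \<in> S"
      have "apply_bcontfun (op v) t \<in> cball v0 b" for t
        using Gb[OF v clamp(1)[of t]] unfolding app[OF v] mem_cball dist_norm by (simp add: norm_minus_commute)
      then show "op v \<in> S" by (auto simp: S_def mem_PiC_iff)
    qed
    show "dist (op x) (op y) \<le> L * T * dist x y" if x: "x \<in> S" and y: "y \<in> S" for x y
    proof (rule dist_bound)
      fix t
      let ?D = "\<lambda>t. G x t - G y t"
      have "norm (?D (clamp t) - ?D 0) \<le> L * dist x y * \<bar>clamp t - 0\<bar>"
      proof (rule vector_derivative_norm_bound[where a = "-T" and b = T])
        fix s assume s: "s \<in> {-T..T}"
        show "(?D has_vector_derivative \<Phi> s (apply_bcontfun x s) - \<Phi> s (apply_bcontfun y s)) (at s within {-T..T})"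
          by (intro has_vector_derivative_diff G x y s)
        have "norm (\<Phi> s (apply_bcontfun x s) - \<Phi> s (apply_bcontfun y s)) \<le> L * norm (apply_bcontfun x s - apply_bcontfun y s)"
          by (intro lip s S x y)
        also have "\<dots> \<le> L * dist x y"
          using L dist_bounded[of x s y] by (intro mult_left_mono) (auto simp: dist_norm)
        finally show "norm (\<Phi> s (apply_bcontfun x s) - \<Phi> s (apply_bcontfun y s)) \<le> L * dist x y" .
      qed (use zero clamp in auto)
      also have "\<dots> \<le> L * dist x y * T"
        using L clamp(3)[of t] by (intro mult_left_mono) auto
      finally show "dist (apply_bcontfun (op x) t) (apply_bcontfun (op y) t) \<le> L * T * dist x y"
        unfolding app[OF x] app[OF y] dist_norm by (simp add: algebra_simps)
    qed
  qed
  then obtain v where v: "v \<in> S" "op v = v" by blast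
  have veq: "apply_bcontfun v t = v0 + (G v (clamp t) - G v 0)" for t
    using app[OF v(1)] v(2) by metis
  have "(apply_bcontfun v has_vector_derivative \<Phi> t (apply_bcontfun v t)) (at t within {-T..T})"
    if t: "t \<in> {-T..T}" for t
  proof (rule has_vector_derivative_transform[OF t])
    show "((\<lambda>t. v0 + (G v t - G v 0)) has_vector_derivative \<Phi> t (apply_bcontfun v t)) (at t within {-T..T})"
      using G[OF v(1) t] by (auto intro!: derivative_eq_intros)
  qed (use veq clamp in auto)
  moreover have "apply_bcontfun v 0 = v0" using veq[of 0] clamp(2)[OF zero] by simp
  ultimately show ?thesis using S[OF v(1)] by blast
qed

section \<open>Power series as sums over lists\<close>

lemma supnorm_le_iff: "supnorm z \<le> b \<longleftrightarrow> (\<forall>j. cmod (z $ j) \<le> b)"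
  unfolding supnorm_def by auto

lemma supnorm_less_iff: "supnorm z < b \<longleftrightarrow> (\<forall>j. cmod (z $ j) < b)"
  unfolding supnorm_def by auto

lemma supnorm_le_norm: "supnorm z \<le> norm z"
  unfolding supnorm_le_iff using Finite_Cartesian_Product.norm_nth_le by blast

lemma norm_le_card_bound:
  fixes z :: "complex^'n::finite"
  assumes "\<And>j. cmod (z $ j) \<le> b"
  shows "norm z \<le> real CARD('n) * b"
proof -
  have "norm z \<le> (\<Sum>j\<in>UNIV. norm (z $ j))" unfolding norm_vec_def by (rule L2_set_le_sum) simp
  also have "\<dots> \<le> (\<Sum>j\<in>(UNIV::'n set). b)" by (intro sum_mono assms)
  finally show ?thesis by simp
qed

abbreviation mon :: "'n list \<Rightarrow> complex^'n \<Rightarrow> complex" where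
  "mon xs z \<equiv> prod_list (map (($) z) xs)"

lemma mon_eq_prod_count: "mon xs z = (\<Prod>i\<in>UNIV. (z $ i) ^ count_list xs i)" for z :: "complex^'n::finite"
proof (induction xs)
  case (Cons x xs)
  have "(\<Prod>i\<in>UNIV. (z $ i) ^ count_list (x # xs) i) =
      (\<Prod>i\<in>UNIV. (if i = x then z $ i else 1) * (z $ i) ^ count_list xs i)"
    by (intro prod.cong) auto
  with Cons show ?case by (simp add: prod.distrib)
qed simp

lemma norm_mon_le:
  assumes "\<And>j. cmod (z $ j) \<le> y"
  shows "cmod (mon xs z) \<le> y ^ length xs"
proof (induction xs)
  case (Cons x xs)
  then show ?case
    using assms[of x] by (auto simp: norm_mult intro!: mult_mono order_trans[OF norm_ge_zero])
qed simp

lemma ex_list_count: "\<exists>xs. count_list xs = (\<alpha> :: 'n::finite \<Rightarrow> nat)"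
proof -
  have "\<exists>xs. \<forall>i. count_list xs i = (if i \<in> A then \<alpha> i else 0)" for A :: "'n set"
    using finite[of A]
  proof (induction A rule: finite_induct)
    case empty
    show ?case by (rule exI[of _ "[]"]) simp
  next
    case (insert x A)
    then obtain xs where xs: "\<And>i. count_list xs i = (if i \<in> A then \<alpha> i else 0)" by blast
    have "count_list (replicate k x) i = (if i = x then k else 0)" for k i
      by (induction k) auto
    then have "count_list (replicate (\<alpha> x) x @ xs) i = (if i \<in> insert x A then \<alpha> i else 0)" for i
      using xs insert(2) by auto
    then show ?case by blast
  qed
  from this[of UNIV] show ?thesis by auto
qed

lemma norm_has_sum_le:
  fixes f :: "'a \<Rightarrow> complex"
  assumes "(f has_sum x) A" "\<And>X. finite X \<Longrightarrow> X \<subseteq> A \<Longrightarrow> (\<Sum>i\<in>X. cmod (f i)) \<le> b"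
  shows "cmod x \<le> b"
proof -
  have "(\<lambda>i. cmod (f i)) summable_on A"
    using assms(1) summable_on_iff_abs_summable_on_complex has_sum_imp_summable by blast
  then have h: "((\<lambda>i. cmod (f i)) has_sum (\<Sum>\<^sub>\<infinity>i\<in>A. cmod (f i))) A" by simp
  have "cmod x \<le> (\<Sum>\<^sub>\<infinity>i\<in>A. cmod (f i))"
    by (rule norm_has_sum_bound[OF h assms(1)])
  also have "\<dots> \<le> b" by (rule has_sum_le_finite_sums[OF h assms(2)])
  finally show ?thesis .
qed

lemma has_derivative_zero_of_quadratic:
  fixes g :: "'a::real_normed_vector \<Rightarrow> 'b::real_normed_vector"
  assumes "0 < d" "\<And>z. norm z < d \<Longrightarrow> norm (g z) \<le> C * (norm z)\<^sup>2"
  shows "(g has_derivative (\<lambda>_. 0)) (at 0)"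
proof -
  have g0: "g 0 = 0" using assms(2)[of 0] assms(1) by simp
  have "((\<lambda>h. norm (g h) / norm h) \<longlongrightarrow> 0) (at 0)"
  proof (rule tendsto_sandwich[where f = "\<lambda>_. 0" and h = "\<lambda>h. C * norm h"])
    have "eventually (\<lambda>z::'a. norm z < d) (at 0)"
      using assms(1) unfolding eventually_at by (auto intro!: exI[of _ d])
    then show "eventually (\<lambda>h. norm (g h) / norm h \<le> C * norm h) (at 0)"
    proof eventually_elim
      case (elim z)
      show ?case
      proof (cases "z = 0")
        case False
        then show ?thesis using assms(2)[OF elim] by (simp add: field_simps power2_eq_square)
      qed (simp add: g0)
    qed
    have "((\<lambda>h::'a. C * norm h) \<longlongrightarrow> C * norm (0::'a)) (at 0)" by (intro tendsto_intros)
    then show "((\<lambda>h::'a. C * norm h) \<longlongrightarrow> 0) (at 0)" by simp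
  qed auto
  then show ?thesis
    unfolding has_derivative_at using g0 by simp
qed

text \<open>The power series of a multi-index family is rewritten as a sum over lists of variables:
  each multi-index is represented by one chosen list, all other lists get coefficient \<open>0\<close>.\<close>

lemma list_expansion_at_0:
  fixes F :: "complex^'n::finite \<Rightarrow> complex^'n"
  assumes anal: "cn_analytic_on F unit_polydisc" and F0: "F 0 = 0"
    and DF0: "((\<lambda>z. F z - diag_lin \<omega> z) has_derivative (\<lambda>h. 0)) (at 0)"
  obtains a :: "'n \<Rightarrow> 'n list \<Rightarrow> complex" and r C :: real
  where "0 < r" "0 \<le> C" "\<And>j xs. length xs < 2 \<Longrightarrow> a j xs = 0"
    "\<And>j z. supnorm z \<le> r \<Longrightarrow> ((\<lambda>xs. a j xs * mon xs z) has_sum (F z $ j - \<i> * complex_of_real (\<omega> j) * z $ j)) UNIV"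
    "\<And>j X y. finite X \<Longrightarrow> 0 \<le> y \<Longrightarrow> y \<le> r \<Longrightarrow> (\<Sum>xs\<in>X. cmod (a j xs) * y ^ length xs) \<le> C * y\<^sup>2"
proof -
  have "0 \<in> unit_polydisc" by (simp add: unit_polydisc_def)
  then obtain R c where R: "0 < R" and c: "\<And>z j. supnorm z < R \<Longrightarrow>
      ((\<lambda>\<alpha>. c \<alpha> j * (\<Prod>i\<in>UNIV. (z $ i) ^ \<alpha> i)) has_sum (F z $ j)) UNIV"
  proof -
    obtain R c where "0 < R" "\<forall>z. supnorm (z - 0) < R \<longrightarrow>
        (\<forall>j. ((\<lambda>\<alpha>. c \<alpha> j * (\<Prod>i\<in>UNIV. (z $ i - 0 $ i) ^ \<alpha> i)) has_sum (F z $ j)) UNIV)"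
      using anal \<open>0 \<in> unit_polydisc\<close> unfolding cn_analytic_on_def by blast
    then show thesis by (intro that[of R c]) simp_all
  qed
  define ls :: "('n \<Rightarrow> nat) \<Rightarrow> 'n list" where "ls \<alpha> = (SOME xs. count_list xs = \<alpha>)" for \<alpha>
  have ls: "count_list (ls \<alpha>) = \<alpha>" for \<alpha>
    unfolding ls_def by (rule someI_ex[OF ex_list_count])
  then have inj: "inj ls" by (intro injI) (metis ls)
  define a0 where "a0 j xs = (if xs \<in> range ls then c (count_list xs) j else 0)" for j xs
  have sum0: "((\<lambda>xs. a0 j xs * mon xs z) has_sum (F z $ j)) UNIV" if "supnorm z < R" for z j
  proof -
    have "(((\<lambda>xs. a0 j xs * mon xs z) \<circ> ls) has_sum (F z $ j)) UNIV"
      using c[OF that, of j] by (simp add: comp_def a0_def ls mon_eq_prod_count)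
    then have "((\<lambda>xs. a0 j xs * mon xs z) has_sum (F z $ j)) (range ls)"
      by (subst has_sum_reindex[OF inj])
    then show ?thesis
      by (subst has_sum_cong_neutral[where S = "range ls" and f = "\<lambda>xs. a0 j xs * mon xs z", symmetric])
        (auto simp: a0_def)
  qed
  define r where "r = R / 2"
  have r: "0 < r" "r < R" using R by (auto simp: r_def)
  \<comment> \<open>At the point with all coordinates \<open>r\<close> the terms have modulus
    \<open>cmod (a0 j xs) * r ^ length xs\<close>, so absolute convergence there yields the
    majorant.\<close>
  define zr :: "complex^'n" where "zr = (\<chi> i. complex_of_real r)"
  have zr: "supnorm zr < R" using r by (simp add: supnorm_less_iff zr_def)
  have mon_zr: "cmod (mon xs zr) = r ^ length xs" for xs
    using r by (induction xs) (auto simp: zr_def norm_mult)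
  define C0 where "C0 j = (\<Sum>\<^sub>\<infinity>xs. cmod (a0 j xs * mon xs zr))" for j
  have summ: "(\<lambda>xs. cmod (a0 j xs * mon xs zr)) summable_on UNIV" for j
    unfolding summable_on_iff_abs_summable_on_complex[symmetric]
    by (rule has_sum_imp_summable[OF sum0[OF zr]])
  have C0: "(\<Sum>xs\<in>X. cmod (a0 j xs) * r ^ length xs) \<le> C0 j" if "finite X" for X j
    using finite_sum_le_infsum[OF summ that subset_UNIV norm_ge_zero, of j] unfolding C0_def by (simp add: norm_mult mon_zr)
  have C0_nn: "0 \<le> C0 j" for j using C0[of "{}" j] by simp
  define C where "C = (\<Sum>j\<in>UNIV. C0 j) / r\<^sup>2"
  have C0_le: "C0 j \<le> C * r\<^sup>2" for j
  proof -
    have "C0 j \<le> (\<Sum>j\<in>UNIV. C0 j)" using C0_nn by (intro member_le_sum) auto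
    then show ?thesis using r by (simp add: C_def)
  qed
  have C_nn: "0 \<le> C" unfolding C_def using C0_nn by (intro divide_nonneg_nonneg sum_nonneg) auto
  \<comment> \<open>For the remaining lengths, at least 2, \<open>y ^ length xs\<close> is at most
    \<open>(y / r) ^ 2\<close> times its value at \<open>r\<close>; this gives the factor
    \<open>y ^ 2\<close> of the majorant.\<close>
  define a where "a j xs = (if length xs < 2 then 0 else a0 j xs)" for j xs
  have maj: "(\<Sum>xs\<in>X. cmod (a j xs) * y ^ length xs) \<le> C * y\<^sup>2"
    if X: "finite X" and y: "0 \<le> y" "y \<le> r" for j X y
  proof -
    have "(\<Sum>xs\<in>X. cmod (a j xs) * y ^ length xs) \<le> (\<Sum>xs\<in>X. (y / r)\<^sup>2 * (cmod (a0 j xs) * r ^ length xs))"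
    proof (rule sum_mono)
      fix xs
      show "cmod (a j xs) * y ^ length xs \<le> (y / r)\<^sup>2 * (cmod (a0 j xs) * r ^ length xs)"
      proof (cases "length xs < 2")
        case False
        then obtain m where m: "length xs = 2 + m" using le_Suc_ex by (metis not_less)
        have "y ^ length xs \<le> (y / r)\<^sup>2 * r ^ length xs"
          unfolding m power_add using r y by (simp add: power_divide mult_left_mono power_mono)
        from mult_left_mono[OF this, of "cmod (a0 j xs)"] show ?thesis
          using False by (simp add: a_def algebra_simps)
      qed (use r in \<open>simp add: a_def\<close>)
    qed
    also have "\<dots> = (y / r)\<^sup>2 * (\<Sum>xs\<in>X. cmod (a0 j xs) * r ^ length xs)" by (simp add: sum_distrib_left)
    also have "\<dots> \<le> (y / r)\<^sup>2 * (C * r\<^sup>2)"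
      using C0[OF X, of j] C0_le[of j] by (intro mult_left_mono) auto
    also have "\<dots> = C * y\<^sup>2" using r by (simp add: power_divide)
    finally show ?thesis .
  qed
  let ?S = "{xs :: 'n list. length xs < 2}"
  have S_eq: "?S = insert [] (range (\<lambda>i. [i]))"
  proof -
    have "length xs < 2 \<longleftrightarrow> xs = [] \<or> (\<exists>i. xs = [i])" for xs :: "'n list"
      by (cases xs rule: remdups_adj.cases) auto
    then show ?thesis by auto
  qed
  have a00: "a0 j [] = 0" for j
  proof -
    have s0: "supnorm (0 :: complex^'n) < R" using R by (simp add: supnorm_less_iff)
    have "((\<lambda>xs. a0 j xs * mon xs 0) has_sum (a0 j [])) UNIV"
      by (subst has_sum_cong_neutral[where T = "{[]}" and g = "\<lambda>xs. a0 j xs"])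
        (auto simp: neq_Nil_conv intro: has_sum_finiteI)
    from has_sum_unique[OF sum0[OF s0] this] F0 show ?thesis by simp
  qed
  define l where "l j z = (\<Sum>i\<in>UNIV. a0 j [i] * z $ i)" for j and z :: "complex^'n"
  have sum1: "((\<lambda>xs. a j xs * mon xs z) has_sum (F z $ j - l j z)) UNIV" if "supnorm z < R" for z j
  proof -
    have "(\<Sum>xs\<in>?S. a0 j xs * mon xs z) = l j z"
      unfolding S_eq l_def by (subst sum.insert) (auto simp: a00 sum.reindex inj_on_def)
    then have "((\<lambda>xs. a0 j xs * mon xs z) has_sum (l j z)) ?S"
      by (intro has_sum_finiteI) (auto simp: S_eq)
    then have "((\<lambda>xs. a0 j xs * mon xs z) has_sum (F z $ j - l j z)) (UNIV - ?S)"
      by (intro has_sum_Diff sum0[OF that]) auto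
    then show ?thesis
      by (subst has_sum_cong_neutral[where S = "UNIV - ?S" and f = "\<lambda>xs. a0 j xs * mon xs z", symmetric])
        (auto simp: a_def)
  qed
  \<comment> \<open>\<open>F z $ j - l j z\<close> is quadratically small by the majorant, and
    \<open>F z - diag_lin \<omega> z\<close> has derivative 0 by hypothesis; a linear map with
    derivative 0 vanishes.\<close>
  have l_eq: "l j z = \<i> * complex_of_real (\<omega> j) * z $ j" for j z
  proof -
    let ?e = "\<lambda>z :: complex^'n. l j z - \<i> * complex_of_real (\<omega> j) * z $ j"
    have "((\<lambda>z. F z $ j - l j z) has_derivative (\<lambda>_. 0)) (at 0)"
    proof (rule has_derivative_zero_of_quadratic[where d = r and C = C])
      fix z :: "complex^'n" assume z: "norm z < r"
      then have z': "supnorm z < R" using supnorm_le_norm[of z] r by linarith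
      show "norm (F z $ j - l j z) \<le> C * (norm z)\<^sup>2"
      proof (rule norm_has_sum_le[OF sum1[OF z']])
        fix X :: "'n list set" assume X: "finite X"
        have "(\<Sum>xs\<in>X. cmod (a j xs * mon xs z)) \<le> (\<Sum>xs\<in>X. cmod (a j xs) * norm z ^ length xs)"
          unfolding norm_mult
          by (intro sum_mono mult_left_mono norm_mon_le Finite_Cartesian_Product.norm_nth_le) auto
        also have "\<dots> \<le> C * (norm z)\<^sup>2" using z by (intro maj X) auto
        finally show "(\<Sum>xs\<in>X. cmod (a j xs * mon xs z)) \<le> C * (norm z)\<^sup>2" .
      qed
    qed (rule r)
    moreover have "((\<lambda>z. F z $ j - \<i> * complex_of_real (\<omega> j) * z $ j) has_derivative (\<lambda>_. 0)) (at 0)"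
      using bounded_linear.has_derivative[OF bounded_linear_vec_nth DF0, of j] by (simp add: diag_lin_def)
    ultimately have "((\<lambda>z. (F z $ j - \<i> * complex_of_real (\<omega> j) * z $ j) - (F z $ j - l j z)) has_derivative (\<lambda>_. 0 - 0)) (at 0)"
      by (intro has_derivative_diff)
    then have d0: "(?e has_derivative (\<lambda>_. 0)) (at 0)" by (simp add: algebra_simps)
    have "bounded_linear ?e"
      unfolding l_def by (intro bounded_linear_sub bounded_linear_sum bounded_linear_const_mult bounded_linear_vec_nth)
    then have "(?e has_derivative ?e) (at 0)" by (rule bounded_linear_imp_has_derivative)
    from has_derivative_unique[OF this d0] have "?e z = 0" by (rule fun_cong)
    then show ?thesis by simp
  qed
  show thesis
  proof (rule that[of r C a])
    show "((\<lambda>xs. a j xs * mon xs z) has_sum (F z $ j - \<i> * complex_of_real (\<omega> j) * z $ j)) UNIV"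
      if "supnorm z \<le> r" for j z
      using sum1[of z j] that r unfolding l_eq by simp
  qed (use r C_nn maj in \<open>auto simp: a_def\<close>)
qed

section \<open>Tree expansion of the linearization\<close>

text \<open>These solve the conjugacy equation formally: multiplying by
  \<open>\<i> * divisor\<close> leaves the Taylor coefficient times the coefficients of the
  children, which is what substituting the series into \<open>F\<close> produces.\<close>

fun tcoeff :: "('n \<Rightarrow> real) \<Rightarrow> ('n \<Rightarrow> 'n list \<Rightarrow> complex) \<Rightarrow> 'n ltree \<Rightarrow> complex" where
  "tcoeff \<omega> a (Lf j) = 1"
| "tcoeff \<omega> a (Nd j ts) =
     a j (map tree_root ts) * prod_list (map (tcoeff \<omega> a) ts) / (\<i> * complex_of_real (divisor \<omega> (Nd j ts)))"

fun tmaj :: "('n \<Rightarrow> 'n list \<Rightarrow> complex) \<Rightarrow> 'n ltree \<Rightarrow> real" where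
  "tmaj a (Lf j) = 1"
| "tmaj a (Nd j ts) = cmod (a j (map tree_root ts)) * prod_list (map (tmaj a) ts)"

lemma prod_list_norm: "cmod (prod_list (map f xs)) = prod_list (map (\<lambda>x. cmod (f x)) xs)"
  by (induction xs) (auto simp: norm_mult)

lemma prod_list_nonneg: "(\<And>x. x \<in> set xs \<Longrightarrow> 0 \<le> f x) \<Longrightarrow> 0 \<le> prod_list (map f xs)" for f :: "'a \<Rightarrow> real"
  by (induction xs) auto

lemma prod_list_mono:
  fixes f g :: "'a \<Rightarrow> real"
  assumes "\<And>x. x \<in> set xs \<Longrightarrow> 0 \<le> f x \<and> f x \<le> g x"
  shows "prod_list (map f xs) \<le> prod_list (map g xs)"
  using assms
proof (induction xs)
  case (Cons x xs)
  then have "0 \<le> prod_list (map f xs)" by (intro prod_list_nonneg) auto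
  with Cons show ?case by (auto intro!: mult_mono order_trans[of 0 "f x" "g x"])
qed simp

lemma prod_list_mult: "prod_list (map (\<lambda>x. f x * g x) xs) = prod_list (map f xs) * prod_list (map g xs)"
  for f g :: "'a \<Rightarrow> 'b::comm_monoid_mult"
  by (induction xs) (auto simp: ac_simps)

lemma prod_list_power: "prod_list (map (\<lambda>x. y ^ n x) xs) = y ^ (\<Sum>x\<leftarrow>xs. n x)" for y :: "'b::comm_monoid_mult"
  by (induction xs) (auto simp: power_add)

lemma prod_list_exp: "prod_list (map (\<lambda>x. exp (f x)) xs) = exp (\<Sum>x\<leftarrow>xs. f x)" for f :: "'a \<Rightarrow> real"
  by (induction xs) (auto simp: exp_add)

lemma tmaj_nonneg: "0 \<le> tmaj a t"
  by (induction t) (auto intro!: mult_nonneg_nonneg prod_list_nonneg)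

lemma norm_tcoeff:
  fixes \<omega> :: "'n::finite \<Rightarrow> real"
  assumes "non_resonant \<omega>" "proper t"
  shows "cmod (tcoeff \<omega> a t) = tmaj a t * exp (log_div \<omega> t)"
  using assms(2)
proof (induction t)
  case (Nd j ts)
  have "map (\<lambda>t. cmod (tcoeff \<omega> a t)) ts = map (\<lambda>t. tmaj a t * exp (log_div \<omega> t)) ts"
    using Nd by auto
  then have "cmod (prod_list (map (tcoeff \<omega> a) ts)) = prod_list (map (tmaj a) ts) * exp (\<Sum>t\<leftarrow>ts. log_div \<omega> t)"
    unfolding prod_list_norm by (simp only: prod_list_mult prod_list_exp)
  moreover have "exp (- ln \<bar>divisor \<omega> (Nd j ts)\<bar>) = 1 / \<bar>divisor \<omega> (Nd j ts)\<bar>"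
    using abs_divisor_pos[OF assms(1) Nd.prems] by (simp add: exp_minus field_simps)
  moreover have "exp (log_div \<omega> (Nd j ts)) = exp (- ln \<bar>divisor \<omega> (Nd j ts)\<bar>) * exp (\<Sum>t\<leftarrow>ts. log_div \<omega> t)"
    by (simp only: log_div.simps exp_add)
  ultimately show ?case by (simp add: norm_mult norm_divide)
qed simp

section \<open>Sums over trees and forests\<close>

definition trees :: "nat \<Rightarrow> 'n \<Rightarrow> 'n ltree set" where
  "trees N j = {t. proper t \<and> nl t \<le> N \<and> tree_root t = j}"

definition forests :: "nat \<Rightarrow> 'n list \<Rightarrow> 'n ltree list set" where
  "forests N xs = {ts. map tree_root ts = xs \<and> (\<forall>t\<in>set ts. proper t \<and> nl t \<le> N)}"

lemma finite_proper_nl: "finite {t :: 'n::finite ltree. proper t \<and> nl t \<le> N}"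
proof (induction N)
  case 0
  have "{t :: 'n ltree. proper t \<and> nl t \<le> 0} = {}" using nl_pos by fastforce
  then show ?case by (simp only: finite.emptyI)
next
  case (Suc N)
  let ?T = "\<lambda>N. {t :: 'n ltree. proper t \<and> nl t \<le> N}"
  have "?T (Suc N) \<subseteq> range Lf \<union> (\<lambda>(j, ts). Nd j ts) ` (UNIV \<times> {ts. set ts \<subseteq> ?T N \<and> length ts \<le> Suc N})"
  proof
    fix t assume t: "t \<in> ?T (Suc N)"
    show "t \<in> range Lf \<union> (\<lambda>(j, ts). Nd j ts) ` (UNIV \<times> {ts. set ts \<subseteq> ?T N \<and> length ts \<le> Suc N})"
    proof (cases t)
      case (Nd j ts)
      then have p: "proper (Nd j ts)" "nl (Nd j ts) \<le> Suc N" using t by auto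
      have "length ts \<le> Suc N" using length_le_nl[of ts] p unfolding nl_Nd by auto
      moreover have "set ts \<subseteq> ?T N"
        using nl_child[OF p(1)] p by (fastforce simp del: leaves.simps)
      ultimately show ?thesis using Nd by auto
    qed auto
  qed
  moreover have "finite (range Lf \<union> (\<lambda>(j, ts). Nd j ts) ` (UNIV \<times> {ts. set ts \<subseteq> ?T N \<and> length ts \<le> Suc N}))"
    by (intro finite_UnI finite_imageI finite_SigmaI finite_lists_length_le Suc finite)
  ultimately show ?case by (rule finite_subset)
qed

lemma finite_trees: "finite (trees N (j :: 'n::finite))"
  by (rule finite_subset[OF _ finite_proper_nl[of N]]) (auto simp: trees_def)

lemma finite_forests: "finite (forests N (xs :: 'n::finite list))"
proof -
  have "forests N xs \<subseteq> {ts. set ts \<subseteq> {t. proper t \<and> nl t \<le> N} \<and> length ts = length xs}"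
    by (auto simp: forests_def)
  then show ?thesis by (rule finite_subset) (intro finite_lists_length_eq finite_proper_nl)
qed

lemma forests_Nil: "forests N [] = {[]}"
  by (auto simp: forests_def)

lemma forests_Cons: "forests N (x # xs) = (\<lambda>(t, ts). t # ts) ` (trees N x \<times> forests N xs)"
proof -
  have "ts \<in> (\<lambda>(t, ts). t # ts) ` (trees N x \<times> forests N xs)" if "ts \<in> forests N (x # xs)" for ts
    using that by (cases ts) (auto simp: forests_def trees_def)
  then show ?thesis by (auto simp: forests_def trees_def)
qed

text \<open>Distributivity: the forests keep the order of \<open>xs\<close>, so every choice of one
  tree per factor occurs exactly once.\<close>

lemma sum_forests:
  fixes g :: "'n::finite ltree \<Rightarrow> 'b::comm_semiring_1"
  shows "(\<Sum>ts\<in>forests N xs. prod_list (map g ts)) = prod_list (map (\<lambda>x. \<Sum>t\<in>trees N x. g t) xs)"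
proof (induction xs)
  case (Cons x xs)
  have "(\<Sum>ts\<in>forests N (x # xs). prod_list (map g ts)) =
      (\<Sum>(t, ts)\<in>trees N x \<times> forests N xs. g t * prod_list (map g ts))"
    unfolding forests_Cons by (subst sum.reindex) (auto simp: inj_on_def intro!: sum.cong)
  also have "\<dots> = (\<Sum>t\<in>trees N x. g t) * (\<Sum>ts\<in>forests N xs. prod_list (map g ts))"
    by (simp add: sum_product sum.cartesian_product)
  finally show ?case using Cons by simp
qed (simp add: forests_Nil)

definition big_trees :: "nat \<Rightarrow> 'n \<Rightarrow> 'n ltree set" where
  "big_trees N j = {t \<in> trees N j. 2 \<le> nl t}"

lemma trees_eq_insert:
  assumes "1 \<le> N"
  shows "trees N j = insert (Lf j) (big_trees N j)" "Lf j \<notin> big_trees N j"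
proof -
  have "t = Lf j" if "t \<in> trees N j" "\<not> 2 \<le> nl t" for t
    using that nl_Nd_ge_2 by (cases t) (auto simp: trees_def)
  then show "trees N j = insert (Lf j) (big_trees N j)"
    using assms by (auto simp: big_trees_def trees_def)
qed (simp add: big_trees_def)

lemma big_trees_eq:
  "big_trees N j = Nd j ` (\<Union>xs\<in>{xs. 2 \<le> length xs \<and> length xs \<le> N}. {ts \<in> forests N xs. (\<Sum>t\<leftarrow>ts. nl t) \<le> N})"
proof -
  have "t \<in> Nd j ` (\<Union>xs\<in>{xs. 2 \<le> length xs \<and> length xs \<le> N}. {ts \<in> forests N xs. (\<Sum>t\<leftarrow>ts. nl t) \<le> N})"
    if t: "t \<in> big_trees N j" for t
  proof (cases t)
    case (Lf i)
    then show ?thesis using t by (auto simp: big_trees_def)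
  next
    case (Nd i ts)
    then have p: "proper (Nd j ts)" "nl (Nd j ts) \<le> N" "i = j"
      using t by (auto simp: big_trees_def trees_def)
    have "\<forall>t\<in>set ts. proper t \<and> nl t \<le> N"
      using nl_child[OF p(1)] p by (fastforce simp del: leaves.simps)
    moreover have "length ts \<le> N" using length_le_nl[of ts] p(1,2) unfolding nl_Nd by auto
    moreover have "(\<Sum>t\<leftarrow>ts. nl t) \<le> N" using p(2) unfolding nl_Nd .
    moreover have "2 \<le> length ts" using p(1) by simp
    ultimately show ?thesis unfolding Nd p(3) by (auto simp: forests_def)
  qed
  moreover have "Nd j ts \<in> big_trees N j"
    if ts: "ts \<in> forests N xs" "2 \<le> length xs" "(\<Sum>t\<leftarrow>ts. nl t) \<le> N" for ts xs
  proof -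
    have "length ts = length xs" using ts by (auto simp: forests_def)
    then have p: "proper (Nd j ts)" using ts by (auto simp: forests_def)
    then show ?thesis
      using nl_Nd_ge_2[OF p] ts(3) p
      by (simp add: big_trees_def trees_def nl_Nd del: leaves.simps)
  qed
  ultimately show ?thesis by auto
qed

text \<open>Removing the root turns a tree into a forest. Grouping by the list \<open>xs\<close> of
  child labels isolates the Taylor coefficient \<open>a j xs\<close>, which depends on nothing else;
  the limit \<open>N\<close> on the total number of leaves couples the trees of a forest.\<close>

lemma sum_big_trees:
  fixes g :: "'n::finite ltree \<Rightarrow> 'b::comm_monoid_add"
  shows "(\<Sum>t\<in>big_trees N j. g t) =
    (\<Sum>xs\<in>{xs. 2 \<le> length xs \<and> length xs \<le> N}. \<Sum>ts\<in>{ts \<in> forests N xs. (\<Sum>t\<leftarrow>ts. nl t) \<le> N}. g (Nd j ts))"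
proof -
  have fin: "finite {xs :: 'n list. 2 \<le> length xs \<and> length xs \<le> N}"
    using finite_lists_length_le[of "UNIV :: 'n set" N] by (rule finite_subset[rotated]) auto
  have "(\<Sum>t\<in>big_trees N j. g t) =
      (\<Sum>ts\<in>(\<Union>xs\<in>{xs. 2 \<le> length xs \<and> length xs \<le> N}. {ts \<in> forests N xs. (\<Sum>t\<leftarrow>ts. nl t) \<le> N}). g (Nd j ts))"
    unfolding big_trees_eq by (subst sum.reindex) (auto simp: inj_on_def)
  also have "\<dots> = (\<Sum>xs\<in>{xs. 2 \<le> length xs \<and> length xs \<le> N}. \<Sum>ts\<in>{ts \<in> forests N xs. (\<Sum>t\<leftarrow>ts. nl t) \<le> N}. g (Nd j ts))"
  proof (rule sum.UNION_disjoint[OF fin])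
    show "\<forall>xs\<in>{xs :: 'n list. 2 \<le> length xs \<and> length xs \<le> N}. finite {ts \<in> forests N xs. (\<Sum>t\<leftarrow>ts. nl t) \<le> N}"
    proof
      fix xs :: "'n list"
      show "finite {ts \<in> forests N xs. (\<Sum>t\<leftarrow>ts. nl t) \<le> N}"
        by (rule finite_subset[OF _ finite_forests[of N xs]]) auto
    qed
  qed (auto simp: forests_def)
  finally show ?thesis .
qed

locale majorized =
  fixes a :: "'n::finite \<Rightarrow> 'n list \<Rightarrow> complex" and r C :: real
  assumes r_pos: "0 < r" and C_nonneg: "0 \<le> C"
    and maj: "\<And>j X y. finite X \<Longrightarrow> 0 \<le> y \<Longrightarrow> y \<le> r \<Longrightarrow> (\<Sum>xs\<in>X. cmod (a j xs) * y ^ length xs) \<le> C * y\<^sup>2"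
begin

text \<open>Method of majorants: removing the root turns the bound \<open>2 * y\<close> into
  \<open>y + C * (2 * y) ^ 2\<close>, which is again at most \<open>2 * y\<close>.\<close>

lemma sum_trees_tmaj_le:
  assumes y: "0 \<le> y" "2 * y \<le> r" "4 * C * y \<le> 1"
  shows "(\<Sum>t\<in>trees N j. tmaj a t * y ^ nl t) \<le> 2 * y"
proof (induction N arbitrary: j)
  case 0
  have "trees 0 j = {}" using nl_pos by (fastforce simp: trees_def)
  then show ?case using y by simp
next
  case (Suc N)
  let ?g = "\<lambda>t. tmaj a t * y ^ nl t"
  have g0: "0 \<le> ?g t" for t by (intro mult_nonneg_nonneg tmaj_nonneg zero_le_power y)
  let ?X = "{xs :: 'n list. 2 \<le> length xs \<and> length xs \<le> Suc N}"
  have fin: "finite ?X"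
    using finite_lists_length_le[of "UNIV :: 'n set" "Suc N"] by (rule finite_subset[rotated]) auto
  have g_Nd: "?g (Nd j ts) = cmod (a j xs) * prod_list (map ?g ts)" if "map tree_root ts = xs" for ts xs
    using that unfolding nl_Nd by (simp add: prod_list_mult prod_list_power)
  have "(\<Sum>t\<in>big_trees (Suc N) j. ?g t) =
      (\<Sum>xs\<in>?X. \<Sum>ts\<in>{ts \<in> forests (Suc N) xs. (\<Sum>t\<leftarrow>ts. nl t) \<le> Suc N}. ?g (Nd j ts))"
    by (rule sum_big_trees)
  also have "\<dots> \<le> (\<Sum>xs\<in>?X. \<Sum>ts\<in>forests N xs. cmod (a j xs) * prod_list (map ?g ts))"
  proof (rule sum_mono)
    fix xs assume xs: "xs \<in> ?X"
    have "(\<Sum>ts\<in>{ts \<in> forests (Suc N) xs. (\<Sum>t\<leftarrow>ts. nl t) \<le> Suc N}. ?g (Nd j ts)) \<le>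
        (\<Sum>ts\<in>forests N xs. ?g (Nd j ts))"
    proof (rule sum_mono2[OF finite_forests _ g0])
      \<comment> \<open>At least two children with at most \<open>Suc N\<close> leaves together have
        at most \<open>N\<close> leaves each, so the induction hypothesis covers them; the limit on
        the total is then dropped.\<close>
      show "{ts \<in> forests (Suc N) xs. (\<Sum>t\<leftarrow>ts. nl t) \<le> Suc N} \<subseteq> forests N xs"
      proof clarify
        fix ts assume ts: "ts \<in> forests (Suc N) xs" "(\<Sum>t\<leftarrow>ts. nl t) \<le> Suc N"
        then have "length ts = length xs" by (auto simp: forests_def)
        then have p: "proper (Nd j ts)" using ts xs by (auto simp: forests_def)
        have "nl t < Suc N" if "t \<in> set ts" for t
          using nl_child[OF p that] ts(2) unfolding nl_Nd by linarith
        then show "ts \<in> forests N xs" using ts by (auto simp: forests_def less_Suc_eq_le)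
      qed
    qed
    also have "\<dots> = (\<Sum>ts\<in>forests N xs. cmod (a j xs) * prod_list (map ?g ts))"
      by (intro sum.cong refl g_Nd) (auto simp: forests_def)
    finally show "(\<Sum>ts\<in>{ts \<in> forests (Suc N) xs. (\<Sum>t\<leftarrow>ts. nl t) \<le> Suc N}. ?g (Nd j ts)) \<le>
        (\<Sum>ts\<in>forests N xs. cmod (a j xs) * prod_list (map ?g ts))" .
  qed
  also have "\<dots> = (\<Sum>xs\<in>?X. cmod (a j xs) * prod_list (map (\<lambda>x. \<Sum>t\<in>trees N x. ?g t) xs))"
    by (simp only: sum_distrib_left[symmetric] sum_forests)
  also have "\<dots> \<le> (\<Sum>xs\<in>?X. cmod (a j xs) * (2 * y) ^ length xs)"
  proof (intro sum_mono mult_left_mono)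
    fix xs :: "'n list"
    have "prod_list (map (\<lambda>x. \<Sum>t\<in>trees N x. ?g t) xs) \<le> prod_list (map (\<lambda>x. 2 * y) xs)"
      using Suc g0 by (intro prod_list_mono) (auto intro!: sum_nonneg)
    then show "prod_list (map (\<lambda>x. \<Sum>t\<in>trees N x. ?g t) xs) \<le> (2 * y) ^ length xs"
      by (simp add: map_replicate_const)
  qed auto
  also have "\<dots> \<le> C * (2 * y)\<^sup>2" using y by (intro maj fin) auto
  also have "\<dots> = 4 * C * y * y" by (simp add: power2_eq_square)
  also have "\<dots> \<le> 1 * y" using y by (intro mult_right_mono) auto
  finally have "(\<Sum>t\<in>big_trees (Suc N) j. ?g t) \<le> y" by simp
  moreover have "(\<Sum>t\<in>trees (Suc N) j. ?g t) = ?g (Lf j) + (\<Sum>t\<in>big_trees (Suc N) j. ?g t)"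
    using trees_eq_insert[of "Suc N" j] finite_trees[of "Suc N" j] by simp
  ultimately show ?case by simp
qed

text \<open>At radius \<open>\<sigma> N powr (- s)\<close> a tree with \<open>L \<ge> 2\<close> leaves has weight at most
  \<open>(E \<sigma>) ^ L * (L / N) powr (s L)\<close>, and \<open>(L / N) powr (s L) \<le> (L / N) powr (2 s)\<close> for \<open>L \<le> N\<close>.\<close>

lemma sum_big_trees_tcoeff_le:
  assumes nonres: "non_resonant \<omega>" and ldb: "log_div_bound s \<omega>" and s: "0 < s" and \<kappa>: "0 < \<kappa>"
  obtains \<sigma> where "0 < \<sigma>" "\<sigma> \<le> 1" "2 * \<sigma> \<le> r"
    "\<And>N j. 1 \<le> N \<Longrightarrow> (\<Sum>t\<in>big_trees N j. cmod (tcoeff \<omega> a t) * (\<sigma> * real N powr (- s)) ^ nl t)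
      \<le> \<kappa> * (\<sigma> * real N powr (- s))"
proof -
  obtain K where K: "\<And>t. proper t \<Longrightarrow> log_div \<omega> t \<le> real (nl t) * (K + s * ln (real (nl t)))"
    using ldb unfolding log_div_bound_def by blast
  \<comment> \<open>The extra \<open>2 * s\<close> absorbs the factor \<open>L powr (2 * s)\<close>,
    as \<open>ln L \<le> L\<close>.\<close>
  define E where "E = exp (K + 2 * s)"
  define y0 where "y0 = min (r / 2) (1 / (4 * C + 1))"
  have y0: "0 < y0" "2 * y0 \<le> r" "4 * C * y0 \<le> 1"
  proof -
    show "0 < y0" "2 * y0 \<le> r" using r_pos C_nonneg by (auto simp: y0_def)
    have "4 * C * y0 \<le> 4 * C * (1 / (4 * C + 1))"
      using C_nonneg by (intro mult_left_mono) (auto simp: y0_def)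
    also have "\<dots> \<le> 1" using C_nonneg by (simp add: field_simps)
    finally show "4 * C * y0 \<le> 1" .
  qed
  have E: "0 < E" by (simp add: E_def)
  \<comment> \<open>\<open>y0 / E\<close> makes the geometric factor \<open>E * \<sigma>\<close>
    admissible for the majorant at \<open>y0\<close>; the last entry brings the total, which is
    quadratic in \<sigma>, below \<kappa> times \<sigma>.\<close>
  define \<sigma> where "\<sigma> = min (min 1 (r / 2)) (min (y0 / E) (\<kappa> * y0 / (2 * E\<^sup>2)))"
  have \<sigma>: "0 < \<sigma>" "\<sigma> \<le> 1" "2 * \<sigma> \<le> r" "\<sigma> \<le> y0 / E" "\<sigma> \<le> \<kappa> * y0 / (2 * E\<^sup>2)"
    using r_pos y0(1) E \<kappa> unfolding \<sigma>_def by auto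
  have E\<sigma>: "E * \<sigma> \<le> y0" using \<sigma>(4) E by (simp add: field_simps)
  have "(\<Sum>t\<in>big_trees N j. cmod (tcoeff \<omega> a t) * (\<sigma> * real N powr (- s)) ^ nl t)
      \<le> \<kappa> * (\<sigma> * real N powr (- s))" if N: "1 \<le> N" for N j
  proof -
    define \<nu> where "\<nu> = real N powr (- s)"
    have \<nu>: "0 < \<nu>" "\<nu> \<le> 1" using N s powr_mono[of "- s" 0 "real N"] by (auto simp: \<nu>_def)
    have term_le: "cmod (tcoeff \<omega> a t) * (\<sigma> * \<nu>) ^ nl t \<le> (\<nu>\<^sup>2 * (E * \<sigma> / y0)\<^sup>2) * (tmaj a t * y0 ^ nl t)"
      if t: "t \<in> big_trees N j" for t
    proof -
      let ?L = "real (nl t)"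
      have t': "proper t" "2 \<le> nl t" "nl t \<le> N" using t by (auto simp: big_trees_def trees_def)
      have "0 < ?L" using t'(2) by linarith
      then have lnL: "ln ?L \<le> ln (real N)" "ln ?L \<le> ?L"
        using t'(3) ln_le_minus_one[of ?L] ln_mono[of ?L "real N"] by linarith+
      have ex: "(\<sigma> * \<nu>) ^ nl t = exp (?L * (ln \<sigma> - s * ln (real N)))"
      proof -
        have "\<sigma> * \<nu> = exp (ln \<sigma> - s * ln (real N))"
          using \<sigma>(1) N by (simp add: \<nu>_def powr_def exp_diff exp_minus field_simps)
        then show ?thesis by (simp add: exp_of_nat_mult)
      qed
      have "exp (log_div \<omega> t) * (\<sigma> * \<nu>) ^ nl t = exp (log_div \<omega> t + ?L * (ln \<sigma> - s * ln (real N)))"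
        unfolding ex exp_add ..
      also have "\<dots> \<le> exp (?L * (K + 2 * s + ln \<sigma>) + 2 * (- s * ln (real N)))"
      proof -
        \<comment> \<open>Of the \<open>L\<close> factors \<open>(L / N) powr s\<close>, each at
          most 1, two are kept: they yield \<open>\<nu>\<^sup>2\<close>, and the final bound retains
          one \<nu>.\<close>
        have "2 * (ln (real N) - ln ?L) \<le> ?L * (ln (real N) - ln ?L)"
          using t' lnL by (intro mult_right_mono) auto
        then have "s * (2 * (ln (real N) - ln ?L)) \<le> s * (?L * (ln (real N) - ln ?L))"
          using s by (intro mult_left_mono) auto
        moreover have "s * (2 * ln ?L) \<le> s * (2 * ?L)" using s lnL by (intro mult_left_mono) auto
        moreover have "?L * (K + s * ln ?L) + ?L * (ln \<sigma> - s * ln (real N)) =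
            ?L * (K + ln \<sigma>) - s * (?L * (ln (real N) - ln ?L))" by (simp add: algebra_simps)
        moreover have "?L * (K + 2 * s + ln \<sigma>) + 2 * (- s * ln (real N)) =
            ?L * (K + ln \<sigma>) + s * (2 * ?L) - s * (2 * ln ?L) - s * (2 * (ln (real N) - ln ?L))"
          by (simp add: algebra_simps)
        ultimately show ?thesis using K[OF t'(1)] by simp
      qed
      also have "\<dots> = (E * \<sigma>) ^ nl t * \<nu>\<^sup>2"
      proof -
        have "E * \<sigma> = exp (K + 2 * s + ln \<sigma>)" using \<sigma>(1) by (simp add: E_def exp_add)
        moreover have "\<nu> = exp (- s * ln (real N))" using N by (simp add: \<nu>_def powr_def)
        ultimately show ?thesis by (simp only: exp_add exp_of_nat_mult exp_double)
      qed
      finally have 1: "exp (log_div \<omega> t) * (\<sigma> * \<nu>) ^ nl t \<le> (E * \<sigma>) ^ nl t * \<nu>\<^sup>2" .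
      have "(E * \<sigma>) ^ nl t \<le> (E * \<sigma> / y0)\<^sup>2 * y0 ^ nl t"
      proof -
        obtain m where m: "nl t = 2 + m" using t'(2) le_Suc_ex by blast
        have "(E * \<sigma>) ^ m \<le> y0 ^ m" using E\<sigma> E \<sigma>(1) by (intro power_mono) auto
        then have "(E * \<sigma>)\<^sup>2 * (E * \<sigma>) ^ m \<le> (E * \<sigma>)\<^sup>2 * y0 ^ m"
          by (intro mult_left_mono) auto
        also have "\<dots> = (E * \<sigma> / y0)\<^sup>2 * (y0\<^sup>2 * y0 ^ m)"
          using y0(1) by (simp add: power_divide)
        finally show ?thesis unfolding m power_add .
      qed
      from order_trans[OF 1 mult_right_mono[OF this zero_le_power2]]
      have "exp (log_div \<omega> t) * (\<sigma> * \<nu>) ^ nl t \<le> (E * \<sigma> / y0)\<^sup>2 * y0 ^ nl t * \<nu>\<^sup>2" .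
      from mult_left_mono[OF this tmaj_nonneg[of a t]] show ?thesis
        unfolding norm_tcoeff[OF nonres t'(1)] by (simp only: mult.assoc mult.left_commute mult.commute)
    qed
    have "(\<Sum>t\<in>big_trees N j. cmod (tcoeff \<omega> a t) * (\<sigma> * \<nu>) ^ nl t) \<le>
        (\<Sum>t\<in>big_trees N j. (\<nu>\<^sup>2 * (E * \<sigma> / y0)\<^sup>2) * (tmaj a t * y0 ^ nl t))"
      by (intro sum_mono term_le)
    also have "\<dots> = (\<nu>\<^sup>2 * (E * \<sigma> / y0)\<^sup>2) * (\<Sum>t\<in>big_trees N j. tmaj a t * y0 ^ nl t)"
      by (simp add: sum_distrib_left)
    also have "\<dots> \<le> (\<nu>\<^sup>2 * (E * \<sigma> / y0)\<^sup>2) * (2 * y0)"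
    proof (rule mult_left_mono)
      have "(\<Sum>t\<in>big_trees N j. tmaj a t * y0 ^ nl t) \<le> (\<Sum>t\<in>trees N j. tmaj a t * y0 ^ nl t)"
        using y0 by (intro sum_mono2 finite_trees mult_nonneg_nonneg tmaj_nonneg zero_le_power)
          (auto simp: big_trees_def)
      also have "\<dots> \<le> 2 * y0" using y0 by (intro sum_trees_tmaj_le) auto
      finally show "(\<Sum>t\<in>big_trees N j. tmaj a t * y0 ^ nl t) \<le> 2 * y0" .
    qed simp
    also have "\<dots> = \<nu> * (2 * E\<^sup>2 / y0 * \<sigma>) * (\<sigma> * \<nu>)"
      using y0(1) by (simp add: power_divide power_mult_distrib power2_eq_square)
    also have "\<dots> \<le> 1 * \<kappa> * (\<sigma> * \<nu>)"
    proof (intro mult_right_mono mult_mono)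
      show "2 * E\<^sup>2 / y0 * \<sigma> \<le> \<kappa>" using \<sigma>(5) E y0(1) by (simp add: field_simps)
    qed (use \<nu> \<sigma>(1) E y0(1) in auto)
    finally show ?thesis by (simp add: \<nu>_def)
  qed
  then show thesis using that[of \<sigma>] \<sigma>(1-3) by blast
qed

end

section \<open>The truncated linearization\<close>

fun dmon :: "'n list \<Rightarrow> complex^'n \<Rightarrow> complex^'n \<Rightarrow> complex" where
  "dmon [] w v = 0"
| "dmon (x # xs) w v = v $ x * mon xs w + w $ x * dmon xs w v"

lemma dmon_add: "dmon xs w (u + v) = dmon xs w u + dmon xs w v"
  by (induction xs) (auto simp: algebra_simps)

lemma dmon_diff: "dmon xs w (u - v) = dmon xs w u - dmon xs w v"
  using dmon_add[of xs w "u - v" v] by (simp only: diff_add_cancel eq_diff_eq)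

text \<open>Monomials are eigenvectors of differentiation along the linear field; subtracting
  \<omega> of the root label from the eigenvalue leaves the divisor.\<close>

lemma dmon_diag_lin: "dmon xs w (diag_lin \<omega> w) = \<i> * complex_of_real (\<Sum>x\<leftarrow>xs. \<omega> x) * mon xs w"
  by (induction xs) (auto simp: diag_lin_def algebra_simps)

lemma mon_zero: "xs \<noteq> [] \<Longrightarrow> mon xs 0 = 0"
  by (cases xs) auto

lemma mon_concat: "mon (concat xss) w = prod_list (map (\<lambda>xs. mon xs w) xss)"
  by (induction xss) auto

lemma has_vector_derivative_mon:
  assumes "\<And>j. ((\<lambda>t. w t $ j) has_vector_derivative v $ j) (at t within S)"
  shows "((\<lambda>t. mon xs (w t)) has_vector_derivative dmon xs (w t) v) (at t within S)"
proof (induction xs)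
  case (Cons x xs)
  from has_vector_derivative_mult[OF assms[of x] Cons] show ?case
    by (simp add: algebra_simps)
qed simp

context
  fixes w w' :: "complex^'n" and b d :: real
  assumes b: "0 < b" and w: "\<And>j. cmod (w $ j) \<le> b" and w': "\<And>j. cmod (w' $ j) \<le> b"
    and d: "\<And>j. cmod (w $ j - w' $ j) \<le> d"
begin

lemma d_nonneg: "0 \<le> d"
  using d norm_ge_zero order_trans by blast

text \<open>Product rule, one factor at a time. The extra \<open>b\<close> on the left keeps the
  exponent equal to the length, which also covers the empty list.\<close>

lemma mon_lipschitz: "b * cmod (mon xs w - mon xs w') \<le> real (length xs) * b ^ length xs * d"
proof (induction xs)
  case (Cons x xs)
  have "mon (x # xs) w - mon (x # xs) w' = (w $ x - w' $ x) * mon xs w + w' $ x * (mon xs w - mon xs w')"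
    by (simp add: algebra_simps)
  then have "b * cmod (mon (x # xs) w - mon (x # xs) w') \<le>
      b * (cmod (w $ x - w' $ x) * cmod (mon xs w)) + cmod (w' $ x) * (b * cmod (mon xs w - mon xs w'))"
    using mult_left_mono[OF norm_triangle_ineq[of "(w $ x - w' $ x) * mon xs w" "w' $ x * (mon xs w - mon xs w')"] less_imp_le[OF b]]
    by (simp only: norm_mult distrib_left mult.left_commute)
  also have "\<dots> \<le> b * (d * b ^ length xs) + b * (real (length xs) * b ^ length xs * d)"
    using b d_nonneg by (intro add_mono mult_left_mono[OF mult_mono[OF d norm_mon_le[OF w]]] mult_mono[OF w' Cons]) auto
  finally show ?case by (simp add: algebra_simps)
qed simp

context
  fixes v :: "complex^'n" and m :: real
  assumes v: "\<And>j. cmod (v $ j) \<le> m"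
begin

lemma m_nonneg: "0 \<le> m"
  using v norm_ge_zero order_trans by blast

lemma dmon_bound: "b * cmod (dmon xs w v) \<le> real (length xs) * b ^ length xs * m"
proof (induction xs)
  case (Cons x xs)
  have "b * cmod (dmon (x # xs) w v) \<le> b * (cmod (v $ x) * cmod (mon xs w)) + cmod (w $ x) * (b * cmod (dmon xs w v))"
    using mult_left_mono[OF norm_triangle_ineq[of "v $ x * mon xs w" "w $ x * dmon xs w v"] less_imp_le[OF b]]
    by (simp only: dmon.simps norm_mult distrib_left mult.left_commute)
  also have "\<dots> \<le> b * (m * b ^ length xs) + b * (real (length xs) * b ^ length xs * m)"
    using b m_nonneg by (intro add_mono mult_left_mono[OF mult_mono[OF v norm_mon_le[OF w]]] mult_mono[OF w Cons]) auto
  finally show ?case by (simp add: algebra_simps)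
qed simp

lemma dmon_lipschitz:
  "b\<^sup>2 * cmod (dmon xs w v - dmon xs w' v) \<le> (real (length xs))\<^sup>2 * b ^ length xs * (m * d)"
proof (induction xs)
  case (Cons x xs)
  let ?l = "real (length xs)"
  let ?X = "v $ x * (mon xs w - mon xs w')" and ?Y = "(w $ x - w' $ x) * dmon xs w v"
    and ?Z = "w' $ x * (dmon xs w v - dmon xs w' v)"
  have "dmon (x # xs) w v - dmon (x # xs) w' v = ?X + ?Y + ?Z"
    by (simp add: algebra_simps)
  then have "cmod (dmon (x # xs) w v - dmon (x # xs) w' v) \<le> cmod ?X + cmod ?Y + cmod ?Z"
    using norm_triangle_ineq[of "?X + ?Y" ?Z] norm_triangle_ineq[of ?X ?Y] by simp
  then have "b\<^sup>2 * cmod (dmon (x # xs) w v - dmon (x # xs) w' v) \<le> b\<^sup>2 * (cmod ?X + cmod ?Y + cmod ?Z)"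
    by (rule mult_left_mono) simp
  also have "\<dots> = b * (cmod (v $ x) * (b * cmod (mon xs w - mon xs w'))) +
      b * (cmod (w $ x - w' $ x) * (b * cmod (dmon xs w v))) +
      cmod (w' $ x) * (b\<^sup>2 * cmod (dmon xs w v - dmon xs w' v))"
    by (simp only: norm_mult power2_eq_square distrib_left mult.assoc mult.left_commute mult.commute)
  also have "\<dots> \<le> b * (m * (?l * b ^ length xs * d)) + b * (d * (?l * b ^ length xs * m)) +
      b * (?l\<^sup>2 * b ^ length xs * (m * d))"
  proof (intro add_mono)
    show "b * (cmod (v $ x) * (b * cmod (mon xs w - mon xs w'))) \<le> b * (m * (?l * b ^ length xs * d))"
      using b m_nonneg by (intro mult_left_mono[OF mult_mono[OF v mon_lipschitz]]) auto
    show "b * (cmod (w $ x - w' $ x) * (b * cmod (dmon xs w v))) \<le> b * (d * (?l * b ^ length xs * m))"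
      using b d_nonneg by (intro mult_left_mono[OF mult_mono[OF d dmon_bound]]) auto
    show "cmod (w' $ x) * (b\<^sup>2 * cmod (dmon xs w v - dmon xs w' v)) \<le> b * (?l\<^sup>2 * b ^ length xs * (m * d))"
      using b by (intro mult_mono[OF w' Cons]) auto
  qed
  also have "\<dots> = (2 * ?l + ?l\<^sup>2) * b ^ length (x # xs) * (m * d)"
    by (simp add: algebra_simps)
  also have "\<dots> \<le> (real (length (x # xs)))\<^sup>2 * b ^ length (x # xs) * (m * d)"
    using b d_nonneg m_nonneg by (intro mult_right_mono) (auto simp: power2_eq_square algebra_simps)
  finally show ?case .
qed simp

end

end

lemma le_power_2: "real L \<le> 2 ^ L"
  using of_nat_less_two_power[of L, where 'a = real] by simp

text \<open>Shrinking the radius by 4 gains \<open>4 ^ L\<close>. One derivative costs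
  \<open>L \<le> 2 ^ L\<close> and leaves \<open>2 ^ L\<close>, later the source of
  \<open>2 ^ N\<close>; two derivatives use up the gain.\<close>

lemma quarter_power_bound: "real L * (\<rho> / 4) ^ L \<le> \<rho> ^ L / 2 ^ L" "(real L)\<^sup>2 * (\<rho> / 4) ^ L \<le> \<rho> ^ L"
  if "0 \<le> \<rho>" for L and \<rho> :: real
proof -
  have e: "(\<rho> / 4) ^ L = \<rho> ^ L / (2 ^ L * 2 ^ L)"
  proof -
    have "(4 :: real) ^ L = 2 ^ L * 2 ^ L" by (simp flip: power_mult_distrib)
    then show ?thesis by (simp add: power_divide)
  qed
  show "real L * (\<rho> / 4) ^ L \<le> \<rho> ^ L / 2 ^ L"
  proof -
    have "real L * (\<rho> / 4) ^ L \<le> 2 ^ L * (\<rho> / 4) ^ L"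
      using that le_power_2 by (intro mult_right_mono) auto
    then show ?thesis unfolding e by simp
  qed
  have "(real L)\<^sup>2 * (\<rho> / 4) ^ L \<le> (2 ^ L)\<^sup>2 * (\<rho> / 4) ^ L"
    using that le_power_2 by (intro mult_right_mono power_mono) auto
  then show "(real L)\<^sup>2 * (\<rho> / 4) ^ L \<le> \<rho> ^ L" unfolding e by (simp add: power2_eq_square)
qed

lemma has_sum_diff:
  fixes f g :: "'a \<Rightarrow> complex"
  assumes "(f has_sum x) A" "(g has_sum y) A"
  shows "((\<lambda>i. f i - g i) has_sum (x - y)) A"
  using has_sum_add[OF assms(1) has_sum_uminusI[OF assms(2)]] by simp

lemma has_vector_derivative_componentwise_vec:
  fixes f :: "real \<Rightarrow> complex^'n"
  assumes "\<And>j. ((\<lambda>t. f t $ j) has_vector_derivative f' $ j) (at x within S)"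
  shows "(f has_vector_derivative f') (at x within S)"
  unfolding has_vector_derivative_def has_derivative_within
proof
  show "bounded_linear (\<lambda>t. t *\<^sub>R f')" by (rule bounded_linear_scaleR_left)
  show "((\<lambda>y. (1 / norm (y - x)) *\<^sub>R (f y - (f x + (y - x) *\<^sub>R f'))) \<longlongrightarrow> 0) (at x within S)"
    by (rule vec_tendstoI) (use assms in \<open>simp add: has_vector_derivative_def has_derivative_within\<close>)
qed

section \<open>The near-identity change of coordinates\<close>

locale near_identity = majorized a r C
  for a :: "'n::finite \<Rightarrow> 'n list \<Rightarrow> complex" and r C :: real +
  fixes F :: "complex^'n \<Rightarrow> complex^'n" and \<omega> :: "'n \<Rightarrow> real" and N :: nat and \<rho> :: real
  assumes a_short: "\<And>j xs. length xs < 2 \<Longrightarrow> a j xs = 0"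
    and expansion: "\<And>j z. supnorm z \<le> r \<Longrightarrow>
      ((\<lambda>xs. a j xs * mon xs z) has_sum (F z $ j - \<i> * complex_of_real (\<omega> j) * z $ j)) UNIV"
    and F_zero: "F 0 = 0" and nonres: "non_resonant \<omega>" and N: "1 \<le> N"
    and \<rho>: "0 < \<rho>" "\<rho> \<le> 1" "2 * \<rho> \<le> r"
    and tail: "\<And>j. (\<Sum>t\<in>big_trees N j. cmod (tcoeff \<omega> a t) * \<rho> ^ nl t) \<le> 1 / (16 * real CARD('n)) * \<rho>"
begin

abbreviation "tc \<equiv> tcoeff \<omega> a"

definition h where "h w = (\<chi> j. \<Sum>t\<in>big_trees N j. tc t * mon (leaves t) w)"
text \<open>\<open>P w\<close> is the derivative of \<open>h\<close> at \<open>w\<close>, so DH(w) =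
  1 + P w, and \<open>E\<close> is F(H w) - DH(w) A w, the defect of the conjugacy.\<close>

definition P where "P w v = (\<chi> j. \<Sum>t\<in>big_trees N j. tc t * dmon (leaves t) w v)"
definition H where "H w = w + h w"
definition E where "E w = F (H w) - (diag_lin \<omega> w + P w (diag_lin \<omega> w))"

lemma n_ge_1: "1 \<le> real CARD('n)"
  by (simp add: Suc_le_eq)

lemma component_sum_bound:
  assumes "\<And>t. t \<in> big_trees N j \<Longrightarrow> cmod (X t) \<le> K * \<rho> ^ nl t" "0 \<le> K"
  shows "cmod (\<Sum>t\<in>big_trees N j. tc t * X t) \<le> K * (\<rho> / (16 * real CARD('n)))"
proof -
  have "cmod (\<Sum>t\<in>big_trees N j. tc t * X t) \<le> (\<Sum>t\<in>big_trees N j. cmod (tc t * X t))"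
    by (rule norm_sum)
  also have "\<dots> \<le> (\<Sum>t\<in>big_trees N j. K * (cmod (tc t) * \<rho> ^ nl t))"
  proof (rule sum_mono)
    fix t assume "t \<in> big_trees N j"
    from mult_left_mono[OF assms(1)[OF this] norm_ge_zero[of "tc t"]]
    show "cmod (tc t * X t) \<le> K * (cmod (tc t) * \<rho> ^ nl t)" by (simp add: norm_mult mult.left_commute)
  qed
  also have "\<dots> = K * (\<Sum>t\<in>big_trees N j. cmod (tc t) * \<rho> ^ nl t)" by (simp add: sum_distrib_left)
  also have "\<dots> \<le> K * (\<rho> / (16 * real CARD('n)))"
    using tail[of j] assms(2) by (intro mult_left_mono) auto
  finally show ?thesis .
qed

lemma quarter_power_le: "real L * (\<rho> / 4) ^ L \<le> \<rho> ^ L"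
proof -
  have "real L * (\<rho> / 4) ^ L \<le> \<rho> ^ L / 2 ^ L" using \<rho> by (intro quarter_power_bound) auto
  also have "\<dots> \<le> \<rho> ^ L / 1" using \<rho> by (intro divide_left_mono) auto
  finally show ?thesis by simp
qed

lemma h_lipschitz:
  assumes w: "norm w \<le> \<rho> / 4" "norm w' \<le> \<rho> / 4"
  shows "norm (h w - h w') \<le> norm (w - w') / 4"
proof -
  let ?d = "norm (w - w')"
  have "cmod ((h w - h w') $ j) \<le> ?d / (4 * real CARD('n))" for j
  proof -
    have "(h w - h w') $ j = (\<Sum>t\<in>big_trees N j. tc t * (mon (leaves t) w - mon (leaves t) w'))"
      by (simp add: h_def sum_subtractf right_diff_distrib)
    \<comment> \<open>The constant of \<open>tail\<close> is made for this: of its 16 one factor 4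
      is lost to the smaller radius, the other makes the Lipschitz constant 1 / 4, and
      \<open>CARD('n)\<close> passes from components to the norm.\<close>
    also have "cmod \<dots> \<le> (4 / \<rho> * ?d) * (\<rho> / (16 * real CARD('n)))"
    proof (rule component_sum_bound)
      fix t
      have "\<rho> / 4 * cmod (mon (leaves t) w - mon (leaves t) w') \<le> real (nl t) * (\<rho> / 4) ^ nl t * ?d"
        using \<rho> w by (intro mon_lipschitz order_trans[OF Finite_Cartesian_Product.norm_nth_le])
          (auto simp flip: vector_minus_component intro: Finite_Cartesian_Product.norm_nth_le)
      also have "\<dots> \<le> \<rho> ^ nl t * ?d" by (intro mult_right_mono quarter_power_le) auto
      finally show "cmod (mon (leaves t) w - mon (leaves t) w') \<le> 4 / \<rho> * ?d * \<rho> ^ nl t"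
        using \<rho> by (simp add: field_simps)
    qed (use \<rho> in auto)
    also have "\<dots> = ?d / (4 * real CARD('n))" using \<rho> by simp
    finally show ?thesis .
  qed
  then have "norm (h w - h w') \<le> real CARD('n) * (?d / (4 * real CARD('n)))" by (rule norm_le_card_bound)
  then show ?thesis using n_ge_1 by simp
qed

lemma P_bound:
  assumes w: "norm w \<le> \<rho> / 4"
  shows "norm (P w v) \<le> norm v / 4"
proof -
  have "cmod (P w v $ j) \<le> norm v / (4 * real CARD('n))" for j
  proof -
    have "P w v $ j = (\<Sum>t\<in>big_trees N j. tc t * dmon (leaves t) w v)"
      by (simp add: P_def)
    also have "cmod \<dots> \<le> (4 / \<rho> * norm v) * (\<rho> / (16 * real CARD('n)))"
    proof (rule component_sum_bound)
      fix t
      have "\<rho> / 4 * cmod (dmon (leaves t) w v) \<le> real (nl t) * (\<rho> / 4) ^ nl t * norm v"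
        using \<rho> w by (intro dmon_bound order_trans[OF Finite_Cartesian_Product.norm_nth_le])
          (auto intro: Finite_Cartesian_Product.norm_nth_le)
      also have "\<dots> \<le> \<rho> ^ nl t * norm v" by (intro mult_right_mono quarter_power_le) auto
      finally show "cmod (dmon (leaves t) w v) \<le> 4 / \<rho> * norm v * \<rho> ^ nl t"
        using \<rho> by (simp add: field_simps)
    qed (use \<rho> in auto)
    also have "\<dots> = norm v / (4 * real CARD('n))" using \<rho> by simp
    finally show ?thesis .
  qed
  then have "norm (P w v) \<le> real CARD('n) * (norm v / (4 * real CARD('n)))" by (rule norm_le_card_bound)
  then show ?thesis using n_ge_1 by simp
qed

lemma P_lipschitz:
  assumes w: "norm w \<le> \<rho> / 4" "norm w' \<le> \<rho> / 4"
  shows "norm (P w v - P w' v) \<le> norm v * norm (w - w') / \<rho>"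
proof -
  let ?d = "norm (w - w')"
  have "cmod ((P w v - P w' v) $ j) \<le> norm v * ?d / (\<rho> * real CARD('n))" for j
  proof -
    have "(P w v - P w' v) $ j = (\<Sum>t\<in>big_trees N j. tc t * (dmon (leaves t) w v - dmon (leaves t) w' v))"
      by (simp add: P_def sum_subtractf right_diff_distrib)
    also have "cmod \<dots> \<le> (16 / \<rho>\<^sup>2 * (norm v * ?d)) * (\<rho> / (16 * real CARD('n)))"
    proof (rule component_sum_bound)
      fix t
      have "(\<rho> / 4)\<^sup>2 * cmod (dmon (leaves t) w v - dmon (leaves t) w' v) \<le>
          (real (nl t))\<^sup>2 * (\<rho> / 4) ^ nl t * (norm v * ?d)"
        using \<rho> w by (intro dmon_lipschitz order_trans[OF Finite_Cartesian_Product.norm_nth_le])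
          (auto simp flip: vector_minus_component intro: Finite_Cartesian_Product.norm_nth_le)
      also have "\<dots> \<le> \<rho> ^ nl t * (norm v * ?d)"
        using \<rho> by (intro mult_right_mono quarter_power_bound) auto
      finally show "cmod (dmon (leaves t) w v - dmon (leaves t) w' v) \<le> 16 / \<rho>\<^sup>2 * (norm v * ?d) * \<rho> ^ nl t"
        using \<rho> by (simp add: power_divide field_simps)
    qed (use \<rho> in auto)
    also have "\<dots> = norm v * ?d / (\<rho> * real CARD('n))" using \<rho> by (simp add: power2_eq_square)
    finally show ?thesis .
  qed
  then have "norm (P w v - P w' v) \<le> real CARD('n) * (norm v * ?d / (\<rho> * real CARD('n)))" by (rule norm_le_card_bound)
  then show ?thesis using n_ge_1 by simp
qed

lemma P_add: "P w (u + v) = P w u + P w v"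
  by (simp add: P_def vec_eq_iff dmon_add distrib_left sum.distrib)

lemma P_diff: "P w (u - v) = P w u - P w v"
  by (simp add: P_def vec_eq_iff dmon_diff right_diff_distrib sum_subtractf)

lemma h_zero: "h 0 = 0"
proof -
  have "mon (leaves t) 0 = (0 :: complex)" if "t \<in> big_trees N j" for t :: "'n ltree" and j
    using that by (intro mon_zero) (auto simp: big_trees_def)
  then show ?thesis by (simp add: h_def vec_eq_iff)
qed

lemma h_bound: "norm w \<le> \<rho> / 4 \<Longrightarrow> norm (h w) \<le> norm w / 4"
  using h_lipschitz[of w 0] \<rho> by (simp add: h_zero)

lemma H_bound: "norm w \<le> \<rho> / 4 \<Longrightarrow> norm (H w) \<le> 5 / 4 * norm w"
  using h_bound[of w] norm_triangle_ineq[of w "h w"] unfolding H_def by linarith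

lemma sum_trees:
  fixes j :: 'n and g :: "'n ltree \<Rightarrow> 'b::comm_monoid_add"
  shows "(\<Sum>t\<in>trees N j. g t) = g (Lf j) + (\<Sum>t\<in>big_trees N j. g t)"
proof -
  have "finite (big_trees N j)"
    using finite_trees[of N j] by (simp add: big_trees_def)
  then show ?thesis using trees_eq_insert[OF N, of j] by simp
qed

lemma H_component: "H w $ j = (\<Sum>t\<in>trees N j. tc t * mon (leaves t) w)"
  unfolding sum_trees by (simp add: H_def h_def)

section \<open>The defect of the conjugacy\<close>

definition fcoeff where "fcoeff ts = prod_list (map tc ts)"
abbreviation "fmon ts w \<equiv> mon (concat (map leaves ts)) w"
text \<open>Forests are sorted by their number of leaves, that is, by degree in \<open>w\<close>:
  those in \<open>low\<close> become trees of the truncation once a root is added, those in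
  \<open>high\<close> make up the defect.\<close>

definition high where "high xs = {ts \<in> forests N xs. N < (\<Sum>t\<leftarrow>ts. nl t)}"
definition low where "low xs = {ts \<in> forests N xs. (\<Sum>t\<leftarrow>ts. nl t) \<le> N}"

lemma mon_H: "mon xs (H w) = (\<Sum>ts\<in>forests N xs. fcoeff ts * fmon ts w)"
proof -
  have "mon xs (H w) = prod_list (map (\<lambda>x. \<Sum>t\<in>trees N x. tc t * mon (leaves t) w) xs)"
    by (intro arg_cong[where f = prod_list] map_cong refl H_component)
  also have "\<dots> = (\<Sum>ts\<in>forests N xs. prod_list (map (\<lambda>t. tc t * mon (leaves t) w) ts))"
    by (rule sum_forests[symmetric])
  also have "\<dots> = (\<Sum>ts\<in>forests N xs. fcoeff ts * fmon ts w)"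
    by (simp add: prod_list_mult fcoeff_def mon_concat comp_def)
  finally show ?thesis .
qed

text \<open>Adding a root \<open>j\<close> to the low forests gives exactly the trees of
  \<open>big_trees N j\<close>, and the factor \<open>\<i> * divisor\<close> undoes the division in
  \<open>tcoeff\<close>. The limit is component \<open>j\<close> of P w (A w) - A (h w), by
  \<open>dmon_diag_lin\<close>.\<close>

lemma low_part:
  "((\<lambda>xs. a j xs * (\<Sum>ts\<in>low xs. fcoeff ts * fmon ts w)) has_sum
    (\<Sum>t\<in>big_trees N j. \<i> * complex_of_real (divisor \<omega> t) * tc t * mon (leaves t) w)) UNIV"
proof -
  let ?X = "{xs :: 'n list. 2 \<le> length xs \<and> length xs \<le> N}"
  have fin: "finite ?X"
    using finite_lists_length_le[of "UNIV :: 'n set" N] by (rule finite_subset[rotated]) auto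
  have "(\<Sum>t\<in>big_trees N j. \<i> * complex_of_real (divisor \<omega> t) * tc t * mon (leaves t) w) =
      (\<Sum>xs\<in>?X. \<Sum>ts\<in>low xs. \<i> * complex_of_real (divisor \<omega> (Nd j ts)) * tc (Nd j ts) * mon (leaves (Nd j ts)) w)"
    unfolding low_def by (rule sum_big_trees)
  also have "\<dots> = (\<Sum>xs\<in>?X. a j xs * (\<Sum>ts\<in>low xs. fcoeff ts * fmon ts w))"
    unfolding sum_distrib_left
  proof (intro sum.cong refl)
    fix xs ts assume xs: "xs \<in> ?X" and ts: "ts \<in> low xs"
    then have "length ts = length xs" by (auto simp: low_def forests_def)
    then have p: "proper (Nd j ts)" using ts xs by (auto simp: low_def forests_def)
    have "map tree_root ts = xs" using ts by (auto simp: low_def forests_def)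
    then show "\<i> * complex_of_real (divisor \<omega> (Nd j ts)) * tc (Nd j ts) * mon (leaves (Nd j ts)) w =
        a j xs * (fcoeff ts * fmon ts w)"
      using abs_divisor_pos[OF nonres p] by (simp add: fcoeff_def)
  qed
  finally have eq: "(\<Sum>t\<in>big_trees N j. \<i> * complex_of_real (divisor \<omega> t) * tc t * mon (leaves t) w) =
      (\<Sum>xs\<in>?X. a j xs * (\<Sum>ts\<in>low xs. fcoeff ts * fmon ts w))" .
  \<comment> \<open>Each tree has a leaf, so a list longer than \<open>N\<close> admits no low
    forest; below length 2 the Taylor coefficient vanishes. Hence the sum is finite.\<close>
  have outside: "a j xs * (\<Sum>ts\<in>low xs. fcoeff ts * fmon ts w) = 0" if "xs \<notin> ?X" for xs
  proof (cases "length xs < 2")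
    case False
    have "low xs = {}"
    proof (rule ccontr)
      assume "low xs \<noteq> {}"
      then obtain ts where "map tree_root ts = xs" "\<forall>t\<in>set ts. proper t" "(\<Sum>t\<leftarrow>ts. nl t) \<le> N"
        by (auto simp: low_def forests_def)
      with length_le_nl[of ts] False that show False by auto
    qed
    then show ?thesis by simp
  qed (simp add: a_short)
  have "((\<lambda>xs. a j xs * (\<Sum>ts\<in>low xs. fcoeff ts * fmon ts w)) has_sum
      (\<Sum>xs\<in>?X. a j xs * (\<Sum>ts\<in>low xs. fcoeff ts * fmon ts w))) ?X"
    using fin by (rule has_sum_finite)
  then show ?thesis
    unfolding eq using outside
    by (subst has_sum_cong_neutral[where S = ?X and T = UNIV, symmetric]) auto
qed

text \<open>By the choice of the coefficients, all terms of degree at most \<open>N\<close> cancel in \<open>E\<close>.\<close>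

lemma E_expansion:
  assumes w: "norm w \<le> \<rho> / 4"
  shows "((\<lambda>xs. a j xs * (\<Sum>ts\<in>high xs. fcoeff ts * fmon ts w)) has_sum (E w $ j)) UNIV"
proof -
  have "supnorm (H w) \<le> r"
    using supnorm_le_norm[of "H w"] H_bound[OF w] w \<rho> by linarith
  from expansion[OF this, of j]
  have "((\<lambda>xs. a j xs * mon xs (H w)) has_sum (F (H w) $ j - \<i> * complex_of_real (\<omega> j) * H w $ j)) UNIV" .
  from has_sum_diff[OF this low_part[of j w]]
  have "((\<lambda>xs. a j xs * mon xs (H w) - a j xs * (\<Sum>ts\<in>low xs. fcoeff ts * fmon ts w)) has_sum
      (F (H w) $ j - \<i> * complex_of_real (\<omega> j) * H w $ j -
        (\<Sum>t\<in>big_trees N j. \<i> * complex_of_real (divisor \<omega> t) * tc t * mon (leaves t) w))) UNIV" .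
  moreover have "mon xs (H w) = (\<Sum>ts\<in>low xs. fcoeff ts * fmon ts w) + (\<Sum>ts\<in>high xs. fcoeff ts * fmon ts w)" for xs
  proof -
    have "forests N xs = low xs \<union> high xs" "low xs \<inter> high xs = {}"
      by (auto simp: low_def high_def)
    moreover have "finite (low xs)" "finite (high xs)"
      unfolding low_def high_def using finite_forests[of N xs] by simp_all
    ultimately show ?thesis unfolding mon_H by (simp add: sum.union_disjoint)
  qed
  moreover have "F (H w) $ j - \<i> * complex_of_real (\<omega> j) * H w $ j -
        (\<Sum>t\<in>big_trees N j. \<i> * complex_of_real (divisor \<omega> t) * tc t * mon (leaves t) w) = E w $ j"
  proof -
    have "(\<Sum>t\<in>big_trees N j. \<i> * complex_of_real (divisor \<omega> t) * tc t * mon (leaves t) w) =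
        (\<Sum>t\<in>big_trees N j. tc t * dmon (leaves t) w (diag_lin \<omega> w) - \<i> * complex_of_real (\<omega> j) * (tc t * mon (leaves t) w))"
    proof (intro sum.cong refl)
      fix t assume "t \<in> big_trees N j"
      then have "tree_root t = j" by (auto simp: big_trees_def trees_def)
      then show "\<i> * complex_of_real (divisor \<omega> t) * tc t * mon (leaves t) w =
          tc t * dmon (leaves t) w (diag_lin \<omega> w) - \<i> * complex_of_real (\<omega> j) * (tc t * mon (leaves t) w)"
        by (simp add: dmon_diag_lin divisor_def algebra_simps)
    qed
    also have "\<dots> = P w (diag_lin \<omega> w) $ j - \<i> * complex_of_real (\<omega> j) * h w $ j"
      by (simp add: P_def h_def sum_subtractf sum_distrib_left)
    finally show ?thesis by (simp add: E_def H_def diag_lin_def algebra_simps)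
  qed
  ultimately show ?thesis by (simp add: algebra_simps)
qed

lemma sum_trees_bound: "(\<Sum>t\<in>trees N j. cmod (tc t) * \<rho> ^ nl t) \<le> 2 * \<rho>"
proof -
  have "1 / (16 * real CARD('n)) * \<rho> \<le> 1 * \<rho>"
  proof (rule mult_right_mono)
    have "1 \<le> 16 * real CARD('n)" using n_ge_1 by linarith
    then show "1 / (16 * real CARD('n)) \<le> 1" by (subst divide_le_eq_1_pos) linarith+
  qed (use \<rho> in auto)
  then show ?thesis unfolding sum_trees using tail[of j] by simp
qed

text \<open>A forest in \<open>high\<close> has more than \<open>N\<close> leaves, so the smaller
  radius gains at least \<open>2 ^ N\<close>. What remains is bounded by the majorant of
  \<open>F\<close> at \<open>2 * \<rho>\<close>, since each tree sum is at most
  \<open>2 * \<rho>\<close>; the factor \<open>16 * C * \<rho>\<close> is \<open>4 / \<rho>\<close>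
  times \<open>C * (2 * \<rho>)\<^sup>2\<close>.\<close>

lemma E_lipschitz:
  assumes w: "norm w \<le> \<rho> / 4" "norm w' \<le> \<rho> / 4"
  shows "norm (E w - E w') \<le> 16 * (real CARD('n) * C) * \<rho> / 2 ^ N * norm (w - w')"
proof -
  let ?d = "norm (w - w')"
  have "cmod ((E w - E w') $ j) \<le> 16 * C * \<rho> / 2 ^ N * ?d" for j
  proof (rule norm_has_sum_le)
    show "((\<lambda>xs. a j xs * (\<Sum>ts\<in>high xs. fcoeff ts * (fmon ts w - fmon ts w'))) has_sum ((E w - E w') $ j)) UNIV"
      using has_sum_diff[OF E_expansion[OF w(1), of j] E_expansion[OF w(2), of j]]
      by (simp add: right_diff_distrib sum_subtractf)
    fix X :: "'n list set" assume X: "finite X"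
    let ?K = "4 / \<rho> / 2 ^ N * ?d"
    have K0: "0 \<le> ?K" using \<rho> by simp
    have fm: "cmod (fmon ts w - fmon ts w') \<le> ?K * \<rho> ^ (\<Sum>t\<leftarrow>ts. nl t)" if ts: "ts \<in> high xs" for ts xs
    proof -
      let ?L = "\<Sum>t\<leftarrow>ts. nl t"
      have len: "length (concat (map leaves ts)) = ?L" by (simp add: length_concat comp_def)
      have "\<rho> / 4 * cmod (fmon ts w - fmon ts w') \<le>
          real (length (concat (map leaves ts))) * (\<rho> / 4) ^ length (concat (map leaves ts)) * ?d"
        using \<rho> w by (intro mon_lipschitz order_trans[OF Finite_Cartesian_Product.norm_nth_le])
          (auto simp flip: vector_minus_component intro: Finite_Cartesian_Product.norm_nth_le)
      also have "\<dots> \<le> \<rho> ^ ?L / 2 ^ ?L * ?d"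
        unfolding len using \<rho> by (intro mult_right_mono quarter_power_bound) auto
      also have "\<dots> \<le> \<rho> ^ ?L / 2 ^ N * ?d"
        using ts \<rho> by (intro mult_right_mono divide_left_mono power_increasing) (auto simp: high_def)
      finally show ?thesis using \<rho> by (simp add: field_simps)
    qed
    have "cmod (a j xs * (\<Sum>ts\<in>high xs. fcoeff ts * (fmon ts w - fmon ts w'))) \<le>
        ?K * (cmod (a j xs) * (2 * \<rho>) ^ length xs)" for xs
    proof -
      have "cmod (\<Sum>ts\<in>high xs. fcoeff ts * (fmon ts w - fmon ts w')) \<le>
          (\<Sum>ts\<in>high xs. cmod (fcoeff ts) * cmod (fmon ts w - fmon ts w'))"
        unfolding norm_mult[symmetric] by (rule norm_sum)
      also have "\<dots> \<le> (\<Sum>ts\<in>high xs. cmod (fcoeff ts) * (?K * \<rho> ^ (\<Sum>t\<leftarrow>ts. nl t)))"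
        by (intro sum_mono mult_left_mono fm) auto
      also have "\<dots> \<le> (\<Sum>ts\<in>forests N xs. cmod (fcoeff ts) * (?K * \<rho> ^ (\<Sum>t\<leftarrow>ts. nl t)))"
        using \<rho> K0 by (intro sum_mono2 finite_forests mult_nonneg_nonneg) (auto simp: high_def)
      also have "\<dots> = ?K * (\<Sum>ts\<in>forests N xs. prod_list (map (\<lambda>t. cmod (tc t) * \<rho> ^ nl t) ts))"
        unfolding sum_distrib_left fcoeff_def prod_list_norm prod_list_mult prod_list_power
        by (simp only: mult.left_commute)
      also have "\<dots> = ?K * prod_list (map (\<lambda>x. \<Sum>t\<in>trees N x. cmod (tc t) * \<rho> ^ nl t) xs)"
        unfolding sum_forests ..
      also have "\<dots> \<le> ?K * prod_list (map (\<lambda>x. 2 * \<rho>) xs)"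
        using \<rho> sum_trees_bound
        by (intro mult_left_mono[OF _ K0] prod_list_mono) (auto intro!: sum_nonneg)
      also have "prod_list (map (\<lambda>x. 2 * \<rho>) xs) = (2 * \<rho>) ^ length xs"
        by (simp add: map_replicate_const)
      finally have "cmod (\<Sum>ts\<in>high xs. fcoeff ts * (fmon ts w - fmon ts w')) \<le> ?K * (2 * \<rho>) ^ length xs" .
      from mult_left_mono[OF this norm_ge_zero[of "a j xs"]] show ?thesis
        unfolding norm_mult by (simp only: mult.left_commute)
    qed
    then have "(\<Sum>xs\<in>X. cmod (a j xs * (\<Sum>ts\<in>high xs. fcoeff ts * (fmon ts w - fmon ts w')))) \<le>
        (\<Sum>xs\<in>X. ?K * (cmod (a j xs) * (2 * \<rho>) ^ length xs))"
      by (intro sum_mono)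
    also have "\<dots> = ?K * (\<Sum>xs\<in>X. cmod (a j xs) * (2 * \<rho>) ^ length xs)" by (simp add: sum_distrib_left)
    also have "\<dots> \<le> ?K * (C * (2 * \<rho>)\<^sup>2)"
      using \<rho> by (intro mult_left_mono[OF _ K0] maj X) auto
    also have "\<dots> = 16 * C * \<rho> / 2 ^ N * ?d" using \<rho> by (simp add: power2_eq_square)
    finally show "(\<Sum>xs\<in>X. cmod (a j xs * (\<Sum>ts\<in>high xs. fcoeff ts * (fmon ts w - fmon ts w')))) \<le>
        16 * C * \<rho> / 2 ^ N * ?d" .
  qed
  then have "norm (E w - E w') \<le> real CARD('n) * (16 * C * \<rho> / 2 ^ N * ?d)" by (rule norm_le_card_bound)
  then show ?thesis by (simp add: mult_ac)
qed

lemma E_zero: "E 0 = 0"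
proof -
  have "diag_lin \<omega> 0 = 0" by (simp add: diag_lin_def vec_eq_iff)
  moreover have "P 0 0 = 0" using P_diff[of 0 0 0] by simp
  ultimately show ?thesis by (simp add: E_def H_def h_zero F_zero)
qed

lemma E_bound:
  assumes w: "norm w \<le> \<rho> / 4"
  shows "norm (E w) \<le> 4 * (real CARD('n) * C) * \<rho>\<^sup>2 / 2 ^ N"
proof -
  have "norm (E w - E 0) \<le> 16 * (real CARD('n) * C) * \<rho> / 2 ^ N * norm (w - 0)"
    using w \<rho> by (intro E_lipschitz) auto
  also have "\<dots> \<le> 16 * (real CARD('n) * C) * \<rho> / 2 ^ N * (\<rho> / 4)"
    using w \<rho> C_nonneg by (intro mult_left_mono) auto
  finally show ?thesis by (simp add: E_zero power2_eq_square mult_ac)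
qed

text \<open>Inverts 1 + P w by contraction, since \<open>P w\<close> has norm at most 1 / 4; no
  inverse matrix has to be handled.\<close>

lemma ex_remainder:
  assumes w: "norm w \<le> \<rho> / 4"
  shows "\<exists>y. y + P w y = E w"
proof -
  have "\<exists>!y. E w - P w y = y"
  proof (rule banach_fix_type[where c = "1 / 4"])
    show "\<forall>x y. dist (E w - P w x) (E w - P w y) \<le> 1 / 4 * dist x y"
    proof (intro allI)
      fix x y
      have "dist (E w - P w x) (E w - P w y) = norm (P w (y - x))"
        by (simp add: dist_norm P_diff)
      also have "\<dots> \<le> 1 / 4 * dist x y"
        using P_bound[OF w, of "y - x"] by (simp add: dist_norm norm_minus_commute)
      finally show "dist (E w - P w x) (E w - P w y) \<le> 1 / 4 * dist x y" .
    qed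
  qed auto
  then obtain y where "E w - P w y = y" by blast
  then have "y + P w y = E w" by (metis diff_add_cancel)
  then show ?thesis by blast
qed

text \<open>\<open>R w\<close> solves \<open>DH(w) (R w) = E w\<close>, so \<open>w' = A w + R w\<close> is the field \<open>F\<close> in the coordinate \<open>z = H w\<close>.\<close>

definition R where "R w = (SOME y. y + P w y = E w)"

lemma R_eq: "norm w \<le> \<rho> / 4 \<Longrightarrow> R w + P w (R w) = E w"
  unfolding R_def by (rule someI_ex[OF ex_remainder])

lemma R_bound:
  assumes w: "norm w \<le> \<rho> / 4"
  shows "norm (R w) \<le> 6 * (real CARD('n) * C) * \<rho>\<^sup>2 / 2 ^ N"
proof -
  have "R w = E w - P w (R w)" using R_eq[OF w] by (simp add: algebra_simps)
  then have "norm (R w) \<le> norm (E w) + norm (P w (R w))" by (metis norm_triangle_ineq4)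
  then have "norm (R w) \<le> 4 / 3 * norm (E w)" using P_bound[OF w, of "R w"] by linarith
  moreover have "norm (E w) \<le> 4 * (real CARD('n) * C * \<rho>\<^sup>2 / 2 ^ N)"
    using E_bound[OF w] by (simp add: mult_ac)
  moreover have "0 \<le> real CARD('n) * C * \<rho>\<^sup>2 / 2 ^ N" using C_nonneg by simp
  moreover have "x \<le> 6 * k" if "x \<le> 4 / 3 * e" "e \<le> 4 * k" "0 \<le> k" for x e k :: real
    using that by linarith
  ultimately have "norm (R w) \<le> 6 * (real CARD('n) * C * \<rho>\<^sup>2 / 2 ^ N)" by blast
  then show ?thesis by (simp add: mult_ac)
qed

text \<open>Subtracting the two equations leaves, besides the change of \<open>E\<close>, the change
  of \<open>P\<close> in its base point, which acts on the already small \<open>R w'\<close>. The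
  term with \<open>P w\<close> is absorbed on the left:
  \<open>(16 + 6) * 4 / 3 \<le> 30\<close>.\<close>

lemma R_lipschitz:
  assumes w: "norm w \<le> \<rho> / 4" "norm w' \<le> \<rho> / 4"
  shows "norm (R w - R w') \<le> 30 * (real CARD('n) * C) * \<rho> / 2 ^ N * norm (w - w')"
proof -
  let ?d = "norm (w - w')" and ?K = "real CARD('n) * C * \<rho> / 2 ^ N"
  have K: "0 \<le> ?K * ?d" using C_nonneg \<rho> by simp
  have "R w - R w' = ((E w - E w') - P w (R w - R w')) - (P w (R w') - P w' (R w'))"
    using R_eq[OF w(1)] R_eq[OF w(2)] by (simp add: P_diff algebra_simps)
  then have "norm (R w - R w') \<le> norm (E w - E w') + norm (P w (R w - R w')) + norm (P w (R w') - P w' (R w'))"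
    using norm_triangle_ineq4[of "(E w - E w') - P w (R w - R w')" "P w (R w') - P w' (R w')"]
      norm_triangle_ineq4[of "E w - E w'" "P w (R w - R w')"] by simp
  moreover have "norm (P w (R w') - P w' (R w')) \<le> 6 * (?K * ?d)"
  proof -
    have "norm (P w (R w') - P w' (R w')) \<le> norm (R w') * ?d / \<rho>" by (rule P_lipschitz[OF w])
    also have "\<dots> \<le> (6 * (real CARD('n) * C) * \<rho>\<^sup>2 / 2 ^ N) * ?d / \<rho>"
      using \<rho> by (intro divide_right_mono mult_right_mono R_bound w) auto
    also have "\<dots> = 6 * (?K * ?d)" using \<rho> by (simp add: power2_eq_square)
    finally show ?thesis .
  qed
  moreover have "norm (E w - E w') \<le> 16 * (?K * ?d)" using E_lipschitz[OF w] by (simp add: mult_ac)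
  moreover have "norm (P w (R w - R w')) \<le> norm (R w - R w') / 4" by (rule P_bound[OF w(1)])
  moreover have "x \<le> 30 * k" if "x \<le> e + p + q" "q \<le> 6 * k" "e \<le> 16 * k" "p \<le> x / 4" "0 \<le> k"
    for x e p q k :: real
    using that by linarith
  ultimately have "norm (R w - R w') \<le> 30 * (?K * ?d)" using K by blast
  then show ?thesis by (simp add: mult_ac)
qed

section \<open>The flow in the new coordinates\<close>

definition T where "T = 2 ^ N / (128 * (real CARD('n) * C + 1))"

text \<open>The 128 in \<open>T\<close> serves both requirements of the Picard iteration: 30 / 128 <
  1 for the contraction, 6 / 128 \<le> 1 / 16 for staying within \<rho> / 16 of the start. The + 1
  covers \<open>C = 0\<close>.\<close>

lemma T_bounds:
  shows "0 < T" "30 * (real CARD('n) * C) * \<rho> / 2 ^ N * T < 1" "6 * (real CARD('n) * C) * \<rho>\<^sup>2 / 2 ^ N * T \<le> \<rho> / 16"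
proof -
  let ?K = "real CARD('n) * C"
  have K: "0 \<le> ?K" using C_nonneg by simp
  show "0 < T" using K by (simp add: T_def)
  have "?K * \<rho> \<le> ?K * 1" using \<rho> K by (intro mult_left_mono) auto
  then show "30 * ?K * \<rho> / 2 ^ N * T < 1"
    unfolding T_def using K by (simp add: field_simps)
  have "?K * \<rho> * \<rho> \<le> ?K * 1 * \<rho>" using \<rho> K by (intro mult_right_mono mult_left_mono) auto
  then have "6 * (?K * \<rho>\<^sup>2) \<le> 6 * (?K * \<rho>)" by (simp add: power2_eq_square mult.assoc)
  also have "\<dots> = (6 * ?K) * \<rho>" by simp
  also have "\<dots> \<le> (8 * (?K + 1)) * \<rho>"
  proof (rule mult_right_mono)
    show "6 * ?K \<le> 8 * (?K + 1)" unfolding distrib_left using K by linarith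
  qed (use \<rho> in simp)
  finally have "6 * (?K * \<rho>\<^sup>2) / (128 * (?K + 1)) \<le> (8 * (?K + 1)) * \<rho> / (128 * (?K + 1))"
    using K by (intro divide_right_mono) auto
  also have "\<dots> = \<rho> / 16" using K by (simp add: field_simps)
  finally show "6 * ?K * \<rho>\<^sup>2 / 2 ^ N * T \<le> \<rho> / 16" unfolding T_def by (simp add: mult_ac)
qed

text \<open>The flow of the linear field, an isometry because the frequencies are real. With w = rot
  t v the equation w' = A w + R w becomes v' = rot (- t) (R (rot t v)), whose right side is as small
  as \<open>R\<close>.\<close>

definition rot :: "real \<Rightarrow> complex^'n \<Rightarrow> complex^'n" where
  "rot t v = (\<chi> j. exp (\<i> * complex_of_real (\<omega> j) * complex_of_real t) * v $ j)"

lemma norm_rot: "norm (rot t v) = norm v"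
  by (simp add: norm_vec_def rot_def norm_mult)

lemma rot_diff: "rot t (u - v) = rot t u - rot t v"
  by (simp add: rot_def vec_eq_iff right_diff_distrib)

lemma rot_rot_minus: "rot t (rot (- t) v) = v"
  by (simp add: rot_def vec_eq_iff mult.assoc[symmetric] exp_minus flip: exp_add)

lemma has_vector_derivative_rot:
  assumes "(v has_vector_derivative u) (at t within S)"
  shows "((\<lambda>t. rot t (v t)) has_vector_derivative (diag_lin \<omega> (rot t (v t)) + rot t u)) (at t within S)"
proof (rule has_vector_derivative_componentwise_vec)
  fix j
  let ?c = "\<i> * complex_of_real (\<omega> j)"
  have "((\<lambda>z. exp (?c * z)) has_field_derivative ?c * exp (?c * complex_of_real t)) (at (complex_of_real t))"
    by (auto intro!: derivative_eq_intros)
  then have "((\<lambda>t. exp (?c * complex_of_real t)) has_vector_derivative ?c * exp (?c * complex_of_real t)) (at t within S)"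
    by (rule has_vector_derivative_real_field)
  moreover have "((\<lambda>t. v t $ j) has_vector_derivative u $ j) (at t within S)"
    by (rule bounded_linear.has_vector_derivative[OF bounded_linear_vec_nth assms])
  ultimately have "((\<lambda>t. exp (?c * complex_of_real t) * v t $ j) has_vector_derivative
      exp (?c * complex_of_real t) * u $ j + ?c * exp (?c * complex_of_real t) * v t $ j) (at t within S)"
    by (rule has_vector_derivative_mult)
  then show "((\<lambda>t. rot t (v t) $ j) has_vector_derivative (diag_lin \<omega> (rot t (v t)) + rot t u) $ j) (at t within S)"
    by (simp add: rot_def diag_lin_def algebra_simps)
qed

lemma has_vector_derivative_H:
  assumes "(w has_vector_derivative u) (at t within S)"
  shows "((\<lambda>t. H (w t)) has_vector_derivative u + P (w t) u) (at t within S)"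
proof (rule has_vector_derivative_componentwise_vec)
  fix j
  have c: "((\<lambda>t. w t $ j) has_vector_derivative u $ j) (at t within S)" for j
    by (rule bounded_linear.has_vector_derivative[OF bounded_linear_vec_nth assms])
  have "((\<lambda>t. w t $ j + (\<Sum>s\<in>big_trees N j. tc s * mon (leaves s) (w t))) has_vector_derivative
      u $ j + (\<Sum>s\<in>big_trees N j. tc s * dmon (leaves s) (w t) u)) (at t within S)"
    by (intro has_vector_derivative_add c has_vector_derivative_sum
        bounded_linear.has_vector_derivative[OF bounded_linear_mult_right] has_vector_derivative_mon)
  then show "((\<lambda>t. H (w t) $ j) has_vector_derivative (u + P (w t) u) $ j) (at t within S)"
    by (simp add: H_def h_def P_def)
qed

lemma ex_preimage_H:
  assumes z0: "norm z0 \<le> \<rho> / 16"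
  obtains w0 where "norm w0 \<le> \<rho> / 8" "H w0 = z0"
proof -
  have "\<exists>!w\<in>cball 0 (\<rho> / 8). z0 - h w = w"
  proof (rule Banach_fix[where c = "1 / 4"])
    show "complete (cball (0 :: complex^'n) (\<rho> / 8))" by (simp add: complete_eq_closed)
    show "cball (0 :: complex^'n) (\<rho> / 8) \<noteq> {}" using \<rho> by simp
    show "(\<lambda>w. z0 - h w) ` cball 0 (\<rho> / 8) \<subseteq> cball 0 (\<rho> / 8)"
    proof (rule image_subsetI)
      fix w :: "complex^'n" assume "w \<in> cball 0 (\<rho> / 8)"
      then have w: "norm w \<le> \<rho> / 8" by simp
      then have "norm (h w) \<le> norm w / 4" using \<rho> by (intro h_bound) auto
      then have "norm (z0 - h w) \<le> \<rho> / 8" using norm_triangle_ineq4[of z0 "h w"] w z0 \<rho> by linarith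
      then show "z0 - h w \<in> cball 0 (\<rho> / 8)" by simp
    qed
    show "dist (z0 - h x) (z0 - h y) \<le> 1 / 4 * dist x y" if "x \<in> cball 0 (\<rho> / 8)" "y \<in> cball 0 (\<rho> / 8)" for x y
    proof -
      have "norm (h y - h x) \<le> norm (y - x) / 4" using that \<rho> by (intro h_lipschitz) auto
      then show ?thesis by (simp add: dist_norm norm_minus_commute)
    qed
  qed auto
  then obtain w where "norm w \<le> \<rho> / 8" "z0 - h w = w" by auto
  moreover from this have "H w = z0" unfolding H_def by (metis diff_add_cancel)
  ultimately show thesis using that by blast
qed

text \<open>The radii are nested: \<rho> / 16 for \<open>z0\<close>, \<rho> / 8 for
  \<open>w0\<close>, 3 \<rho> / 16 for the trajectory in \<open>w\<close>, all inside the ball of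
  radius \<rho> / 4 on which the estimates hold.\<close>

lemma solution_exists:
  assumes z0: "norm z0 \<le> \<rho> / 16"
  shows "\<exists>z. z 0 = z0 \<and> (\<forall>t\<in>{-T..T}. norm (z t) \<le> \<rho> / 2 \<and>
    (z has_vector_derivative F (z t)) (at t within {-T..T}))"
proof -
  obtain w0 where w0: "norm w0 \<le> \<rho> / 8" "H w0 = z0" using ex_preimage_H[OF z0] .
  have dom: "norm (rot t x) \<le> \<rho> / 4" if "x \<in> cball w0 (\<rho> / 16)" for x t
  proof -
    have "norm (x - w0) \<le> \<rho> / 16" using that by (simp add: dist_norm norm_minus_commute)
    then show ?thesis using w0(1) norm_triangle_sub[of x w0] \<rho> unfolding norm_rot by linarith
  qed
  have contR: "continuous_on (cball 0 (\<rho> / 4)) R"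
  proof (rule lipschitz_on_continuous_on, rule lipschitz_onI)
    show "dist (R x) (R y) \<le> 30 * (real CARD('n) * C) * \<rho> / 2 ^ N * dist x y"
      if "x \<in> cball 0 (\<rho> / 4)" "y \<in> cball 0 (\<rho> / 4)" for x y
      using R_lipschitz[of x y] that by (simp add: dist_norm)
  qed (use \<rho> C_nonneg in auto)
  let ?\<Phi> = "\<lambda>t x. rot (- t) (R (rot t x))"
  have controt: "continuous_on S (\<lambda>x. rot (f x) (g x))"
    if "continuous_on S f" "continuous_on S g" for S :: "(real \<times> (complex^'n)) set" and f g
    unfolding rot_def by (intro continuous_intros that)
  have "\<exists>v. v 0 = w0 \<and> (\<forall>t\<in>{-T..T}. v t \<in> cball w0 (\<rho> / 16) \<and>
      (v has_vector_derivative ?\<Phi> t (v t)) (at t within {-T..T}))"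
  proof (rule picard_lindeloef_interval[where L = "30 * (real CARD('n) * C) * \<rho> / 2 ^ N"
        and M = "6 * (real CARD('n) * C) * \<rho>\<^sup>2 / 2 ^ N"])
    have "continuous_on ({-T..T} \<times> cball w0 (\<rho> / 16)) (\<lambda>p. R (rot (fst p) (snd p)))"
    proof (rule continuous_on_compose2[OF contR])
      show "continuous_on ({-T..T} \<times> cball w0 (\<rho> / 16)) (\<lambda>p. rot (fst p) (snd p))"
        by (intro controt continuous_on_fst continuous_on_snd continuous_on_id)
      show "(\<lambda>p. rot (fst p) (snd p)) ` ({-T..T} \<times> cball w0 (\<rho> / 16)) \<subseteq> cball 0 (\<rho> / 4)"
        using dom by (auto simp del: mem_cball simp: mem_cball_0)
    qed
    then show "continuous_on ({-T..T} \<times> cball w0 (\<rho> / 16)) (\<lambda>(t, x). ?\<Phi> t x)"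
      unfolding case_prod_beta by (intro controt continuous_intros)
    fix t x y assume x: "x \<in> cball w0 (\<rho> / 16)"
    show "norm (?\<Phi> t x) \<le> 6 * (real CARD('n) * C) * \<rho>\<^sup>2 / 2 ^ N"
      unfolding norm_rot by (rule R_bound[OF dom[OF x]])
    assume y: "y \<in> cball w0 (\<rho> / 16)"
    show "norm (?\<Phi> t x - ?\<Phi> t y) \<le> 30 * (real CARD('n) * C) * \<rho> / 2 ^ N * norm (x - y)"
      using R_lipschitz[OF dom[OF x] dom[OF y], of t t] unfolding rot_diff[symmetric] norm_rot .
  qed (use T_bounds \<rho> C_nonneg in auto)
  then obtain v where v0: "v 0 = w0" and v: "\<And>t. t \<in> {-T..T} \<Longrightarrow> v t \<in> cball w0 (\<rho> / 16)"
    and v': "\<And>t. t \<in> {-T..T} \<Longrightarrow> (v has_vector_derivative ?\<Phi> t (v t)) (at t within {-T..T})"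
    by blast
  define w where "w t = rot t (v t)" for t
  have "H (w 0) = z0" using w0 v0 by (simp add: w_def rot_def)
  moreover have "norm (H (w t)) \<le> \<rho> / 2 \<and>
      ((\<lambda>t. H (w t)) has_vector_derivative F (H (w t))) (at t within {-T..T})" if t: "t \<in> {-T..T}" for t
  proof
    have wb: "norm (w t) \<le> \<rho> / 4" unfolding w_def by (rule dom[OF v[OF t]])
    then show "norm (H (w t)) \<le> \<rho> / 2" using H_bound[OF wb] \<rho> by linarith
    have "(w has_vector_derivative diag_lin \<omega> (w t) + R (w t)) (at t within {-T..T})"
      using has_vector_derivative_rot[OF v'[OF t]] by (simp add: rot_rot_minus w_def[abs_def])
    from has_vector_derivative_H[OF this]
    show "((\<lambda>t. H (w t)) has_vector_derivative F (H (w t))) (at t within {-T..T})"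
      using R_eq[OF wb] by (simp add: P_add E_def algebra_simps)
  qed
  ultimately show ?thesis by (intro exI[of _ "\<lambda>t. H (w t)"]) auto
qed

end

section \<open>Choice of the order of truncation and of the constants\<close>

theorem mainTheorem1:
  fixes \<omega> :: "'n::{finite,linorder} \<Rightarrow> real"
    and F :: "complex^('n::{finite,linorder}) \<Rightarrow> complex^'n::{finite,linorder}"
    and s :: real
  assumes n2: "CARD('n::{finite,linorder}) \<ge> 2"
    and anal: "cn_analytic_on F unit_polydisc"
    and f0: "F 0 = 0"
    and Df0: "((\<lambda>z. F z - diag_lin \<omega> z) has_derivative (\<lambda>h. 0)) (at 0)"
    and s_pos: "s > 0"
    and nonres: "non_resonant \<omega>"
    and bruno: "bruno_cond s \<omega> \<or>
                (CARD('n::{finite,linorder}) = 2 \<and> bruno1_cond s (\<omega> (Min UNIV)) (\<omega> (Max UNIV)))"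
  shows "\<exists>r0>0. \<forall>r. 0 < r \<and> r < r0 \<and> r < 1 \<longrightarrow>
           (\<exists>A>0. \<exists>B>0. \<exists>C>0. \<forall>z0 :: complex^'n::{finite,linorder}. 0 < supnorm z0 \<and> supnorm z0 < r / 2 \<longrightarrow>
              (let T = inverse A * exp (B * (r / supnorm z0) powr (1 / s)) in
               \<exists>z :: real \<Rightarrow> complex^'n::{finite,linorder}. z 0 = z0 \<and>
                 (\<forall>t. \<bar>t\<bar> \<le> T \<longrightarrow> z t \<in> unit_polydisc \<and>
                    (z has_vector_derivative F (z t)) (at t within {-T..T}) \<and>
                    supnorm (z t) \<le> C * r)))"
proof -
  obtain a R C where R: "0 < R" and C: "0 \<le> C" and short: "\<And>j xs. length xs < 2 \<Longrightarrow> a j xs = 0"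
    and exp: "\<And>j z. supnorm z \<le> R \<Longrightarrow>
      ((\<lambda>xs. a j xs * mon xs z) has_sum (F z $ j - \<i> * complex_of_real (\<omega> j) * z $ j)) UNIV"
    and maj: "\<And>j X y. finite X \<Longrightarrow> 0 \<le> y \<Longrightarrow> y \<le> R \<Longrightarrow> (\<Sum>xs\<in>X. cmod (a j xs) * y ^ length xs) \<le> C * y\<^sup>2"
    by (rule list_expansion_at_0[OF anal f0 Df0]) (rule that)
  interpret maj: majorized a R C
    by unfold_locales (use R C maj in auto)
  have "log_div_bound s \<omega>"
    using bruno log_div_bound_bruno[OF nonres _ s_pos] log_div_bound_two[OF nonres _ _ s_pos] by blast
  moreover have card_pos: "0 < 1 / (16 * real CARD('n))" by simp
  ultimately obtain \<sigma> where \<sigma>: "0 < \<sigma>" "\<sigma> \<le> 1" "2 * \<sigma> \<le> R"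
    and tail: "\<And>N j. 1 \<le> N \<Longrightarrow> (\<Sum>t\<in>big_trees N j. cmod (tcoeff \<omega> a t) * (\<sigma> * real N powr (- s)) ^ nl t)
      \<le> 1 / (16 * real CARD('n)) * (\<sigma> * real N powr (- s))"
    by (rule maj.sum_big_trees_tcoeff_le[OF nonres _ s_pos]) (rule that)
  define n where "n = real CARD('n)"
  have n: "1 \<le> n" using n2 by (simp add: n_def)
  have loc: "near_identity a R C F \<omega> N (\<sigma> * real N powr (- s))" if N: "1 \<le> N" for N
  proof -
    have "real N powr (- s) \<le> 1" using powr_mono[of "- s" 0 "real N"] N s_pos by simp
    then have "\<sigma> * real N powr (- s) \<le> \<sigma> * 1" using \<sigma> by (intro mult_left_mono) auto
    then have "\<sigma> * real N powr (- s) \<le> 1" "2 * (\<sigma> * real N powr (- s)) \<le> R"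
      using \<sigma> by linarith+
    then show ?thesis
      using short exp f0 nonres N tail[OF N] \<sigma> by unfold_locales auto
  qed
  define D where "D = n * C + 1"
  have D: "1 \<le> D" using n C by (simp add: D_def)
  have sol: "\<exists>z. z 0 = z0 \<and> (\<forall>t\<in>{-T..T}. norm (z t) \<le> 1 / 2 \<and>
      (z has_vector_derivative F (z t)) (at t within {-T..T}))"
    if N: "1 \<le> N" and z0: "norm z0 \<le> \<sigma> * real N powr (- s) / 16" and T: "T = 2 ^ N / (128 * D)" for N z0 T
  proof -
    interpret near_identity a R C F \<omega> N "\<sigma> * real N powr (- s)" by (rule loc[OF N])
    have T': "local.T = T" unfolding T_def T D_def n_def ..
    have "\<sigma> * real N powr (- s) / 2 \<le> 1 / 2" using \<rho>(2) by simp
    with solution_exists[OF z0, unfolded T'] show ?thesis by (elim exE) (intro exI, force)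
  qed
  show ?thesis
  proof (rule exI[of _ "\<sigma> / (8 * n)"], intro conjI allI impI)
    show "0 < \<sigma> / (8 * n)" using \<sigma> n by simp
    fix r assume r: "0 < r \<and> r < \<sigma> / (8 * n) \<and> r < 1"
    \<comment> \<open>128 comes from the existence time, the further factor 2 from rounding
      \<open>y\<close> down to \<open>N\<close>.\<close>
    define A where "A = 256 * D"
    \<comment> \<open>Chosen such that \<open>B * (r / x) powr (1 / s) = ln 2 * y\<close>, so that
      the exponential is \<open>2 powr y\<close>.\<close>
    define B where "B = ln 2 * (\<sigma> / (16 * n * r)) powr (1 / s)"
    have A: "0 < A" using D by (simp add: A_def)
    have B: "0 < B" using \<sigma> n r by (simp add: B_def)
    show "\<exists>A>0. \<exists>B>0. \<exists>C>0. \<forall>z0 :: complex^'n::{finite,linorder}. 0 < supnorm z0 \<and> supnorm z0 < r / 2 \<longrightarrow>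
              (let T = inverse A * exp (B * (r / supnorm z0) powr (1 / s)) in
               \<exists>z :: real \<Rightarrow> complex^'n::{finite,linorder}. z 0 = z0 \<and>
                 (\<forall>t. \<bar>t\<bar> \<le> T \<longrightarrow> z t \<in> unit_polydisc \<and>
                    (z has_vector_derivative F (z t)) (at t within {-T..T}) \<and>
                    supnorm (z t) \<le> C * r))"
    \<comment> \<open>The constant in the bound may depend on \<open>r\<close>; the trajectories
      stay within norm 1 / 2, so \<open>1 / r\<close> serves.\<close>
    proof (rule exI[of _ A], rule conjI[OF A], rule exI[of _ B], rule conjI[OF B],
        rule exI[of _ "1 / r"], intro conjI allI impI)
      show "0 < 1 / r" using r by simp
      fix z0 :: "complex^'n::{finite,linorder}" assume z0: "0 < supnorm z0 \<and> supnorm z0 < r / 2"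
      define x where "x = supnorm z0"
      have x: "0 < x" "x < r / 2" using z0 by (auto simp: x_def)
      \<comment> \<open>\<open>N powr s \<le> Y\<close> is equivalent to
        \<open>n * x \<le> \<sigma> * N powr (- s) / 16\<close>, the smallness of \<open>z0\<close>
        required at order \<open>N\<close>; the floor below picks the largest such \<open>N\<close>.
        The factor \<open>n\<close> passes from \<open>supnorm\<close> to the Euclidean
        norm.\<close>
      define Y where "Y = \<sigma> / (16 * n * x)"
      define y where "y = Y powr (1 / s)"
      define N where "N = nat \<lfloor>y\<rfloor>"
      define T where "T = inverse A * exp (B * (r / supnorm z0) powr (1 / s))"
      have "16 * n * x \<le> \<sigma>"
      proof -
        have "r * (8 * n) < \<sigma>" using r n by (simp add: pos_less_divide_eq)
        moreover have "16 * n * x \<le> 16 * n * (r / 2)" using x n by (intro mult_left_mono) auto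
        ultimately show ?thesis by (simp add: mult_ac)
      qed
      then have Y: "1 \<le> Y" using x n by (simp add: Y_def)
      then have y1: "1 \<le> y" unfolding y_def using s_pos by (intro ge_one_powr_ge_zero) auto
      then have N: "1 \<le> N" "real N \<le> y" "y < real N + 1" unfolding N_def by linarith+
      have "real N powr s \<le> y powr s" using N s_pos by (intro powr_mono2) auto
      also have "\<dots> = Y" unfolding y_def using Y s_pos by (simp add: powr_powr)
      finally have NY: "real N powr s \<le> Y" .
      have "norm z0 \<le> n * x"
        unfolding n_def by (rule norm_le_card_bound) (use supnorm_le_iff[of z0 x] in \<open>auto simp: x_def\<close>)
      also have "n * x = \<sigma> / Y / 16" using x n \<sigma> by (simp add: Y_def)
      also have "\<dots> \<le> \<sigma> / real N powr s / 16"
        using NY \<sigma> N Y by (intro divide_right_mono divide_left_mono) auto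
      finally have z0_small: "norm z0 \<le> \<sigma> * real N powr (- s) / 16"
        by (simp add: powr_minus field_simps)
      have T_le: "T \<le> 2 ^ N / (128 * D)"
      proof -
        have "Y = \<sigma> / (16 * n * r) * (r / x)" using r by (simp add: Y_def)
        then have "y = (\<sigma> / (16 * n * r)) powr (1 / s) * (r / x) powr (1 / s)"
          unfolding y_def using \<sigma> n r x by (simp only: powr_mult)
        then have "T = inverse A * exp (ln 2 * y)" by (simp add: T_def B_def x_def)
        also have "\<dots> \<le> inverse A * exp (ln 2 * (real N + 1))"
          using A N by (intro mult_left_mono) auto
        also have "exp (ln 2 * (real N + 1)) = 2 * (2::real) ^ N"
          by (simp add: distrib_left exp_add mult.commute[of "ln 2"] exp_of_nat_mult)
        finally show ?thesis using D by (simp add: A_def field_simps)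
      qed
      from sol[OF N(1) z0_small refl] obtain z where z: "z 0 = z0"
        "\<And>t. t \<in> {-(2 ^ N / (128 * D))..2 ^ N / (128 * D)} \<Longrightarrow> norm (z t) \<le> 1 / 2 \<and>
          (z has_vector_derivative F (z t)) (at t within {-(2 ^ N / (128 * D))..2 ^ N / (128 * D)})"
        by blast
      have "z t \<in> unit_polydisc \<and> (z has_vector_derivative F (z t)) (at t within {-T..T}) \<and> supnorm (z t) \<le> 1 / r * r"
        if t: "\<bar>t\<bar> \<le> T" for t
      proof (intro conjI)
        have t': "t \<in> {-(2 ^ N / (128 * D))..2 ^ N / (128 * D)}" using t T_le by auto
        have nz: "norm (z t) \<le> 1 / 2" using z(2)[OF t'] by blast
        have "cmod (z t $ j) < 1" for j
          using Finite_Cartesian_Product.norm_nth_le[of "z t" j] nz by linarith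
        then show "z t \<in> unit_polydisc" by (simp add: unit_polydisc_def)
        show "supnorm (z t) \<le> 1 / r * r" using supnorm_le_norm[of "z t"] nz r by simp
        have "{-T..T} \<subseteq> {-(2 ^ N / (128 * D))..2 ^ N / (128 * D)}" using T_le by auto
        then show "(z has_vector_derivative F (z t)) (at t within {-T..T})"
          using z(2)[OF t'] has_vector_derivative_within_subset by blast
      qed
      with z(1) show "let T = inverse A * exp (B * (r / supnorm z0) powr (1 / s)) in
               \<exists>z :: real \<Rightarrow> complex^'n::{finite,linorder}. z 0 = z0 \<and>
                 (\<forall>t. \<bar>t\<bar> \<le> T \<longrightarrow> z t \<in> unit_polydisc \<and>
                    (z has_vector_derivative F (z t)) (at t within {-T..T}) \<and>
                    supnorm (z t) \<le> 1 / r * r)"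
        unfolding Let_def T_def[symmetric] by blast
    qed
  qed
qed

end
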